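(* Let $n\ge1$, let $(\mathcal D,\Sigma,\mathcal P)$ be an $(n+2)$-angulated category with class of $(n+2)$-angles $\mathcal P$, and let $\mathcal B\subseteq\mathcal D$ be an $n$-extension closed additive subcategory. Then $(\mathcal B,\mathbb G_{\mathcal B},\mathfrak r_{\mathcal B})$ is an $n$-exangulated category, where $\mathbb G_{\mathcal B}$ is the restriction of the bifunctor $\mathbb G_\Sigma(-,-)=\mathcal D(-,\Sigma-)$ to $\mathcal B^{\mathrm{op}}\times\mathcal B$, and where for $A,C\in\mathcal B$ and $\delta\in\mathcal D(C,\Sigma A)$ one sets $\mathfrak r_{\mathcal B}(\delta):=[X_\bullet]_{\mathcal B}$ for any $(n+2)$-angle $A\xrightarrow{d^X_0}X_1\xrightarrow{d^X_1}\cdots\xrightarrow{d^X_{n-1}}X_n\xrightarrow{d^X_n}C\xrightarrow{\delta}\Sigma A$ in $\mathcal P$ with $X_1,\dots,X_n\in\mathcal B$, $X_\bullet$ being the truncated complex $A\to X_1\to\cdots\to X_n\to C$.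
   Context: **$(n+2)$-angulated categories (Geiss–Keller–Oppermann).** Let $\mathcal D$ be additive with an additive automorphism $\Sigma$. An $(n+2)$-$\Sigma$-sequence is a sequence of morphisms $X_0\xrightarrow{\alpha_0}X_1\xrightarrow{\alpha_1}\cdots\xrightarrow{\alpha_n}X_{n+1}\xrightarrow{\alpha_{n+1}}\Sigma X_0$; its left rotation is $X_1\xrightarrow{\alpha_1}\cdots\to X_{n+1}\xrightarrow{\alpha_{n+1}}\Sigma X_0\xrightarrow{(-1)^{n}\Sigma\alpha_0}\Sigma X_1$. A morphism of such sequences is $(\varphi_0,\dots,\varphi_{n+1})$ making all squares commute, including the last one with $\Sigma\varphi_0$. $(\mathcal D,\Sigma,\mathcal P)$ is $(n+2)$-angulated if $\mathcal P$ is a class of $(n+2)$-$\Sigma$-sequences (called $(n+2)$-angles) with: (F1) $\mathcal P$ is closed under isomorphisms, direct sums and direct summands; for all $X$ the sequence $X\xrightarrow{\mathrm{id}}X\to0\to\cdots\to0\to\Sigma X$ is in $\mathcal P$; every morphism of $\mathcal D$ is the first morphism of some member of $\mathcal P$; (F2) a sequence is in $\mathcal P$ iff its left rotation is; (F3) given two members $(X,\alpha)$, $(Y,\beta)$ of $\mathcal P$ and $\varphi_0,\varphi_1$ with $\varphi_1\alpha_0=\beta_0\varphi_0$, there are $\varphi_2,\dots,\varphi_{n+1}$ completing these to a morphism of sequences; (F4) in (F3) these can be chosen so that the cone $X_1\oplus Y_0\to X_2\oplus Y_1\to\cdots\to X_{n+1}\oplus Y_n\to\Sigma X_0\oplus Y_{n+1}\to\Sigma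 X_1\oplus\Sigma Y_0$ with maps $\begin{bmatrix}-\alpha_{i}&0\\ \varphi_{i}&\beta_{i-1}\end{bmatrix}$ ($i=1,\dots,n+1$) and last map $\begin{bmatrix}-\Sigma\alpha_0&0\\ \Sigma\varphi_0&\beta_{n+1}\end{bmatrix}$ is in $\mathcal P$. **Subcategories.** An additive subcategory is a full subcategory closed under isomorphisms and finite direct sums and containing $0$ (not necessarily closed under direct summands). An additive subcategory $\mathcal B\subseteq\mathcal D$ is $n$-extension closed if for all $A,C\in\mathcal B$ and $\delta\in\mathcal D(C,\Sigma A)$ there is an $(n+2)$-angle $A\to X_1\to\cdots\to X_n\to C\xrightarrow{\delta}\Sigma A$ with $X_1,\dots,X_n\in\mathcal B$. The class $\mathfrak r_{\mathcal B}(\delta)$ does not depend on the chosen $(n+2)$-angle. The bifunctor $\mathbb G_\Sigma$ is $\mathbb G_\Sigma(C,A)=\mathcal D(C,\Sigma A)$, with $\mathbb G_\Sigma(c,a)(\delta)=(\Sigma a)\,\delta\,c$. **Complexes.** For an additive category $\mathcal D$, $\mathbf C^{n+2}_{\mathcal D}$ is the category of complexes $X_\bullet\colon X_0\xrightarrow{d^X_0}X_1\to\cdots\to X_n\xrightarrow{d^X_n}X_{n+1}$ over $\mathcal D$ concentrated in degrees $0,\dots,n+1$, with chain maps $f_\bullet=(f_0,\dots,f_{n+1})$. For $A,C\in\mathcal D$, $\mathbf C^{n+2}_{(\mathcal D;A,C)}$ is its subcategory of complexes with $X_0=A$, $X_{n+1}=C$ and chain maps with $f_0=\mathrm{id}_A$,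 $f_{n+1}=\mathrm{id}_C$; two of its morphisms are homotopic if their difference is null-homotopic as a chain map, and $[X_\bullet]_{\mathcal D}$ is the resulting homotopy equivalence class of $X_\bullet$ in $\mathbf C^{n+2}_{(\mathcal D;A,C)}$ (similarly $[X_\bullet]_{\mathcal B}$). For $X\in\mathcal D$ and $0\le i\le n$, $\mathrm{triv}_i(X)_\bullet$ has $X$ in degrees $i,i+1$ with differential $\mathrm{id}_X$ between them and $0$ elsewhere. **Extensions.** Let $\mathbb G\colon\mathcal D^{\mathrm{op}}\times\mathcal D\to\mathsf{Ab}$ be biadditive. For $\delta\in\mathbb G(C,A)$, $a\colon A\to B$, $c\colon D\to C$ write $a_*\delta=\mathbb G(C,a)(\delta)$ and $c^*\delta=\mathbb G(c,A)(\delta)$. For $\delta\in\mathbb G(C,A)$, $\rho\in\mathbb G(D,B)$, a morphism $(a,c)\colon\delta\to\rho$ is a pair $a\colon A\to B$, $c\colon C\to D$ with $a_*\delta=c^*\rho$. An $n$-exangle is a pair $\langle X_\bullet,\delta\rangle$ with $X_\bullet\in\mathbf C^{n+2}_{\mathcal D}$, $\delta\in\mathbb G(X_{n+1},X_0)$, $(d^X_0)_*\delta=0$, $(d^X_n)^*\delta=0$, such that for all $X\in\mathcal D$ the sequences $\mathcal D(X,X_0)\to\cdots\to\mathcal D(X,X_{n+1})\to\mathbb G(X,X_0)$ (last map $f\mapsto f^*\delta$) and $\mathcal D(X_{n+1},X)\to\cdots\to\mathcal D(X_0,X)\to\mathbb G(X_{n+1},X)$ (last map $g\mapsto g_*\delta$)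 are exact. **Exact realisation.** An exact realisation $\mathfrak r$ of $\mathbb G$ assigns to each $\delta\in\mathbb G(C,A)$ a homotopy equivalence class $\mathfrak r(\delta)$ of an object of $\mathbf C^{n+2}_{(\mathcal D;A,C)}$ such that: (R0) if $[X_\bullet]_{\mathcal D}=\mathfrak r(\delta)$, $[Y_\bullet]_{\mathcal D}=\mathfrak r(\rho)$ and $(a,c)\colon\delta\to\rho$ is a morphism of extensions, there is a chain map $f_\bullet\colon X_\bullet\to Y_\bullet$ (a lift of $(a,c)$) with $f_0=a$, $f_{n+1}=c$; (R1) if $\mathfrak r(\delta)=[X_\bullet]_{\mathcal D}$ then $\langle X_\bullet,\delta\rangle$ is an $n$-exangle; (R2) for all $A,C\in\mathcal D$, $\mathfrak r$ sends $0\in\mathbb G(0,A)$ to $[\mathrm{triv}_0(A)_\bullet]_{\mathcal D}$ and $0\in\mathbb G(C,0)$ to $[\mathrm{triv}_n(C)_\bullet]_{\mathcal D}$. If $\mathfrak r(\delta)=[X_\bullet]_{\mathcal D}$, then $\langle X_\bullet,\delta\rangle$ is called $\mathfrak r$-distinguished, $X_\bullet$ an $\mathfrak r$-conflation, $d^X_0$ an $\mathfrak r$-inflation and $d^X_n$ an $\mathfrak r$-deflation. **$n$-exangulated category.** A triple $(\mathcal D,\mathbb G,\mathfrak r)$ with $\mathcal D$ additive, $\mathbb G$ biadditive and $\mathfrak r$ an exact realisation of $\mathbb G$ such that: (EA1) $\mathfrak r$-inflations are closed under composition; (EA1$^{\mathrm{op}}$) $\mathfrak r$-deflations are closed under composition;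 (EA2) for $c\colon X_{n+1}\to Y_{n+1}$ and $\mathfrak r$-distinguished $\langle X_\bullet,c^*\rho\rangle$, $\langle Y_\bullet,\rho\rangle$ with $A:=X_0=Y_0$, there is a lift $f_\bullet$ of $(\mathrm{id}_A,c)$ such that $\langle M^f_\bullet,(d^X_0)_*\rho\rangle$ is $\mathfrak r$-distinguished, where $M^f_\bullet$ is the complex $X_1\to X_2\oplus Y_1\to\cdots\to X_{n+1}\oplus Y_n\to Y_{n+1}$ with differentials $\begin{bmatrix}-d^X_1\\ f_1\end{bmatrix}$, then $\begin{bmatrix}-d^X_{i}&0\\ f_{i}&d^Y_{i-1}\end{bmatrix}$ for $i=2,\dots,n$, then $\begin{bmatrix}f_{n+1}&d^Y_n\end{bmatrix}$; (EA2$^{\mathrm{op}}$) for $a\colon X_0\to Y_0$ and $\mathfrak r$-distinguished $\langle X_\bullet,\delta\rangle$, $\langle Y_\bullet,a_*\delta\rangle$ with $C:=X_{n+1}=Y_{n+1}$, there is a lift $f_\bullet$ of $(a,\mathrm{id}_C)$ such that $\langle N^f_\bullet,(d^Y_n)^*\delta\rangle$ is $\mathfrak r$-distinguished, where $N^f_\bullet$ is the complex $X_0\to X_1\oplus Y_0\to\cdots\to X_n\oplus Y_{n-1}\to Y_n$ with differentials $\begin{bmatrix}d^X_0\\ f_0\end{bmatrix}$, then $\begin{bmatrix}d^X_i&0\\ f_i&-d^Y_{i-1}\end{bmatrix}$ for $i=1,\dots,n-1$, then $\begin{bmatrix}f_n&-d^Y_{n-1}\end{bmatrix}$. *)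

theory Defs
  imports "HOL-Algebra.Coset"
begin

section \<open>Additive categories\<close>

text \<open>
  Abelian groups are groups in the sense of \<^locale>\<open>comm_group\<close>, hence written multiplicatively:
  the sum of \<open>f, g \<in> D(A, B)\<close> is \<open>f \<otimes>\<^bsub>Hom D A B\<^esub> g\<close>, the zero morphism is \<open>\<one>\<^bsub>Hom D A B\<^esub>\<close>.
  A category carries a choice of a zero object and of binary biproducts (object, injections,
  projections).  Values of the fields at arguments outside \<open>Ob\<close> are irrelevant.
\<close>

record ('o, 'm) addcat =
  Ob :: "'o set"
  Hom :: "'o \<Rightarrow> 'o \<Rightarrow> 'm monoid"
  Comp :: "'m \<Rightarrow> 'm \<Rightarrow> 'm" (infixl \<open>\<cdot>\<index>\<close> 75)
  Id :: "'o \<Rightarrow> 'm"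
  Zer :: "'o"
  Sum :: "'o \<Rightarrow> 'o \<Rightarrow> 'o"
  In1 :: "'o \<Rightarrow> 'o \<Rightarrow> 'm"
  In2 :: "'o \<Rightarrow> 'o \<Rightarrow> 'm"
  Pr1 :: "'o \<Rightarrow> 'o \<Rightarrow> 'm"
  Pr2 :: "'o \<Rightarrow> 'o \<Rightarrow> 'm"

abbreviation mor :: "('o, 'm) addcat \<Rightarrow> 'o \<Rightarrow> 'o \<Rightarrow> 'm set" where
  "mor D A B \<equiv> carrier (Hom D A B)"

abbreviation zero_mor :: "('o, 'm) addcat \<Rightarrow> 'o \<Rightarrow> 'o \<Rightarrow> 'm" where
  "zero_mor D A B \<equiv> \<one>\<^bsub>Hom D A B\<^esub>"

abbreviation neg_mor :: "('o, 'm) addcat \<Rightarrow> 'o \<Rightarrow> 'o \<Rightarrow> 'm \<Rightarrow> 'm" where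
  "neg_mor D A B f \<equiv> inv\<^bsub>Hom D A B\<^esub> f"

abbreviation add_mor :: "('o, 'm) addcat \<Rightarrow> 'o \<Rightarrow> 'o \<Rightarrow> 'm \<Rightarrow> 'm \<Rightarrow> 'm" where
  "add_mor D A B f g \<equiv> f \<otimes>\<^bsub>Hom D A B\<^esub> g"

locale additive_category =
  fixes D :: "('o, 'm) addcat" (structure)
  assumes hom_group: "\<lbrakk>A \<in> Ob D; B \<in> Ob D\<rbrakk> \<Longrightarrow> comm_group (Hom D A B)"
    and hom_disjoint:
      "\<lbrakk>A \<in> Ob D; B \<in> Ob D; A' \<in> Ob D; B' \<in> Ob D; f \<in> mor D A B; f \<in> mor D A' B'\<rbrakk>
        \<Longrightarrow> A = A' \<and> B = B'"
    and id_mor: "A \<in> Ob D \<Longrightarrow> Id D A \<in> mor D A A"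
    and comp_mor:
      "\<lbrakk>A \<in> Ob D; B \<in> Ob D; C \<in> Ob D; f \<in> mor D A B; g \<in> mor D B C\<rbrakk> \<Longrightarrow> g \<cdot> f \<in> mor D A C"
    and comp_id: "\<lbrakk>A \<in> Ob D; B \<in> Ob D; f \<in> mor D A B\<rbrakk> \<Longrightarrow> f \<cdot> Id D A = f"
    and id_comp: "\<lbrakk>A \<in> Ob D; B \<in> Ob D; f \<in> mor D A B\<rbrakk> \<Longrightarrow> Id D B \<cdot> f = f"
    and comp_assoc:
      "\<lbrakk>A \<in> Ob D; B \<in> Ob D; C \<in> Ob D; E \<in> Ob D; f \<in> mor D A B; g \<in> mor D B C; h \<in> mor D C E\<rbrakk>
        \<Longrightarrow> h \<cdot> g \<cdot> f = h \<cdot> (g \<cdot> f)"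
    and comp_add_right:
      "\<lbrakk>A \<in> Ob D; B \<in> Ob D; C \<in> Ob D; f \<in> mor D A B; f' \<in> mor D A B; g \<in> mor D B C\<rbrakk>
        \<Longrightarrow> g \<cdot> (add_mor D A B f f') = add_mor D A C (g \<cdot> f) (g \<cdot> f')"
    and comp_add_left:
      "\<lbrakk>A \<in> Ob D; B \<in> Ob D; C \<in> Ob D; f \<in> mor D A B; g \<in> mor D B C; g' \<in> mor D B C\<rbrakk>
        \<Longrightarrow> (add_mor D B C g g') \<cdot> f = add_mor D A C (g \<cdot> f) (g' \<cdot> f)"
    and zero_ob: "Zer D \<in> Ob D"
    and zero_initial: "A \<in> Ob D \<Longrightarrow> mor D (Zer D) A = {zero_mor D (Zer D) A}"
    and zero_terminal: "A \<in> Ob D \<Longrightarrow> mor D A (Zer D) = {zero_mor D A (Zer D)}"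
    and sum_ob: "\<lbrakk>A \<in> Ob D; B \<in> Ob D\<rbrakk> \<Longrightarrow> Sum D A B \<in> Ob D"
    and in_mor:
      "\<lbrakk>A \<in> Ob D; B \<in> Ob D\<rbrakk> \<Longrightarrow> In1 D A B \<in> mor D A (Sum D A B)"
      "\<lbrakk>A \<in> Ob D; B \<in> Ob D\<rbrakk> \<Longrightarrow> In2 D A B \<in> mor D B (Sum D A B)"
    and pr_mor:
      "\<lbrakk>A \<in> Ob D; B \<in> Ob D\<rbrakk> \<Longrightarrow> Pr1 D A B \<in> mor D (Sum D A B) A"
      "\<lbrakk>A \<in> Ob D; B \<in> Ob D\<rbrakk> \<Longrightarrow> Pr2 D A B \<in> mor D (Sum D A B) B"
    and pr_in:
      "\<lbrakk>A \<in> Ob D; B \<in> Ob D\<rbrakk> \<Longrightarrow> Pr1 D A B \<cdot> In1 D A B = Id D A"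
      "\<lbrakk>A \<in> Ob D; B \<in> Ob D\<rbrakk> \<Longrightarrow> Pr2 D A B \<cdot> In2 D A B = Id D B"
      "\<lbrakk>A \<in> Ob D; B \<in> Ob D\<rbrakk> \<Longrightarrow> Pr1 D A B \<cdot> In2 D A B = zero_mor D B A"
      "\<lbrakk>A \<in> Ob D; B \<in> Ob D\<rbrakk> \<Longrightarrow> Pr2 D A B \<cdot> In1 D A B = zero_mor D A B"
    and in_pr:
      "\<lbrakk>A \<in> Ob D; B \<in> Ob D\<rbrakk> \<Longrightarrow>
        add_mor D (Sum D A B) (Sum D A B) (In1 D A B \<cdot> Pr1 D A B) (In2 D A B \<cdot> Pr2 D A B)
          = Id D (Sum D A B)"

definition isomorphic :: "('o, 'm) addcat \<Rightarrow> 'o \<Rightarrow> 'o \<Rightarrow> bool" where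
  "isomorphic D A B \<longleftrightarrow>
    (\<exists>f \<in> mor D A B. \<exists>g \<in> mor D B A. g \<cdot>\<^bsub>D\<^esub> f = Id D A \<and> f \<cdot>\<^bsub>D\<^esub> g = Id D B)"

text \<open>The column \<open>[f; g] : X \<rightarrow> A \<oplus> B\<close>, the row \<open>[f, g] : A \<oplus> B \<rightarrow> X\<close>, and the matrix
  \<open>[a, b; c, e] : A \<oplus> B \<rightarrow> A' \<oplus> B'\<close>.\<close>

definition col :: "('o, 'm) addcat \<Rightarrow> 'o \<Rightarrow> 'o \<Rightarrow> 'o \<Rightarrow> 'm \<Rightarrow> 'm \<Rightarrow> 'm" where
  "col D X A B f g = add_mor D X (Sum D A B) (In1 D A B \<cdot>\<^bsub>D\<^esub> f) (In2 D A B \<cdot>\<^bsub>D\<^esub> g)"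

definition row :: "('o, 'm) addcat \<Rightarrow> 'o \<Rightarrow> 'o \<Rightarrow> 'o \<Rightarrow> 'm \<Rightarrow> 'm \<Rightarrow> 'm" where
  "row D A B X f g = add_mor D (Sum D A B) X (f \<cdot>\<^bsub>D\<^esub> Pr1 D A B) (g \<cdot>\<^bsub>D\<^esub> Pr2 D A B)"

definition matrix22 ::
  "('o, 'm) addcat \<Rightarrow> 'o \<Rightarrow> 'o \<Rightarrow> 'o \<Rightarrow> 'o \<Rightarrow> 'm \<Rightarrow> 'm \<Rightarrow> 'm \<Rightarrow> 'm \<Rightarrow> 'm" where
  "matrix22 D A B A' B' a b c e =
    row D A B (Sum D A' B') (col D A A' B' a c) (col D B A' B' b e)"


section \<open>Complexes\<close>

text \<open>
  The following record represents complexes concentrated in degrees \<open>0, \<dots>, n + 1\<close>, where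
  \<open>Obj X i\<close> matters for \<open>i \<le> n + 1\<close> and \<open>Dif X i : X\<^sub>i \<rightarrow> X\<^sub>i\<^sub>+\<^sub>1\<close> for \<open>i \<le> n\<close>; and also
  \<open>(n+2)\<close>-\<open>\<Sigma>\<close>-sequences, where in addition \<open>Dif X (n + 1) : X\<^sub>n\<^sub>+\<^sub>1 \<rightarrow> \<Sigma> X\<^sub>0\<close> matters.  So truncating a
  sequence means to forget about the value of \<open>Dif X (n + 1)\<close>, and no operation is needed for this.
\<close>

record ('o, 'm) chain =
  Obj :: "nat \<Rightarrow> 'o"
  Dif :: "nat \<Rightarrow> 'm"

definition complex :: "('o, 'm) addcat \<Rightarrow> nat \<Rightarrow> ('o, 'm) chain \<Rightarrow> bool" where
  "complex D n X \<longleftrightarrow>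
    (\<forall>i \<le> n + 1. Obj X i \<in> Ob D) \<and>
    (\<forall>i \<le> n. Dif X i \<in> mor D (Obj X i) (Obj X (i + 1))) \<and>
    (\<forall>i < n. Dif X (i + 1) \<cdot>\<^bsub>D\<^esub> Dif X i = zero_mor D (Obj X i) (Obj X (i + 2)))"

definition chain_map ::
  "('o, 'm) addcat \<Rightarrow> nat \<Rightarrow> ('o, 'm) chain \<Rightarrow> ('o, 'm) chain \<Rightarrow> (nat \<Rightarrow> 'm) \<Rightarrow> bool" where
  "chain_map D n X Y f \<longleftrightarrow>
    (\<forall>i \<le> n + 1. f i \<in> mor D (Obj X i) (Obj Y i)) \<and>
    (\<forall>i \<le> n. f (i + 1) \<cdot>\<^bsub>D\<^esub> Dif X i = Dif Y i \<cdot>\<^bsub>D\<^esub> f i)"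

definition null_homotopic ::
  "('o, 'm) addcat \<Rightarrow> nat \<Rightarrow> ('o, 'm) chain \<Rightarrow> ('o, 'm) chain \<Rightarrow> (nat \<Rightarrow> 'm) \<Rightarrow> bool" where
  "null_homotopic D n X Y h \<longleftrightarrow>
    (\<exists>s. (\<forall>i \<in> {1..n + 1}. s i \<in> mor D (Obj X i) (Obj Y (i - 1))) \<and>
      h 0 = s 1 \<cdot>\<^bsub>D\<^esub> Dif X 0 \<and>
      (\<forall>i \<in> {1..n}. h i =
        add_mor D (Obj X i) (Obj Y i) (Dif Y (i - 1) \<cdot>\<^bsub>D\<^esub> s i) (s (i + 1) \<cdot>\<^bsub>D\<^esub> Dif X i)) \<and>
      h (n + 1) = Dif Y n \<cdot>\<^bsub>D\<^esub> s (n + 1))"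

definition homotopic_maps ::
  "('o, 'm) addcat \<Rightarrow> nat \<Rightarrow> ('o, 'm) chain \<Rightarrow> ('o, 'm) chain \<Rightarrow> (nat \<Rightarrow> 'm) \<Rightarrow> (nat \<Rightarrow> 'm) \<Rightarrow> bool"
  where
  "homotopic_maps D n X Y f g \<longleftrightarrow>
    null_homotopic D n X Y
      (\<lambda>i. add_mor D (Obj X i) (Obj Y i) (f i) (neg_mor D (Obj X i) (Obj Y i) (g i)))"

text \<open>The category of complexes with fixed end terms \<open>A\<close> (degree \<open>0\<close>) and \<open>C\<close>
  (degree \<open>n + 1\<close>).\<close>

definition complexes_between ::
  "('o, 'm) addcat \<Rightarrow> nat \<Rightarrow> 'o \<Rightarrow> 'o \<Rightarrow> ('o, 'm) chain set" where
  "complexes_between D n A C = {X. complex D n X \<and> Obj X 0 = A \<and> Obj X (n + 1) = C}"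

definition chain_map_between ::
  "('o, 'm) addcat \<Rightarrow> nat \<Rightarrow> 'o \<Rightarrow> 'o \<Rightarrow> ('o, 'm) chain \<Rightarrow> ('o, 'm) chain \<Rightarrow> (nat \<Rightarrow> 'm) \<Rightarrow> bool"
  where
  "chain_map_between D n A C X Y f \<longleftrightarrow>
    chain_map D n X Y f \<and> f 0 = Id D A \<and> f (n + 1) = Id D C"

definition homotopy_equivalent ::
  "('o, 'm) addcat \<Rightarrow> nat \<Rightarrow> 'o \<Rightarrow> 'o \<Rightarrow> ('o, 'm) chain \<Rightarrow> ('o, 'm) chain \<Rightarrow> bool" where
  "homotopy_equivalent D n A C X Y \<longleftrightarrow>
    (\<exists>f g. chain_map_between D n A C X Y f \<and> chain_map_between D n A C Y X g \<and>
      homotopic_maps D n X X (\<lambda>i. g i \<cdot>\<^bsub>D\<^esub> f i) (\<lambda>i. Id D (Obj X i)) \<and>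
      homotopic_maps D n Y Y (\<lambda>i. f i \<cdot>\<^bsub>D\<^esub> g i) (\<lambda>i. Id D (Obj Y i)))"

definition homotopy_class ::
  "('o, 'm) addcat \<Rightarrow> nat \<Rightarrow> ('o, 'm) chain \<Rightarrow> ('o, 'm) chain set" where
  "homotopy_class D n X =
    {Y \<in> complexes_between D n (Obj X 0) (Obj X (n + 1)).
      homotopy_equivalent D n (Obj X 0) (Obj X (n + 1)) X Y}"

definition triv :: "('o, 'm) addcat \<Rightarrow> nat \<Rightarrow> 'o \<Rightarrow> ('o, 'm) chain" where
  "triv D i A =
    (let X = (\<lambda>k. if k = i \<or> k = i + 1 then A else Zer D) in
      \<lparr>Obj = X, Dif = (\<lambda>k. if k = i then Id D A else zero_mor D (X k) (X (k + 1)))\<rparr>)"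


section \<open>Angulated categories\<close>

record ('o, 'm) endofunctor =
  FOb :: "'o \<Rightarrow> 'o"
  FMor :: "'m \<Rightarrow> 'm"

locale additive_automorphism = additive_category D
  for D :: "('o, 'm) addcat" (structure) +
  fixes \<Sigma> :: "('o, 'm) endofunctor"
  assumes F_ob: "bij_betw (FOb \<Sigma>) (Ob D) (Ob D)"
    and F_iso: "\<lbrakk>A \<in> Ob D; B \<in> Ob D\<rbrakk> \<Longrightarrow> FMor \<Sigma> \<in> iso (Hom D A B) (Hom D (FOb \<Sigma> A) (FOb \<Sigma> B))"
    and F_id: "A \<in> Ob D \<Longrightarrow> FMor \<Sigma> (Id D A) = Id D (FOb \<Sigma> A)"
    and F_comp:
      "\<lbrakk>A \<in> Ob D; B \<in> Ob D; C \<in> Ob D; f \<in> mor D A B; g \<in> mor D B C\<rbrakk>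
        \<Longrightarrow> FMor \<Sigma> (g \<cdot> f) = FMor \<Sigma> g \<cdot> FMor \<Sigma> f"

text \<open>The canonical isomorphism \<open>\<Sigma>A \<oplus> \<Sigma>B \<rightarrow> \<Sigma>(A \<oplus> B)\<close>.  It is usually suppressed, but the chosen
  biproducts need not be preserved strictly by \<open>\<Sigma>\<close>.\<close>

definition sum_shift ::
  "('o, 'm) addcat \<Rightarrow> ('o, 'm) endofunctor \<Rightarrow> 'o \<Rightarrow> 'o \<Rightarrow> 'm" where
  "sum_shift D \<Sigma> A B =
    row D (FOb \<Sigma> A) (FOb \<Sigma> B) (FOb \<Sigma> (Sum D A B)) (FMor \<Sigma> (In1 D A B)) (FMor \<Sigma> (In2 D A B))"

definition sigma_seq ::
  "nat \<Rightarrow> ('o, 'm) addcat \<Rightarrow> ('o, 'm) endofunctor \<Rightarrow> ('o, 'm) chain \<Rightarrow> bool" where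
  "sigma_seq n D \<Sigma> X \<longleftrightarrow>
    (\<forall>i \<le> n + 1. Obj X i \<in> Ob D) \<and>
    (\<forall>i \<le> n. Dif X i \<in> mor D (Obj X i) (Obj X (i + 1))) \<and>
    Dif X (n + 1) \<in> mor D (Obj X (n + 1)) (FOb \<Sigma> (Obj X 0))"

definition sigma_seq_map ::
  "nat \<Rightarrow> ('o, 'm) addcat \<Rightarrow> ('o, 'm) endofunctor \<Rightarrow>
    ('o, 'm) chain \<Rightarrow> ('o, 'm) chain \<Rightarrow> (nat \<Rightarrow> 'm) \<Rightarrow> bool" where
  "sigma_seq_map n D \<Sigma> X Y \<phi> \<longleftrightarrow>
    (\<forall>i \<le> n + 1. \<phi> i \<in> mor D (Obj X i) (Obj Y i)) \<and>
    (\<forall>i \<le> n. \<phi> (i + 1) \<cdot>\<^bsub>D\<^esub> Dif X i = Dif Y i \<cdot>\<^bsub>D\<^esub> \<phi> i) \<and>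
    FMor \<Sigma> (\<phi> 0) \<cdot>\<^bsub>D\<^esub> Dif X (n + 1) = Dif Y (n + 1) \<cdot>\<^bsub>D\<^esub> \<phi> (n + 1)"

definition sigma_seq_isomorphic ::
  "nat \<Rightarrow> ('o, 'm) addcat \<Rightarrow> ('o, 'm) endofunctor \<Rightarrow> ('o, 'm) chain \<Rightarrow> ('o, 'm) chain \<Rightarrow> bool" where
  "sigma_seq_isomorphic n D \<Sigma> X Y \<longleftrightarrow>
    (\<exists>\<phi> \<psi>. sigma_seq_map n D \<Sigma> X Y \<phi> \<and> sigma_seq_map n D \<Sigma> Y X \<psi> \<and>
      (\<forall>i \<le> n + 1. \<psi> i \<cdot>\<^bsub>D\<^esub> \<phi> i = Id D (Obj X i) \<and> \<phi> i \<cdot>\<^bsub>D\<^esub> \<psi> i = Id D (Obj Y i)))"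

definition left_rotation ::
  "nat \<Rightarrow> ('o, 'm) addcat \<Rightarrow> ('o, 'm) endofunctor \<Rightarrow> ('o, 'm) chain \<Rightarrow> ('o, 'm) chain" where
  "left_rotation n D \<Sigma> X =
    \<lparr>Obj = (\<lambda>i. if i \<le> n then Obj X (i + 1) else FOb \<Sigma> (Obj X 0)),
     Dif = (\<lambda>i. if i \<le> n then Dif X (i + 1)
       else if even n then FMor \<Sigma> (Dif X 0)
       else neg_mor D (FOb \<Sigma> (Obj X 0)) (FOb \<Sigma> (Obj X 1)) (FMor \<Sigma> (Dif X 0)))\<rparr>"

definition trivial_angle ::
  "nat \<Rightarrow> ('o, 'm) addcat \<Rightarrow> ('o, 'm) endofunctor \<Rightarrow> 'o \<Rightarrow> ('o, 'm) chain" where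
  "trivial_angle n D \<Sigma> A =
    \<lparr>Obj = Obj (triv D 0 A),
     Dif = (\<lambda>i. if i \<le> n then Dif (triv D 0 A) i else zero_mor D (Zer D) (FOb \<Sigma> A))\<rparr>"

definition direct_sum ::
  "nat \<Rightarrow> ('o, 'm) addcat \<Rightarrow> ('o, 'm) endofunctor \<Rightarrow>
    ('o, 'm) chain \<Rightarrow> ('o, 'm) chain \<Rightarrow> ('o, 'm) chain" where
  "direct_sum n D \<Sigma> X Y =
    (let diag = (\<lambda>A B A' B' f g. matrix22 D A B A' B' f (zero_mor D B A') (zero_mor D A B') g) in
      \<lparr>Obj = (\<lambda>i. Sum D (Obj X i) (Obj Y i)),
       Dif = (\<lambda>i.
         if i \<le> n
         then diag (Obj X i) (Obj Y i) (Obj X (i + 1)) (Obj Y (i + 1)) (Dif X i) (Dif Y i)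
         else sum_shift D \<Sigma> (Obj X 0) (Obj Y 0) \<cdot>\<^bsub>D\<^esub>
           diag (Obj X (n + 1)) (Obj Y (n + 1)) (FOb \<Sigma> (Obj X 0)) (FOb \<Sigma> (Obj Y 0))
             (Dif X (n + 1)) (Dif Y (n + 1)))\<rparr>)"

text \<open>In the cone, \<open>x i\<close> is \<open>X\<^sub>i\<close> for \<open>i \<le> n + 1\<close> and \<open>\<Sigma>X\<^sub>0\<close> for \<open>i = n + 2\<close>.  The map leaving
  position \<open>i \<le> n\<close> is the one with \<open>-\<alpha>\<^sub>i\<^sub>+\<^sub>1\<close>, \<open>\<phi>\<^sub>i\<^sub>+\<^sub>1\<close> and \<open>\<beta>\<^sub>i\<close> as entries.\<close>

definition cone ::
  "nat \<Rightarrow> ('o, 'm) addcat \<Rightarrow> ('o, 'm) endofunctor \<Rightarrow>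
    ('o, 'm) chain \<Rightarrow> ('o, 'm) chain \<Rightarrow> (nat \<Rightarrow> 'm) \<Rightarrow> ('o, 'm) chain" where
  "cone n D \<Sigma> X Y \<phi> =
    (let x = (\<lambda>i. if i \<le> n + 1 then Obj X i else FOb \<Sigma> (Obj X 0));
         y = Obj Y in
      \<lparr>Obj = (\<lambda>i. Sum D (x (i + 1)) (y i)),
       Dif = (\<lambda>i.
         if i \<le> n
         then matrix22 D (x (i + 1)) (y i) (x (i + 2)) (y (i + 1))
           (neg_mor D (x (i + 1)) (x (i + 2)) (Dif X (i + 1))) (zero_mor D (y i) (x (i + 2)))
           (\<phi> (i + 1)) (Dif Y i)
         else sum_shift D \<Sigma> (Obj X 1) (Obj Y 0) \<cdot>\<^bsub>D\<^esub>
           matrix22 D (FOb \<Sigma> (x 0)) (y (n + 1)) (FOb \<Sigma> (x 1)) (FOb \<Sigma> (y 0))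
             (neg_mor D (FOb \<Sigma> (x 0)) (FOb \<Sigma> (x 1)) (FMor \<Sigma> (Dif X 0)))
             (zero_mor D (y (n + 1)) (FOb \<Sigma> (x 1)))
             (FMor \<Sigma> (\<phi> 0)) (Dif Y (n + 1)))\<rparr>)"

locale angulated_category = additive_automorphism D \<Sigma>
  for n :: nat
    and D :: "('o, 'm) addcat" (structure)
    and \<Sigma> :: "('o, 'm) endofunctor" +
  fixes P :: "('o, 'm) chain set"
  assumes angle_seq: "X \<in> P \<Longrightarrow> sigma_seq n D \<Sigma> X"
    and F1_iso:
      "\<lbrakk>X \<in> P; sigma_seq n D \<Sigma> Y; sigma_seq_isomorphic n D \<Sigma> X Y\<rbrakk> \<Longrightarrow> Y \<in> P"
    and F1_sum: "\<lbrakk>X \<in> P; Y \<in> P\<rbrakk> \<Longrightarrow> direct_sum n D \<Sigma> X Y \<in> P"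
    and F1_summand:
      "\<lbrakk>sigma_seq n D \<Sigma> X; sigma_seq n D \<Sigma> Y; direct_sum n D \<Sigma> X Y \<in> P\<rbrakk> \<Longrightarrow> X \<in> P"
    and F1_trivial: "A \<in> Ob D \<Longrightarrow> trivial_angle n D \<Sigma> A \<in> P"
    and F1_first:
      "\<lbrakk>A \<in> Ob D; B \<in> Ob D; f \<in> mor D A B\<rbrakk>
        \<Longrightarrow> \<exists>X \<in> P. Obj X 0 = A \<and> Obj X 1 = B \<and> Dif X 0 = f"
    and F2: "sigma_seq n D \<Sigma> X \<Longrightarrow> X \<in> P \<longleftrightarrow> left_rotation n D \<Sigma> X \<in> P"
    and F3:
      "\<lbrakk>X \<in> P; Y \<in> P; a \<in> mor D (Obj X 0) (Obj Y 0); b \<in> mor D (Obj X 1) (Obj Y 1);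
        b \<cdot> Dif X 0 = Dif Y 0 \<cdot> a\<rbrakk>
        \<Longrightarrow> \<exists>\<phi>. sigma_seq_map n D \<Sigma> X Y \<phi> \<and> \<phi> 0 = a \<and> \<phi> 1 = b"
    and F4:
      "\<lbrakk>X \<in> P; Y \<in> P; a \<in> mor D (Obj X 0) (Obj Y 0); b \<in> mor D (Obj X 1) (Obj Y 1);
        b \<cdot> Dif X 0 = Dif Y 0 \<cdot> a\<rbrakk>
        \<Longrightarrow> \<exists>\<phi>. sigma_seq_map n D \<Sigma> X Y \<phi> \<and> \<phi> 0 = a \<and> \<phi> 1 = b \<and> cone n D \<Sigma> X Y \<phi> \<in> P"


section \<open>Biadditive functors and exangles\<close>

text \<open>A functor \<open>\<G> : D\<^sup>o\<^sup>p \<times> D \<rightarrow> Ab\<close>: \<open>GOb \<G> C A\<close> is the abelian group \<open>\<G>(C, A)\<close>, and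
  \<open>GMap \<G> c a : \<G>(C, A) \<rightarrow> \<G>(C', A')\<close> for \<open>c : C' \<rightarrow> C\<close> and \<open>a : A \<rightarrow> A'\<close>.\<close>

record ('o, 'm, 'e) bifunctor =
  GOb :: "'o \<Rightarrow> 'o \<Rightarrow> 'e monoid"
  GMap :: "'m \<Rightarrow> 'm \<Rightarrow> 'e \<Rightarrow> 'e"

locale biadditive_functor = additive_category D
  for D :: "('o, 'm) addcat" (structure) +
  fixes G :: "('o, 'm, 'e) bifunctor"
  assumes G_group: "\<lbrakk>C \<in> Ob D; A \<in> Ob D\<rbrakk> \<Longrightarrow> comm_group (GOb G C A)"
    and G_hom:
      "\<lbrakk>C \<in> Ob D; C' \<in> Ob D; A \<in> Ob D; A' \<in> Ob D; c \<in> mor D C' C; a \<in> mor D A A'\<rbrakk>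
        \<Longrightarrow> GMap G c a \<in> hom (GOb G C A) (GOb G C' A')"
    and G_id:
      "\<lbrakk>C \<in> Ob D; A \<in> Ob D; \<delta> \<in> carrier (GOb G C A)\<rbrakk> \<Longrightarrow> GMap G (Id D C) (Id D A) \<delta> = \<delta>"
    and G_comp:
      "\<lbrakk>C \<in> Ob D; C' \<in> Ob D; C'' \<in> Ob D; A \<in> Ob D; A' \<in> Ob D; A'' \<in> Ob D;
        c \<in> mor D C' C; c' \<in> mor D C'' C'; a \<in> mor D A A'; a' \<in> mor D A' A'';
        \<delta> \<in> carrier (GOb G C A)\<rbrakk>
        \<Longrightarrow> GMap G (c \<cdot> c') (a' \<cdot> a) \<delta> = GMap G c' a' (GMap G c a \<delta>)"
    and G_add_left:
      "\<lbrakk>C \<in> Ob D; C' \<in> Ob D; A \<in> Ob D; A' \<in> Ob D;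
        c \<in> mor D C' C; c' \<in> mor D C' C; a \<in> mor D A A'; \<delta> \<in> carrier (GOb G C A)\<rbrakk>
        \<Longrightarrow> GMap G (add_mor D C' C c c') a \<delta> = GMap G c a \<delta> \<otimes>\<^bsub>GOb G C' A'\<^esub> GMap G c' a \<delta>"
    and G_add_right:
      "\<lbrakk>C \<in> Ob D; C' \<in> Ob D; A \<in> Ob D; A' \<in> Ob D;
        c \<in> mor D C' C; a \<in> mor D A A'; a' \<in> mor D A A'; \<delta> \<in> carrier (GOb G C A)\<rbrakk>
        \<Longrightarrow> GMap G c (add_mor D A A' a a') \<delta> = GMap G c a \<delta> \<otimes>\<^bsub>GOb G C' A'\<^esub> GMap G c a' \<delta>"

text \<open>\<open>push D G C a \<delta> = a\<^sub>*\<delta>\<close> and \<open>pull D G A c \<delta> = c\<^sup>*\<delta>\<close> for \<open>\<delta> \<in> \<G>(C, A)\<close>.\<close>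

definition push :: "('o, 'm) addcat \<Rightarrow> ('o, 'm, 'e) bifunctor \<Rightarrow> 'o \<Rightarrow> 'm \<Rightarrow> 'e \<Rightarrow> 'e" where
  "push D G C a \<delta> = GMap G (Id D C) a \<delta>"

definition pull :: "('o, 'm) addcat \<Rightarrow> ('o, 'm, 'e) bifunctor \<Rightarrow> 'o \<Rightarrow> 'm \<Rightarrow> 'e \<Rightarrow> 'e" where
  "pull D G A c \<delta> = GMap G c (Id D A) \<delta>"

definition exangle ::
  "nat \<Rightarrow> ('o, 'm) addcat \<Rightarrow> ('o, 'm, 'e) bifunctor \<Rightarrow> ('o, 'm) chain \<Rightarrow> 'e \<Rightarrow> bool" where
  "exangle n D G X \<delta> \<longleftrightarrow>
    complex D n X \<and>
    \<delta> \<in> carrier (GOb G (Obj X (n + 1)) (Obj X 0)) \<and>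
    push D G (Obj X (n + 1)) (Dif X 0) \<delta> = \<one>\<^bsub>GOb G (Obj X (n + 1)) (Obj X 1)\<^esub> \<and>
    pull D G (Obj X 0) (Dif X n) \<delta> = \<one>\<^bsub>GOb G (Obj X n) (Obj X 0)\<^esub> \<and>
    (\<forall>T \<in> Ob D.
      (\<forall>i \<in> {1..n}.
        kernel (Hom D T (Obj X i)) (Hom D T (Obj X (i + 1))) (\<lambda>f. Dif X i \<cdot>\<^bsub>D\<^esub> f) =
          (\<lambda>f. Dif X (i - 1) \<cdot>\<^bsub>D\<^esub> f) ` mor D T (Obj X (i - 1))) \<and>
      kernel (Hom D T (Obj X (n + 1))) (GOb G T (Obj X 0)) (\<lambda>f. pull D G (Obj X 0) f \<delta>) =
        (\<lambda>f. Dif X n \<cdot>\<^bsub>D\<^esub> f) ` mor D T (Obj X n)) \<and>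
    (\<forall>T \<in> Ob D.
      (\<forall>i \<in> {1..n}.
        kernel (Hom D (Obj X i) T) (Hom D (Obj X (i - 1)) T) (\<lambda>g. g \<cdot>\<^bsub>D\<^esub> Dif X (i - 1)) =
          (\<lambda>g. g \<cdot>\<^bsub>D\<^esub> Dif X i) ` mor D (Obj X (i + 1)) T) \<and>
      kernel (Hom D (Obj X 0) T) (GOb G (Obj X (n + 1)) T)
          (\<lambda>g. push D G (Obj X (n + 1)) g \<delta>) =
        (\<lambda>g. g \<cdot>\<^bsub>D\<^esub> Dif X 0) ` mor D (Obj X 1) T)"


section \<open>Exangulated categories\<close>

text \<open>A realisation is a function \<open>r\<close> such that \<open>r C A \<delta>\<close> is the class assigned to
  \<open>\<delta> \<in> \<G>(C, A)\<close>.  The end terms are arguments because the groups \<open>\<G>(C, A)\<close> need not be disjoint.\<close>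

definition distinguished ::
  "nat \<Rightarrow> ('o, 'm) addcat \<Rightarrow> ('o, 'm, 'e) bifunctor \<Rightarrow> ('o \<Rightarrow> 'o \<Rightarrow> 'e \<Rightarrow> ('o, 'm) chain set) \<Rightarrow>
    ('o, 'm) chain \<Rightarrow> 'e \<Rightarrow> bool" where
  "distinguished n D G r X \<delta> \<longleftrightarrow>
    complex D n X \<and> \<delta> \<in> carrier (GOb G (Obj X (n + 1)) (Obj X 0)) \<and>
    homotopy_class D n X = r (Obj X (n + 1)) (Obj X 0) \<delta>"

definition inflation ::
  "nat \<Rightarrow> ('o, 'm) addcat \<Rightarrow> ('o, 'm, 'e) bifunctor \<Rightarrow> ('o \<Rightarrow> 'o \<Rightarrow> 'e \<Rightarrow> ('o, 'm) chain set) \<Rightarrow>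
    'm \<Rightarrow> bool" where
  "inflation n D G r f \<longleftrightarrow> (\<exists>X \<delta>. distinguished n D G r X \<delta> \<and> Dif X 0 = f)"

definition deflation ::
  "nat \<Rightarrow> ('o, 'm) addcat \<Rightarrow> ('o, 'm, 'e) bifunctor \<Rightarrow> ('o \<Rightarrow> 'o \<Rightarrow> 'e \<Rightarrow> ('o, 'm) chain set) \<Rightarrow>
    'm \<Rightarrow> bool" where
  "deflation n D G r f \<longleftrightarrow> (\<exists>X \<delta>. distinguished n D G r X \<delta> \<and> Dif X n = f)"

definition lift ::
  "('o, 'm) addcat \<Rightarrow> nat \<Rightarrow> ('o, 'm) chain \<Rightarrow> ('o, 'm) chain \<Rightarrow> 'm \<Rightarrow> 'm \<Rightarrow> (nat \<Rightarrow> 'm) \<Rightarrow> bool" where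
  "lift D n X Y a c f \<longleftrightarrow> chain_map D n X Y f \<and> f 0 = a \<and> f (n + 1) = c"

definition ext_morphism ::
  "('o, 'm) addcat \<Rightarrow> ('o, 'm, 'e) bifunctor \<Rightarrow> 'o \<Rightarrow> 'o \<Rightarrow> 'e \<Rightarrow> 'o \<Rightarrow> 'o \<Rightarrow> 'e \<Rightarrow> 'm \<Rightarrow> 'm \<Rightarrow> bool"
  where
  "ext_morphism D G C A \<delta> C' A' \<rho> a c \<longleftrightarrow>
    a \<in> mor D A A' \<and> c \<in> mor D C C' \<and> push D G C a \<delta> = pull D G A' c \<rho>"

locale exact_realisation = biadditive_functor D G
  for n :: nat
    and D :: "('o, 'm) addcat" (structure)
    and G :: "('o, 'm, 'e) bifunctor" +
  fixes r :: "'o \<Rightarrow> 'o \<Rightarrow> 'e \<Rightarrow> ('o, 'm) chain set"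
  assumes r_class:
      "\<lbrakk>C \<in> Ob D; A \<in> Ob D; \<delta> \<in> carrier (GOb G C A)\<rbrakk>
        \<Longrightarrow> \<exists>X \<in> complexes_between D n A C. r C A \<delta> = homotopy_class D n X"
    and R0:
      "\<lbrakk>distinguished n D G r X \<delta>; distinguished n D G r Y \<rho>;
        ext_morphism D G (Obj X (n + 1)) (Obj X 0) \<delta> (Obj Y (n + 1)) (Obj Y 0) \<rho> a c\<rbrakk>
        \<Longrightarrow> \<exists>f. lift D n X Y a c f"
    and R1: "distinguished n D G r X \<delta> \<Longrightarrow> exangle n D G X \<delta>"
    and R2_left:
      "A \<in> Ob D \<Longrightarrow> r (Zer D) A (\<one>\<^bsub>GOb G (Zer D) A\<^esub>) = homotopy_class D n (triv D 0 A)"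
    and R2_right:
      "C \<in> Ob D \<Longrightarrow> r C (Zer D) (\<one>\<^bsub>GOb G C (Zer D)\<^esub>) = homotopy_class D n (triv D n C)"

text \<open>The complex \<open>M\<^sup>f\<close>; only used for \<open>f\<^sub>0 = id\<close>.\<close>

definition mapping_cone ::
  "nat \<Rightarrow> ('o, 'm) addcat \<Rightarrow> ('o, 'm) chain \<Rightarrow> ('o, 'm) chain \<Rightarrow> (nat \<Rightarrow> 'm) \<Rightarrow> ('o, 'm) chain" where
  "mapping_cone n D X Y f =
    (let x = Obj X; y = Obj Y in
      \<lparr>Obj = (\<lambda>i. if i = 0 then x 1 else if i \<le> n then Sum D (x (i + 1)) (y i) else y (n + 1)),
       Dif = (\<lambda>i.
         if i = 0 then col D (x 1) (x 2) (y 1) (neg_mor D (x 1) (x 2) (Dif X 1)) (f 1)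
         else if i < n then matrix22 D (x (i + 1)) (y i) (x (i + 2)) (y (i + 1))
           (neg_mor D (x (i + 1)) (x (i + 2)) (Dif X (i + 1))) (zero_mor D (y i) (x (i + 2)))
           (f (i + 1)) (Dif Y i)
         else row D (x (n + 1)) (y n) (y (n + 1)) (f (n + 1)) (Dif Y n))\<rparr>)"

text \<open>The complex \<open>N\<^sup>f\<close>; only used for \<open>f\<^sub>n\<^sub>+\<^sub>1 = id\<close>.\<close>

definition mapping_cocone ::
  "nat \<Rightarrow> ('o, 'm) addcat \<Rightarrow> ('o, 'm) chain \<Rightarrow> ('o, 'm) chain \<Rightarrow> (nat \<Rightarrow> 'm) \<Rightarrow> ('o, 'm) chain" where
  "mapping_cocone n D X Y f =
    (let x = Obj X; y = Obj Y in
      \<lparr>Obj = (\<lambda>i. if i = 0 then x 0 else if i \<le> n then Sum D (x i) (y (i - 1)) else y n),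
       Dif = (\<lambda>i.
         if i = 0 then col D (x 0) (x 1) (y 0) (Dif X 0) (f 0)
         else if i < n then matrix22 D (x i) (y (i - 1)) (x (i + 1)) (y i)
           (Dif X i) (zero_mor D (y (i - 1)) (x (i + 1)))
           (f i) (neg_mor D (y (i - 1)) (y i) (Dif Y (i - 1)))
         else row D (x n) (y (n - 1)) (y n)
           (f n) (neg_mor D (y (n - 1)) (y n) (Dif Y (n - 1))))\<rparr>)"

locale exangulated_category = exact_realisation n D G r
  for n :: nat
    and D :: "('o, 'm) addcat" (structure)
    and G :: "('o, 'm, 'e) bifunctor"
    and r :: "'o \<Rightarrow> 'o \<Rightarrow> 'e \<Rightarrow> ('o, 'm) chain set" +
  assumes EA1:
      "\<lbrakk>A \<in> Ob D; B \<in> Ob D; C \<in> Ob D; f \<in> mor D A B; g \<in> mor D B C;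
        inflation n D G r f; inflation n D G r g\<rbrakk> \<Longrightarrow> inflation n D G r (g \<cdot> f)"
    and EA1_op:
      "\<lbrakk>A \<in> Ob D; B \<in> Ob D; C \<in> Ob D; f \<in> mor D A B; g \<in> mor D B C;
        deflation n D G r f; deflation n D G r g\<rbrakk> \<Longrightarrow> deflation n D G r (g \<cdot> f)"
    and EA2:
      "\<lbrakk>distinguished n D G r Y \<rho>; Obj X 0 = Obj Y 0; c \<in> mor D (Obj X (n + 1)) (Obj Y (n + 1));
        distinguished n D G r X (pull D G (Obj Y 0) c \<rho>)\<rbrakk>
        \<Longrightarrow> \<exists>f. lift D n X Y (Id D (Obj X 0)) c f \<and>
          distinguished n D G r (mapping_cone n D X Y f) (push D G (Obj Y (n + 1)) (Dif X 0) \<rho>)"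
    and EA2_op:
      "\<lbrakk>distinguished n D G r X \<delta>; Obj X (n + 1) = Obj Y (n + 1); a \<in> mor D (Obj X 0) (Obj Y 0);
        distinguished n D G r Y (push D G (Obj X (n + 1)) a \<delta>)\<rbrakk>
        \<Longrightarrow> \<exists>f. lift D n X Y a (Id D (Obj X (n + 1))) f \<and>
          distinguished n D G r (mapping_cocone n D X Y f) (pull D G (Obj X 0) (Dif Y n) \<delta>)"


section \<open>Extension closed subcategories\<close>

text \<open>Full subcategories are given by their sets of objects.\<close>

definition full_subcategory :: "('o, 'm) addcat \<Rightarrow> 'o set \<Rightarrow> ('o, 'm) addcat" where
  "full_subcategory D \<B> = D\<lparr>Ob := \<B>\<rparr>"

definition additive_subcategory :: "('o, 'm) addcat \<Rightarrow> 'o set \<Rightarrow> bool" where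
  "additive_subcategory D \<B> \<longleftrightarrow>
    \<B> \<subseteq> Ob D \<and> Zer D \<in> \<B> \<and>
    (\<forall>A \<in> \<B>. \<forall>B \<in> \<B>. Sum D A B \<in> \<B>) \<and>
    (\<forall>A \<in> \<B>. \<forall>B \<in> Ob D. isomorphic D A B \<longrightarrow> B \<in> \<B>)"

text \<open>The \<open>(n+2)\<close>-angles \<open>A \<rightarrow> X\<^sub>1 \<rightarrow> \<dots> \<rightarrow> X\<^sub>n \<rightarrow> C \<rightarrow> \<Sigma>A\<close> with last map \<open>\<delta>\<close> and middle terms
  in the subcategory.\<close>

definition angles_in ::
  "nat \<Rightarrow> ('o, 'm) chain set \<Rightarrow> 'o set \<Rightarrow> 'o \<Rightarrow> 'o \<Rightarrow> 'm \<Rightarrow> ('o, 'm) chain set" where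
  "angles_in n P \<B> C A \<delta> =
    {X \<in> P. Obj X 0 = A \<and> Obj X (n + 1) = C \<and> Dif X (n + 1) = \<delta> \<and> (\<forall>i \<in> {1..n}. Obj X i \<in> \<B>)}"

definition extension_closed ::
  "nat \<Rightarrow> ('o, 'm) addcat \<Rightarrow> ('o, 'm) endofunctor \<Rightarrow> ('o, 'm) chain set \<Rightarrow> 'o set \<Rightarrow> bool" where
  "extension_closed n D \<Sigma> P \<B> \<longleftrightarrow>
    (\<forall>A \<in> \<B>. \<forall>C \<in> \<B>. \<forall>\<delta> \<in> mor D C (FOb \<Sigma> A). angles_in n P \<B> C A \<delta> \<noteq> {})"

text \<open>The bifunctor \<open>D(-, \<Sigma>-)\<close>.  Its restriction to a full subcategory is given by the same record:
  with respect to that subcategory, only the values at its objects and morphisms matter.\<close>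

definition G_shift ::
  "('o, 'm) addcat \<Rightarrow> ('o, 'm) endofunctor \<Rightarrow> ('o, 'm, 'm) bifunctor" where
  "G_shift D \<Sigma> =
    \<lparr>GOb = (\<lambda>C A. Hom D C (FOb \<Sigma> A)), GMap = (\<lambda>c a \<delta>. FMor \<Sigma> a \<cdot>\<^bsub>D\<^esub> \<delta> \<cdot>\<^bsub>D\<^esub> c)\<rparr>"

definition r_sub ::
  "nat \<Rightarrow> ('o, 'm) addcat \<Rightarrow> ('o, 'm) chain set \<Rightarrow> 'o set \<Rightarrow>
    'o \<Rightarrow> 'o \<Rightarrow> 'm \<Rightarrow> ('o, 'm) chain set" where
  "r_sub n D P \<B> C A \<delta> =
    homotopy_class (full_subcategory D \<B>) n (SOME X. X \<in> angles_in n P \<B> C A \<delta>)"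

end

theory Submission
  imports Defs
begin

text \<open>
  A complex \<open>X\<close> over \<open>\<B>\<close> with \<open>\<delta>\<close> is distinguished iff \<open>(X, \<delta>)\<close> is an angle.  For one direction,
  two angles with the same last map are homotopy equivalent relative to their ends: if \<open>g f - 1\<close> and
  \<open>f g - 1\<close> vanish on the ends, their squares are null-homotopic.  For the other direction, a
  complex which is homotopy equivalent to an angle \<open>Y\<close> is a retract of the direct sum of \<open>Y\<close> with
  trivial angles, and it is even a direct summand, because its components are complemented.

  The mapping cones of (EA2) and its dual arise from the cones of (F4), rotated such that the outer
  components of the morphism are prescribed, by removing a contractible summand.  For (EA1), let
  \<open>f : A \<rightarrow> B\<close> and \<open>g : B \<rightarrow> C\<close> be inflations in angles \<open>X\<close> and \<open>Y\<close> with terms in \<open>\<B>\<close>.  Pushing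
  \<open>Y\<close> forward along \<open>B \<rightarrow> X\<^sub>2\<close> gives an angle \<open>B \<rightarrow> C \<oplus> X\<^sub>2 \<rightarrow> N\<^sub>2 \<rightarrow> \<dots>\<close> over \<open>\<B>\<close>.  The mapping
  cone of a morphism from it to the rotation of \<open>X\<close>, after removing \<open>X\<^sub>2\<close>, is the rotation of an
  angle \<open>A \<rightarrow> C \<rightarrow> N\<^sub>2 \<rightarrow> N\<^sub>3 \<oplus> X\<^sub>3 \<rightarrow> \<dots>\<close> over \<open>\<B>\<close> that starts with \<open>g f\<close>.
\<close>

section \<open>Matrix calculus in additive categories\<close>

text \<open>(F1) does give an angle starting with g f, but nothing puts its other terms into \<B>.
  The terms of the angle built for (EA1) are instead sums of terms of angles over \<B>, and
  extension closure enters through the choice of the pushed-forward angle. The column with entries g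
  and B -> \<open>X\<^sub>2\<close> is chosen since, composed with f, its first entry is g f.

  Idempotents of D need not split, so a retract of an angle is not known to be a direct summand of
  it, and only summands are covered by (F1). Hence every retraction has to come with a complement in
  each degree.

  The squares in the comparison of two angles have a similar origin: for an endomorphism vanishing
  on both ends, the homotopy that exactness builds from one end stops in degree n, and in degree n +
  1 it yields d s instead of 0. Multiplying by a second such endomorphism removes this
  remainder.\<close>

context additive_category
begin

abbreviation zm :: "'o \<Rightarrow> 'o \<Rightarrow> 'm" where "zm \<equiv> zero_mor D"

text \<open>Since hom sets are disjoint, a morphism determines its source and target, and \<open>\<oplus>\<close> and \<open>\<ominus>\<close> read off
  the hom group from their argument.\<close>

definition arrow :: "'m \<Rightarrow> bool" where
  "arrow f \<longleftrightarrow> (\<exists>A \<in> Ob D. \<exists>B \<in> Ob D. f \<in> mor D A B)"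

definition src :: "'m \<Rightarrow> 'o" where
  "src f = (THE A. A \<in> Ob D \<and> (\<exists>B \<in> Ob D. f \<in> mor D A B))"

definition tgt :: "'m \<Rightarrow> 'o" where
  "tgt f = (THE B. B \<in> Ob D \<and> (\<exists>A \<in> Ob D. f \<in> mor D A B))"

definition plus :: "'m \<Rightarrow> 'm \<Rightarrow> 'm" (infixl "\<oplus>" 65) where
  "f \<oplus> g = add_mor D (src f) (tgt f) f g"

definition minus :: "'m \<Rightarrow> 'm" ("\<ominus> _" [81] 80) where
  "\<ominus> f = neg_mor D (src f) (tgt f) f"

lemma mor_arrow:
  assumes "A \<in> Ob D" "B \<in> Ob D" "f \<in> mor D A B"
  shows "arrow f" "src f = A" "tgt f = B"
proof -
  show "arrow f" using assms arrow_def by blast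
  show "src f = A" unfolding src_def using assms hom_disjoint by (intro the_equality) blast+
  show "tgt f = B" unfolding tgt_def using assms hom_disjoint by (intro the_equality) blast+
qed

text \<open>As a rewrite rule this turns typing into conditions on \<open>arrow\<close>,
  \<open>src\<close> and \<open>tgt\<close>. The side conditions of the later rules are stated in
  these terms, so that the simplifier computes types.\<close>

lemma mor_iff [simp]:
  "\<lbrakk>A \<in> Ob D; B \<in> Ob D\<rbrakk> \<Longrightarrow> f \<in> mor D A B \<longleftrightarrow> arrow f \<and> src f = A \<and> tgt f = B"
  using mor_arrow arrow_def by metis

lemma src_ob [simp]: "arrow f \<Longrightarrow> src f \<in> Ob D"
  and tgt_ob [simp]: "arrow f \<Longrightarrow> tgt f \<in> Ob D"
  using mor_arrow arrow_def by metis+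

lemma arrow_mor: "arrow f \<Longrightarrow> f \<in> mor D (src f) (tgt f)"
  by simp

lemma add_mor_plus [simp]:
  "\<lbrakk>arrow f; src f = A; tgt f = B\<rbrakk> \<Longrightarrow> add_mor D A B f g = f \<oplus> g"
  unfolding plus_def by simp

lemma neg_mor_minus [simp]: "\<lbrakk>arrow f; src f = A; tgt f = B\<rbrakk> \<Longrightarrow> neg_mor D A B f = \<ominus> f"
  unfolding minus_def by simp

lemma
  assumes "arrow f" "arrow g" "src f = src g" "tgt f = tgt g"
  shows arrow_plus [simp]: "arrow (f \<oplus> g)"
    and src_plus [simp]: "src (f \<oplus> g) = src g"
    and tgt_plus [simp]: "tgt (f \<oplus> g) = tgt g"
proof -
  interpret comm_group "Hom D (src g) (tgt g)" using assms hom_group by simp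
  have "f \<in> mor D (src g) (tgt g)" "g \<in> mor D (src g) (tgt g)" using assms by simp_all
  then have "f \<oplus> g \<in> mor D (src g) (tgt g)" unfolding plus_def assms(3,4) by (rule m_closed)
  then show "arrow (f \<oplus> g)" "src (f \<oplus> g) = src g" "tgt (f \<oplus> g) = tgt g" using assms by simp_all
qed

lemma
  assumes "arrow f"
  shows arrow_minus [simp]: "arrow (\<ominus> f)"
    and src_minus [simp]: "src (\<ominus> f) = src f"
    and tgt_minus [simp]: "tgt (\<ominus> f) = tgt f"
proof -
  interpret comm_group "Hom D (src f) (tgt f)" using assms hom_group by simp
  have "\<ominus> f \<in> mor D (src f) (tgt f)" unfolding minus_def using arrow_mor[OF assms] by simp
  then show "arrow (\<ominus> f)" "src (\<ominus> f) = src f" "tgt (\<ominus> f) = tgt f" using assms by simp_all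
qed

lemma
  assumes "A \<in> Ob D" "B \<in> Ob D"
  shows arrow_zero [simp]: "arrow (zm A B)"
    and src_zero [simp]: "src (zm A B) = A"
    and tgt_zero [simp]: "tgt (zm A B) = B"
proof -
  interpret comm_group "Hom D A B" using assms hom_group by simp
  have "zm A B \<in> mor D A B" by simp
  then show "arrow (zm A B)" "src (zm A B) = A" "tgt (zm A B) = B"
    using mor_arrow[OF assms] by blast+
qed

lemma
  assumes "arrow f" "arrow g" "src g = tgt f"
  shows arrow_comp [simp]: "arrow (g \<cdot> f)"
    and src_comp [simp]: "src (g \<cdot> f) = src f"
    and tgt_comp [simp]: "tgt (g \<cdot> f) = tgt g"
proof -
  have "g \<cdot> f \<in> mor D (src f) (tgt g)" using assms by (intro comp_mor[of _ "tgt f"]) simp_all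
  then show "arrow (g \<cdot> f)" "src (g \<cdot> f) = src f" "tgt (g \<cdot> f) = tgt g" using assms by simp_all
qed

lemma
  assumes "A \<in> Ob D"
  shows arrow_Id [simp]: "arrow (Id D A)"
    and src_Id [simp]: "src (Id D A) = A"
    and tgt_Id [simp]: "tgt (Id D A) = A"
  using id_mor[OF assms] assms by simp_all

lemma comp_assoc' [simp]:
  "\<lbrakk>arrow f; arrow g; arrow h; src g = tgt f; src h = tgt g\<rbrakk> \<Longrightarrow> h \<cdot> g \<cdot> f = h \<cdot> (g \<cdot> f)"
  by (rule comp_assoc[of "src f" "tgt f" "tgt g" "tgt h"]) simp_all

lemma comp_Id [simp]: "\<lbrakk>arrow f; src f = A\<rbrakk> \<Longrightarrow> f \<cdot> Id D A = f"
  using comp_id[of "src f" "tgt f" f] by auto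

lemma Id_comp [simp]: "\<lbrakk>arrow f; tgt f = A\<rbrakk> \<Longrightarrow> Id D A \<cdot> f = f"
  using id_comp[of "src f" "tgt f" f] by auto

lemma comp_plus [simp]:
  assumes "arrow f" "arrow f'" "arrow g" "src f = src f'" "tgt f = tgt f'" "src g = tgt f'"
  shows "g \<cdot> (f \<oplus> f') = g \<cdot> f \<oplus> g \<cdot> f'"
  using comp_add_right[of "src f'" "tgt f'" "tgt g" f f' g] assms by simp

lemma plus_comp [simp]:
  assumes "arrow f" "arrow g" "arrow g'" "src g = src g'" "tgt g = tgt g'" "src g' = tgt f"
  shows "(g \<oplus> g') \<cdot> f = g \<cdot> f \<oplus> g' \<cdot> f"
  using comp_add_left[of "src f" "tgt f" "tgt g'" f g g'] assms by simp

lemma plus_commute: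
  assumes "arrow f" "arrow g" "src f = src g" "tgt f = tgt g"
  shows "f \<oplus> g = g \<oplus> f"
proof -
  interpret comm_group "Hom D (src g) (tgt g)" using assms hom_group by simp
  have "f \<in> mor D (src g) (tgt g)" "g \<in> mor D (src g) (tgt g)" using assms by simp_all
  from m_comm[OF this] show ?thesis using assms by simp
qed

lemma plus_assoc:
  assumes "arrow f" "arrow g" "arrow h" "src f = src h" "src g = src h" "tgt f = tgt h"
    "tgt g = tgt h"
  shows "f \<oplus> g \<oplus> h = f \<oplus> (g \<oplus> h)"
proof -
  interpret comm_group "Hom D (src h) (tgt h)" using assms hom_group by simp
  have "f \<in> mor D (src h) (tgt h)" "g \<in> mor D (src h) (tgt h)" "h \<in> mor D (src h) (tgt h)"
    using assms by simp_all
  from m_assoc[OF this] show ?thesis using assms by simp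
qed

lemma plus_left_commute:
  assumes "arrow f" "arrow g" "arrow h" "src f = src h" "src g = src h" "tgt f = tgt h"
    "tgt g = tgt h"
  shows "f \<oplus> (g \<oplus> h) = g \<oplus> (f \<oplus> h)"
  using plus_assoc[of f g h] plus_assoc[of g f h] plus_commute[of f g] assms by simp

lemmas plus_ac = plus_assoc plus_commute plus_left_commute

lemma plus_zero [simp]: "\<lbrakk>arrow f; src f = A; tgt f = B\<rbrakk> \<Longrightarrow> f \<oplus> zm A B = f"
proof -
  assume *: "arrow f" "src f = A" "tgt f = B"
  interpret comm_group "Hom D A B" using * hom_group by auto
  have "f \<in> mor D A B" using * by auto
  from r_one[OF this] show ?thesis using * by simp
qed

lemma zero_plus [simp]: "\<lbrakk>arrow f; src f = A; tgt f = B\<rbrakk> \<Longrightarrow> zm A B \<oplus> f = f"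
  using plus_commute[of "zm A B" f] by auto

lemma plus_minus [simp]: "arrow f \<Longrightarrow> f \<oplus> \<ominus> f = zm (src f) (tgt f)"
proof -
  assume *: "arrow f"
  interpret comm_group "Hom D (src f) (tgt f)" using * hom_group by auto
  from r_inv[OF arrow_mor[OF *]] show ?thesis using * by simp
qed

lemma minus_plus [simp]: "arrow f \<Longrightarrow> \<ominus> f \<oplus> f = zm (src f) (tgt f)"
  using plus_commute[of "\<ominus> f" f] by simp

lemma plus_minus_cancel [simp]:
  assumes "arrow f" "arrow g" "src g = src f" "tgt g = tgt f"
  shows "f \<oplus> (\<ominus> f \<oplus> g) = g" "\<ominus> f \<oplus> (f \<oplus> g) = g"
proof -
  show "f \<oplus> (\<ominus> f \<oplus> g) = g" by (subst plus_assoc[symmetric]) (use assms in simp_all)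
  show "\<ominus> f \<oplus> (f \<oplus> g) = g" by (subst plus_assoc[symmetric]) (use assms in simp_all)
qed

lemma plus_minus_cancel' [simp]:
  assumes "arrow f" "arrow g" "src g = src f" "tgt g = tgt f"
  shows "f \<oplus> (g \<oplus> \<ominus> f) = g" "\<ominus> f \<oplus> (g \<oplus> f) = g"
  using plus_commute[of g "\<ominus> f"] plus_commute[of g f] by (simp_all add: assms)

lemma plus_eq_zero_minus:
  assumes "arrow f" "arrow g" "src g = src f" "tgt g = tgt f" "f \<oplus> g = zm (src f) (tgt f)"
  shows "g = \<ominus> f"
proof -
  have "g = \<ominus> f \<oplus> (f \<oplus> g)" by (rule plus_minus_cancel(2)[symmetric]) (simp_all add: assms(1-4))
  also have "\<dots> = \<ominus> f" by (simp add: assms)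
  finally show ?thesis .
qed

lemma minus_minus [simp]: "arrow f \<Longrightarrow> \<ominus> (\<ominus> f) = f"
  using plus_eq_zero_minus[of "\<ominus> f" f] by simp

lemma minus_zero [simp]: "\<lbrakk>A \<in> Ob D; B \<in> Ob D\<rbrakk> \<Longrightarrow> \<ominus> (zm A B) = zm A B"
  using plus_eq_zero_minus[of "zm A B" "zm A B"] by simp

lemma minus_plus_distrib [simp]:
  assumes "arrow f" "arrow g" "src f = src g" "tgt f = tgt g"
  shows "\<ominus> (f \<oplus> g) = \<ominus> f \<oplus> \<ominus> g"
proof -
  have "f \<oplus> g \<oplus> (\<ominus> f \<oplus> \<ominus> g) = zm (src (f \<oplus> g)) (tgt (f \<oplus> g))"
    by (simp add: assms plus_ac)
  then have "\<ominus> f \<oplus> \<ominus> g = \<ominus> (f \<oplus> g)"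
    by (intro plus_eq_zero_minus) (simp_all add: assms)
  then show ?thesis by (rule sym)
qed

lemma plus_left_cancel:
  assumes "arrow f" "arrow g" "arrow h" "src f = src h" "src g = src h" "tgt f = tgt h"
    "tgt g = tgt h"
    "h \<oplus> f = h \<oplus> g"
  shows "f = g"
proof -
  have "f = \<ominus> h \<oplus> (h \<oplus> f)" by (rule plus_minus_cancel(2)[symmetric]) (simp_all add: assms(1-7))
  also have "\<dots> = \<ominus> h \<oplus> (h \<oplus> g)" by (simp only: assms(8))
  also have "\<dots> = g" by (rule plus_minus_cancel(2)) (simp_all add: assms(1-7))
  finally show ?thesis .
qed

lemma comp_zero [simp]:
  assumes "arrow g" "A \<in> Ob D" "B \<in> Ob D" "src g = B"
  shows "g \<cdot> zm A B = zm A (tgt g)"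
proof -
  let ?z = "zm A B"
  have "g \<cdot> ?z \<oplus> g \<cdot> ?z = g \<cdot> ?z \<oplus> zm A (tgt g)"
    using comp_plus[of ?z ?z g] assms by simp
  then show ?thesis by (rule plus_left_cancel[rotated -1]) (use assms in simp_all)
qed

lemma zero_comp [simp]:
  assumes "arrow f" "A \<in> Ob D" "B \<in> Ob D" "tgt f = A"
  shows "zm A B \<cdot> f = zm (src f) B"
proof -
  let ?z = "zm A B"
  have "?z \<cdot> f \<oplus> ?z \<cdot> f = ?z \<cdot> f \<oplus> zm (src f) B"
    using plus_comp[of f ?z ?z] assms by simp
  then show ?thesis by (rule plus_left_cancel[rotated -1]) (use assms in simp_all)
qed

lemma comp_minus [simp]: "\<lbrakk>arrow f; arrow g; src g = tgt f\<rbrakk> \<Longrightarrow> g \<cdot> \<ominus> f = \<ominus> (g \<cdot> f)"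
  using comp_plus[of f "\<ominus> f" g] by (intro plus_eq_zero_minus) simp_all

lemma minus_comp [simp]: "\<lbrakk>arrow f; arrow g; src g = tgt f\<rbrakk> \<Longrightarrow> \<ominus> g \<cdot> f = \<ominus> (g \<cdot> f)"
  using plus_comp[of f g "\<ominus> g"] by (intro plus_eq_zero_minus) simp_all

lemma diff_eq_iff:
  assumes "arrow f" "arrow g" "arrow h" "src f = src h" "src g = src h" "tgt f = tgt h"
    "tgt g = tgt h"
  shows "f \<oplus> \<ominus> g = h \<longleftrightarrow> f = g \<oplus> h"
proof
  assume "f \<oplus> \<ominus> g = h"
  then have "g \<oplus> h = g \<oplus> (f \<oplus> \<ominus> g)" by simp
  also have "\<dots> = f" using assms by (simp add: plus_ac)
  finally show "f = g \<oplus> h" by simp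
qed (use assms in \<open>simp add: plus_ac\<close>)

lemma comp_zero_assoc:
  assumes "g \<cdot> f = zm A B" "arrow g" "arrow f" "src g = tgt f" "arrow x" "tgt x = src f"
    "src f = A" "tgt g = B"
  shows "g \<cdot> (f \<cdot> x) = zm (src x) B"
  using comp_assoc'[of x f g] assms zero_comp[of x A B] by auto

section \<open>The zero object, biproducts and matrices\<close>

lemma Zer_ob [simp]: "Zer D \<in> Ob D" by (rule zero_ob)

lemma tgt_Zer_zero: "\<lbrakk>arrow f; tgt f = Zer D\<rbrakk> \<Longrightarrow> f = zm (src f) (Zer D)"
  using zero_terminal[of "src f"] arrow_mor[of f] by auto

lemma Id_Zer [simp]: "Id D (Zer D) = zm (Zer D) (Zer D)"
  using tgt_Zer_zero[of "Id D (Zer D)"] by simp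

lemma Sum_ob [simp]: "\<lbrakk>A \<in> Ob D; B \<in> Ob D\<rbrakk> \<Longrightarrow> Sum D A B \<in> Ob D" by (rule sum_ob)

lemma
  assumes "A \<in> Ob D" "B \<in> Ob D"
  shows arrow_In1 [simp]: "arrow (In1 D A B)"
    and src_In1 [simp]: "src (In1 D A B) = A"
    and tgt_In1 [simp]: "tgt (In1 D A B) = Sum D A B"
    and arrow_In2 [simp]: "arrow (In2 D A B)"
    and src_In2 [simp]: "src (In2 D A B) = B"
    and tgt_In2 [simp]: "tgt (In2 D A B) = Sum D A B"
    and arrow_Pr1 [simp]: "arrow (Pr1 D A B)"
    and src_Pr1 [simp]: "src (Pr1 D A B) = Sum D A B"
    and tgt_Pr1 [simp]: "tgt (Pr1 D A B) = A"
    and arrow_Pr2 [simp]: "arrow (Pr2 D A B)"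
    and src_Pr2 [simp]: "src (Pr2 D A B) = Sum D A B"
    and tgt_Pr2 [simp]: "tgt (Pr2 D A B) = B"
  using in_mor[OF assms] pr_mor[OF assms] assms by simp_all

lemma Pr_In [simp]:
  assumes "A \<in> Ob D" "B \<in> Ob D"
  shows "Pr1 D A B \<cdot> In1 D A B = Id D A" "Pr2 D A B \<cdot> In2 D A B = Id D B"
    "Pr1 D A B \<cdot> In2 D A B = zm B A" "Pr2 D A B \<cdot> In1 D A B = zm A B"
  using pr_in assms by simp_all

lemma Pr_In_comp [simp]:
  assumes "A \<in> Ob D" "B \<in> Ob D" "arrow x"
  shows "tgt x = A \<Longrightarrow> Pr1 D A B \<cdot> (In1 D A B \<cdot> x) = x"
    "tgt x = B \<Longrightarrow> Pr2 D A B \<cdot> (In2 D A B \<cdot> x) = x"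
    "tgt x = B \<Longrightarrow> Pr1 D A B \<cdot> (In2 D A B \<cdot> x) = zm (src x) A"
    "tgt x = A \<Longrightarrow> Pr2 D A B \<cdot> (In1 D A B \<cdot> x) = zm (src x) B"
  using comp_assoc'[of x "In1 D A B" "Pr1 D A B", symmetric]
    comp_assoc'[of x "In2 D A B" "Pr2 D A B", symmetric]
    comp_assoc'[of x "In2 D A B" "Pr1 D A B", symmetric]
    comp_assoc'[of x "In1 D A B" "Pr2 D A B", symmetric] assms by simp_all

lemma In_Pr:
  assumes "A \<in> Ob D" "B \<in> Ob D"
  shows "In1 D A B \<cdot> Pr1 D A B \<oplus> In2 D A B \<cdot> Pr2 D A B = Id D (Sum D A B)"
  using in_pr[OF assms] assms by simp

text \<open>Unlike \<open>col\<close>, \<open>row\<close> and \<open>matrix22\<close>, which take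
  their objects as arguments, \<open>colm\<close>, \<open>rowm\<close> and \<open>mat\<close> read
  them off the entries. This keeps products of matrices free of object arguments.\<close>

definition colm :: "'m \<Rightarrow> 'm \<Rightarrow> 'm" where
  "colm f g = In1 D (tgt f) (tgt g) \<cdot> f \<oplus> In2 D (tgt f) (tgt g) \<cdot> g"

definition rowm :: "'m \<Rightarrow> 'm \<Rightarrow> 'm" where
  "rowm f g = f \<cdot> Pr1 D (src f) (src g) \<oplus> g \<cdot> Pr2 D (src f) (src g)"

definition mat :: "'m \<Rightarrow> 'm \<Rightarrow> 'm \<Rightarrow> 'm \<Rightarrow> 'm" where
  "mat a b c e = rowm (colm a c) (colm b e)"

lemma
  assumes "arrow f" "arrow g" "src f = src g"
  shows arrow_colm [simp]: "arrow (colm f g)"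
    and src_colm [simp]: "src (colm f g) = src g"
    and tgt_colm [simp]: "tgt (colm f g) = Sum D (tgt f) (tgt g)"
  unfolding colm_def using assms by simp_all

lemma
  assumes "arrow f" "arrow g" "tgt f = tgt g"
  shows arrow_rowm [simp]: "arrow (rowm f g)"
    and src_rowm [simp]: "src (rowm f g) = Sum D (src f) (src g)"
    and tgt_rowm [simp]: "tgt (rowm f g) = tgt g"
  unfolding rowm_def using assms by simp_all

lemma
  assumes "arrow a" "arrow b" "arrow c" "arrow e" "src a = src c" "src b = src e"
    "tgt a = tgt b" "tgt c = tgt e"
  shows arrow_mat [simp]: "arrow (mat a b c e)"
    and src_mat [simp]: "src (mat a b c e) = Sum D (src c) (src e)"
    and tgt_mat [simp]: "tgt (mat a b c e) = Sum D (tgt b) (tgt e)"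
  unfolding mat_def using assms by simp_all

lemma col_colm [simp]:
  "\<lbrakk>arrow f; arrow g; src f = X; src g = X; tgt f = A; tgt g = B\<rbrakk> \<Longrightarrow> col D X A B f g = colm f g"
  unfolding col_def colm_def by auto

lemma row_rowm [simp]:
  "\<lbrakk>arrow f; arrow g; src f = A; src g = B; tgt f = X; tgt g = X\<rbrakk> \<Longrightarrow> row D A B X f g = rowm f g"
  unfolding row_def rowm_def by auto

lemma matrix22_mat [simp]:
  "\<lbrakk>arrow a; arrow b; arrow c; arrow e; src a = A; src c = A; src b = B; src e = B;
    tgt a = A'; tgt b = A'; tgt c = B'; tgt e = B'\<rbrakk> \<Longrightarrow> matrix22 D A B A' B' a b c e = mat a b c e"
  unfolding matrix22_def mat_def by auto

lemma Pr_colm [simp]: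
  assumes "arrow f" "arrow g" "src f = src g" "tgt f = A" "tgt g = B"
  shows "Pr1 D A B \<cdot> colm f g = f" "Pr2 D A B \<cdot> colm f g = g"
  unfolding colm_def using assms by auto

lemma rowm_In [simp]:
  assumes "arrow f" "arrow g" "tgt f = tgt g" "src f = A" "src g = B"
  shows "rowm f g \<cdot> In1 D A B = f" "rowm f g \<cdot> In2 D A B = g"
  unfolding rowm_def using assms by auto

lemma colm_comp [simp]:
  assumes "arrow f" "arrow g" "arrow x" "src f = src g" "src g = tgt x"
  shows "colm f g \<cdot> x = colm (f \<cdot> x) (g \<cdot> x)"
  unfolding colm_def using assms by simp

lemma comp_rowm [simp]:
  assumes "arrow f" "arrow g" "arrow x" "tgt f = tgt g" "tgt g = src x"
  shows "x \<cdot> rowm f g = rowm (x \<cdot> f) (x \<cdot> g)"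
  unfolding rowm_def using assms by simp

lemma rowm_colm [simp]:
  assumes "arrow f" "arrow g" "arrow x" "arrow y" "src f = src g" "tgt x = tgt y"
    "src x = tgt f" "src y = tgt g"
  shows "rowm x y \<cdot> colm f g = x \<cdot> f \<oplus> y \<cdot> g"
  unfolding rowm_def using assms by simp

lemma In_colm:
  assumes "A \<in> Ob D" "B \<in> Ob D"
  shows "In1 D A B = colm (Id D A) (zm A B)" "In2 D A B = colm (zm B A) (Id D B)"
  unfolding colm_def using assms by simp_all

lemma Pr_rowm:
  assumes "A \<in> Ob D" "B \<in> Ob D"
  shows "Pr1 D A B = rowm (Id D A) (zm B A)" "Pr2 D A B = rowm (zm A B) (Id D B)"
  unfolding rowm_def using assms by simp_all

lemma colm_plus [simp]:
  assumes "arrow f" "arrow g" "arrow f'" "arrow g'" "src f = src g" "src f' = src g'"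
    "src g = src g'"
    "tgt f = tgt f'" "tgt g = tgt g'"
  shows "colm f g \<oplus> colm f' g' = colm (f \<oplus> f') (g \<oplus> g')"
  unfolding colm_def using assms by (simp add: plus_ac)

lemma rowm_plus [simp]:
  assumes "arrow f" "arrow g" "arrow f'" "arrow g'" "tgt f = tgt g" "tgt f' = tgt g'"
    "tgt g = tgt g'"
    "src f = src f'" "src g = src g'"
  shows "rowm f g \<oplus> rowm f' g' = rowm (f \<oplus> f') (g \<oplus> g')"
  unfolding rowm_def using assms by (simp add: plus_ac)

lemma minus_colm [simp]:
  assumes "arrow f" "arrow g" "src f = src g"
  shows "\<ominus> (colm f g) = colm (\<ominus> f) (\<ominus> g)"
  unfolding colm_def using assms by simp

lemma minus_rowm [simp]:
  assumes "arrow f" "arrow g" "tgt f = tgt g"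
  shows "\<ominus> (rowm f g) = rowm (\<ominus> f) (\<ominus> g)"
  unfolding rowm_def using assms by simp

lemma rowm_colms [simp]:
  "rowm (colm a c) (colm b e) = mat a b c e"
  unfolding mat_def ..

lemma mat_colm [simp]:
  assumes "arrow a" "arrow b" "arrow c" "arrow e" "src a = src c" "src b = src e"
    "tgt a = tgt b" "tgt c = tgt e" "arrow x" "arrow y" "src x = src y" "tgt x = src c"
    "tgt y = src e"
  shows "mat a b c e \<cdot> colm x y = colm (a \<cdot> x \<oplus> b \<cdot> y) (c \<cdot> x \<oplus> e \<cdot> y)"
  unfolding mat_def using assms by (simp del: rowm_colms)

text \<open>Together with \<open>rowm_colms\<close> this makes \<open>mat\<close> the normal form
  for both ways of assembling a matrix.\<close>

lemma colm_rows [simp]: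
  assumes "arrow a" "arrow b" "arrow c" "arrow e" "src a = src c" "src b = src e"
    "tgt a = tgt b" "tgt c = tgt e"
  shows "colm (rowm a b) (rowm c e) = mat a b c e"
  unfolding mat_def rowm_def colm_def using assms by (simp add: plus_ac)

lemma rowm_mat [simp]:
  assumes "arrow a" "arrow b" "arrow c" "arrow e" "src a = src c" "src b = src e"
    "tgt a = tgt b" "tgt c = tgt e" "arrow x" "arrow y" "tgt x = tgt y" "src x = tgt b"
    "src y = tgt e"
  shows "rowm x y \<cdot> mat a b c e = rowm (x \<cdot> a \<oplus> y \<cdot> c) (x \<cdot> b \<oplus> y \<cdot> e)"
  unfolding mat_def using assms by (simp del: rowm_colms)

lemma mat_mat [simp]:
  assumes "arrow a" "arrow b" "arrow c" "arrow e" "src a = src c" "src b = src e"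
    "tgt a = tgt b" "tgt c = tgt e"
    "arrow a'" "arrow b'" "arrow c'" "arrow e'" "src a' = src c'" "src b' = src e'"
    "tgt a' = tgt b'" "tgt c' = tgt e'" "src c = tgt b'" "src e = tgt e'"
  shows "mat a b c e \<cdot> mat a' b' c' e' =
    mat (a \<cdot> a' \<oplus> b \<cdot> c') (a \<cdot> b' \<oplus> b \<cdot> e') (c \<cdot> a' \<oplus> e \<cdot> c') (c \<cdot> b' \<oplus> e \<cdot> e')"
proof -
  have "mat a b c e \<cdot> mat a' b' c' e' = rowm (mat a b c e \<cdot> colm a' c') (mat a b c e \<cdot> colm b' e')"
    unfolding mat_def[of a' b' c' e'] using assms by (intro comp_rowm) simp_all
  then show ?thesis using assms by simp
qed

lemma minus_mat [simp]:
  assumes "arrow a" "arrow b" "arrow c" "arrow e" "src a = src c" "src b = src e"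
    "tgt a = tgt b" "tgt c = tgt e"
  shows "\<ominus> (mat a b c e) = mat (\<ominus> a) (\<ominus> b) (\<ominus> c) (\<ominus> e)"
  unfolding mat_def using assms by (simp del: rowm_colms)

lemma mat_plus [simp]:
  assumes "arrow a" "arrow b" "arrow c" "arrow e" "src a = src c" "src b = src e"
    "tgt a = tgt b" "tgt c = tgt e"
    "arrow a'" "arrow b'" "arrow c'" "arrow e'" "src a' = src c'" "src b' = src e'"
    "tgt a' = tgt b'" "tgt c' = tgt e'" "src c = src c'" "src e = src e'" "tgt b = tgt b'"
    "tgt e = tgt e'"
  shows "mat a b c e \<oplus> mat a' b' c' e' = mat (a \<oplus> a') (b \<oplus> b') (c \<oplus> c') (e \<oplus> e')"
  unfolding mat_def using assms by (simp del: rowm_colms)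

lemma mat_Id [simp]:
  "\<lbrakk>A \<in> Ob D; B \<in> Ob D\<rbrakk> \<Longrightarrow>
    mat (Id D A) (zm B A) (zm A B) (Id D B) = Id D (Sum D A B)"
  unfolding mat_def rowm_def colm_def using In_Pr by simp

lemma colm_zero [simp]:
  "\<lbrakk>A \<in> Ob D; B \<in> Ob D; X \<in> Ob D\<rbrakk> \<Longrightarrow>
    colm (zm X A) (zm X B) = zm X (Sum D A B)"
  unfolding colm_def by simp

lemma rowm_zero [simp]:
  "\<lbrakk>A \<in> Ob D; B \<in> Ob D; X \<in> Ob D\<rbrakk> \<Longrightarrow>
    rowm (zm A X) (zm B X) = zm (Sum D A B) X"
  unfolding rowm_def by simp

lemma rowm_zero_colm [simp]:
  assumes "arrow f" "arrow g" "src f = src g" "tgt f = B" "tgt g = C" "A \<in> Ob D"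
  shows "rowm (zm A (Sum D B C)) (colm f g) = mat (zm A B) f (zm A C) g"
    "rowm (colm f g) (zm A (Sum D B C)) = mat f (zm A B) g (zm A C)"
  unfolding mat_def using assms by (auto simp del: rowm_colms)

text \<open>Multiplication by the sign (-1)^k. The case k = n is the sign in a left
  rotation.\<close>

definition sg :: "nat \<Rightarrow> 'm \<Rightarrow> 'm" where
  "sg k f = (if even k then f else \<ominus> f)"

lemma sg_simps [simp]:
  assumes "arrow f"
  shows "arrow (sg k f)" "src (sg k f) = src f" "tgt (sg k f) = tgt f"
    "sg (Suc k) f = \<ominus> (sg k f)" "sg 0 f = f" "sg k (sg k f) = f" "sg k (\<ominus> f) = \<ominus> (sg k f)"
  using assms by (simp_all add: sg_def)

lemma sg_comp [simp]:
  assumes "arrow f" "arrow g" "src g = tgt f"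
  shows "sg k g \<cdot> f = sg k (g \<cdot> f)" "g \<cdot> sg k f = sg k (g \<cdot> f)"
  using assms by (simp_all add: sg_def)

lemma sg_zero [simp]: "\<lbrakk>A \<in> Ob D; B \<in> Ob D\<rbrakk> \<Longrightarrow> sg k (zm A B) = zm A B"
  by (simp add: sg_def)

lemma sg_colm [simp]:
  "\<lbrakk>arrow f; arrow g; src f = src g\<rbrakk> \<Longrightarrow> sg k (colm f g) = colm (sg k f) (sg k g)"
  by (simp add: sg_def)

lemma sg_rowm [simp]:
  "\<lbrakk>arrow f; arrow g; tgt f = tgt g\<rbrakk> \<Longrightarrow> sg k (rowm f g) = rowm (sg k f) (sg k g)"
  by (simp add: sg_def)

lemma sg_mat [simp]:
  assumes "arrow a" "arrow b" "arrow c" "arrow e" "src a = src c" "src b = src e"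
    "tgt a = tgt b" "tgt c = tgt e"
  shows "sg k (mat a b c e) = mat (sg k a) (sg k b) (sg k c) (sg k e)"
  using assms by (simp add: sg_def)

text \<open>These are the morphisms isomorphic to the inclusion of a direct summand. The complement
  is \<open>src \<sigma>\<close>, split off by \<sigma> and q. Where idempotents do not split, this
  says more than the existence of a retraction r.\<close>

definition complemented :: "'m \<Rightarrow> bool" where
  "complemented i \<longleftrightarrow> arrow i \<and>
    (\<exists>r \<sigma> q. arrow r \<and> arrow \<sigma> \<and> arrow q \<and> src r = tgt i \<and> tgt r = src i \<and>
      tgt \<sigma> = tgt i \<and> src q = tgt i \<and> tgt q = src \<sigma> \<and>
      r \<cdot> i = Id D (src i) \<and> q \<cdot> \<sigma> = Id D (src \<sigma>) \<and> q \<cdot> i = zm (src i) (src \<sigma>) \<and>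
      i \<cdot> r \<oplus> \<sigma> \<cdot> q = Id D (tgt i))"

lemma complementedI:
  assumes "arrow i" "arrow r" "arrow \<sigma>" "arrow q" "src r = tgt i" "tgt r = src i"
    "tgt \<sigma> = tgt i" "src q = tgt i" "tgt q = src \<sigma>"
    "r \<cdot> i = Id D (src i)" "q \<cdot> \<sigma> = Id D (src \<sigma>)" "q \<cdot> i = zm (src i) (src \<sigma>)"
    "i \<cdot> r \<oplus> \<sigma> \<cdot> q = Id D (tgt i)"
  shows "complemented i"
  unfolding complemented_def using assms by blast

text \<open>The retraction can be exchanged: replacing \<sigma> by \<sigma> - i p \<sigma> moves the
  complement into the kernel of p, while q stays the same.\<close>

lemma complemented_retraction:
  assumes "complemented i" "arrow p" "src p = tgt i" "tgt p = src i" "p \<cdot> i = Id D (src i)"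
  obtains \<sigma> q where "arrow \<sigma>" "arrow q" "tgt \<sigma> = tgt i" "src q = tgt i" "tgt q = src \<sigma>"
    "q \<cdot> \<sigma> = Id D (src \<sigma>)" "q \<cdot> i = zm (src i) (src \<sigma>)"
    "p \<cdot> \<sigma> = zm (src \<sigma>) (src i)" "i \<cdot> p \<oplus> \<sigma> \<cdot> q = Id D (tgt i)"
proof -
  obtain r \<sigma> q where [simp]: "arrow i" "arrow r" "arrow \<sigma>" "arrow q" "src r = tgt i" "tgt r = src i"
      "tgt \<sigma> = tgt i" "src q = tgt i" "tgt q = src \<sigma>"
    and eq: "r \<cdot> i = Id D (src i)" "q \<cdot> \<sigma> = Id D (src \<sigma>)" "q \<cdot> i = zm (src i) (src \<sigma>)"
      "i \<cdot> r \<oplus> \<sigma> \<cdot> q = Id D (tgt i)"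
    using assms(1) unfolding complemented_def by blast
  note [simp] = assms(2-5)
  have qi: "q \<cdot> (i \<cdot> x) = zm (src x) (src \<sigma>)" if "arrow x" "tgt x = src i" for x
    by (rule comp_zero_assoc[OF eq(3)]) (simp_all add: that)
  have pi: "p \<cdot> (i \<cdot> x) = x" if "arrow x" "tgt x = src i" for x
    using comp_assoc'[of x i p] by (simp add: that)
  define \<sigma>' where "\<sigma>' = \<sigma> \<oplus> \<ominus> (i \<cdot> (p \<cdot> \<sigma>))"
  have [simp]: "arrow \<sigma>'" "tgt \<sigma>' = tgt i" "src \<sigma>' = src \<sigma>" by (simp_all add: \<sigma>'_def)
  have \<sigma>q: "\<sigma> \<cdot> q = \<ominus> (i \<cdot> r) \<oplus> Id D (tgt i)"
    using arg_cong[OF eq(4), of "\<lambda>x. \<ominus> (i \<cdot> r) \<oplus> x"] by simp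
  have "i \<cdot> p \<oplus> \<sigma>' \<cdot> q = Id D (tgt i)"
    unfolding \<sigma>'_def by (simp add: \<sigma>q pi plus_ac)
  moreover have "q \<cdot> \<sigma>' = Id D (src \<sigma>')" "p \<cdot> \<sigma>' = zm (src \<sigma>') (src i)"
    by (simp_all add: \<sigma>'_def eq qi pi)
  ultimately show ?thesis using that[of \<sigma>' q] eq(3) by simp
qed

lemma complemented_iso:
  assumes "arrow i" "arrow r" "src r = tgt i" "tgt r = src i"
    "r \<cdot> i = Id D (src i)" "i \<cdot> r = Id D (tgt i)"
  shows "complemented i"
  by (rule complementedI[of i r "zm (Zer D) (tgt i)" "zm (tgt i) (Zer D)"])
    (simp_all add: assms)

lemma complemented_Id [simp]: "A \<in> Ob D \<Longrightarrow> complemented (Id D A)"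
  by (rule complemented_iso[of _ "Id D A"]) simp_all

lemma complemented_minus:
  assumes "complemented i"
  shows "complemented (\<ominus> i)"
proof -
  obtain r \<sigma> q where "arrow i" "arrow r" "arrow \<sigma>" "arrow q" "src r = tgt i" "tgt r = src i"
      "tgt \<sigma> = tgt i" "src q = tgt i" "tgt q = src \<sigma>"
      "r \<cdot> i = Id D (src i)" "q \<cdot> \<sigma> = Id D (src \<sigma>)" "q \<cdot> i = zm (src i) (src \<sigma>)"
      "i \<cdot> r \<oplus> \<sigma> \<cdot> q = Id D (tgt i)"
    using assms(1) unfolding complemented_def by blast
  then show ?thesis by (intro complementedI[of "\<ominus> i" "\<ominus> r" \<sigma> q]) simp_all
qed

lemma complemented_sg: "complemented i \<Longrightarrow> complemented (sg k i)"
  using complemented_minus by (simp add: sg_def)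

text \<open>With g invertible, the column is the graph of f h over the second summand, so the first
  summand is a complement.\<close>

lemma complemented_colm_iso:
  assumes "arrow f" "arrow g" "arrow h" "src f = src g" "src h = tgt g" "tgt h = src g"
    "h \<cdot> g = Id D (src g)" "g \<cdot> h = Id D (tgt g)"
  shows "complemented (colm f g)"
proof (rule complementedI[of _ "rowm (zm (tgt f) (src g)) h" "In1 D (tgt f) (tgt g)"
      "rowm (Id D (tgt f)) (\<ominus> (f \<cdot> h))"])
  have "g \<cdot> (h \<cdot> x) = x" if "arrow x" "tgt x = tgt g" for x
    using comp_assoc'[of x h g] assms that by simp
  have "colm f g \<cdot> rowm (zm (tgt f) (src g)) h \<oplus>
      In1 D (tgt f) (tgt g) \<cdot> rowm (Id D (tgt f)) (\<ominus> (f \<cdot> h)) = Id D (Sum D (tgt f) (tgt g))"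
    unfolding In_colm(1)[OF tgt_ob[OF assms(1)] tgt_ob[OF assms(2)]] by (simp add: assms)
  then show "colm f g \<cdot> rowm (zm (tgt f) (src g)) h \<oplus>
      In1 D (tgt f) (tgt g) \<cdot> rowm (Id D (tgt f)) (\<ominus> (f \<cdot> h)) = Id D (tgt (colm f g))"
    by (simp add: assms)
qed (simp_all add: assms)

lemma complemented_In1 [simp]:
  assumes "A \<in> Ob D" "B \<in> Ob D"
  shows "complemented (In1 D A B)"
  by (rule complementedI[of _ "Pr1 D A B" "In2 D A B" "Pr2 D A B"]) (simp_all add: assms In_Pr)

text \<open>The shear by u r turns the column into i followed by the first inclusion. The complement
  is therefore that of i plus the target of u.\<close>

lemma complemented_colm:
  assumes "complemented i" "arrow u" "src u = src i"
  shows "complemented (colm i u)"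
proof -
  obtain r \<sigma> q where [simp]: "arrow i" "arrow r" "arrow \<sigma>" "arrow q" "src r = tgt i" "tgt r = src i"
      "tgt \<sigma> = tgt i" "src q = tgt i" "tgt q = src \<sigma>"
    and eq [simp]: "r \<cdot> i = Id D (src i)" "q \<cdot> \<sigma> = Id D (src \<sigma>)"
      "q \<cdot> i = zm (src i) (src \<sigma>)" "i \<cdot> r \<oplus> \<sigma> \<cdot> q = Id D (tgt i)"
    using assms(1) unfolding complemented_def by blast
  note [simp] = assms(2,3)
  \<comment> \<open>Inserting i r + \<sigma> q = 1 between r and \<sigma> gives r \<sigma> = r
    \<sigma> + r \<sigma>.\<close>
  have "r \<cdot> \<sigma> = zm (src \<sigma>) (src i)"
  proof -
    have "r \<cdot> \<sigma> = r \<cdot> ((i \<cdot> r \<oplus> \<sigma> \<cdot> q) \<cdot> \<sigma>)" unfolding eq by simp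
    also have "\<dots> = r \<cdot> i \<cdot> r \<cdot> \<sigma> \<oplus> r \<cdot> \<sigma>" by (simp del: eq(1,4))
    finally have "r \<cdot> \<sigma> = r \<cdot> \<sigma> \<oplus> r \<cdot> \<sigma>" by simp
    then have "r \<cdot> \<sigma> \<oplus> r \<cdot> \<sigma> = r \<cdot> \<sigma> \<oplus> zm (src \<sigma>) (src i)" by simp
    then show ?thesis by (rule plus_left_cancel[rotated -1]) simp_all
  qed
  then show ?thesis
    by (intro complementedI[of _ "rowm r (zm (tgt u) (src i))"
          "mat \<sigma> (zm (tgt u) (tgt i)) (zm (src \<sigma>) (tgt u)) (Id D (tgt u))"
          "mat q (zm (tgt u) (src \<sigma>)) (\<ominus> (u \<cdot> r)) (Id D (tgt u))"]) simp_all
qed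

lemma Pr_mat [simp]:
  assumes "arrow a" "arrow b" "arrow c" "arrow e" "src a = src c" "src b = src e"
    "tgt a = tgt b" "tgt c = tgt e" "A = tgt b" "B = tgt e"
  shows "Pr1 D A B \<cdot> mat a b c e = rowm a b" "Pr2 D A B \<cdot> mat a b c e = rowm c e"
  using assms by (simp_all add: colm_rows[symmetric] del: colm_rows)

lemma mat_In [simp]:
  assumes "arrow a" "arrow b" "arrow c" "arrow e" "src a = src c" "src b = src e"
    "tgt a = tgt b" "tgt c = tgt e" "A = src c" "B = src e"
  shows "mat a b c e \<cdot> In1 D A B = colm a c" "mat a b c e \<cdot> In2 D A B = colm b e"
  using assms by (simp_all add: rowm_colms[symmetric] del: rowm_colms)

end

section \<open>The automorphism and its compatibility with biproducts\<close>

context additive_automorphism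
begin

abbreviation S :: "'o \<Rightarrow> 'o" where "S \<equiv> FOb \<Sigma>"
abbreviation SM :: "'m \<Rightarrow> 'm" where "SM \<equiv> FMor \<Sigma>"

lemma S_ob [simp]: "A \<in> Ob D \<Longrightarrow> S A \<in> Ob D"
  using F_ob by (auto simp: bij_betw_def)

lemma S_surj:
  assumes "A \<in> Ob D"
  obtains B where "B \<in> Ob D" "S B = A"
  using F_ob assms bij_betw_imp_surj_on by (metis imageE)

lemma
  assumes "arrow f"
  shows arrow_SM [simp]: "arrow (SM f)"
    and src_SM [simp]: "src (SM f) = S (src f)"
    and tgt_SM [simp]: "tgt (SM f) = S (tgt f)"
proof -
  have "SM \<in> hom (Hom D (src f) (tgt f)) (Hom D (S (src f)) (S (tgt f)))"
    using F_iso[of "src f" "tgt f"] assms by (simp add: iso_def)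
  then have "SM f \<in> mor D (S (src f)) (S (tgt f))"
    using arrow_mor[OF assms] by (rule hom_in_carrier)
  then show "arrow (SM f)" "src (SM f) = S (src f)" "tgt (SM f) = S (tgt f)" using assms by simp_all
qed

lemma SM_Id [simp]: "A \<in> Ob D \<Longrightarrow> SM (Id D A) = Id D (S A)"
  by (rule F_id)

lemma SM_comp [simp]: "\<lbrakk>arrow f; arrow g; src g = tgt f\<rbrakk> \<Longrightarrow> SM (g \<cdot> f) = SM g \<cdot> SM f"
  using F_comp[of "src f" "tgt f" "tgt g" f g] by simp

lemma SM_plus [simp]:
  assumes "arrow f" "arrow g" "src f = src g" "tgt f = tgt g"
  shows "SM (f \<oplus> g) = SM f \<oplus> SM g"
proof -
  have "SM \<in> hom (Hom D (src g) (tgt g)) (Hom D (S (src g)) (S (tgt g)))"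
    using F_iso[of "src g" "tgt g"] assms by (simp add: iso_def)
  from hom_mult[OF this, of f g] show ?thesis using assms by simp
qed

lemma SM_zero [simp]:
  assumes "A \<in> Ob D" "B \<in> Ob D"
  shows "SM (zm A B) = zm (S A) (S B)"
proof -
  let ?z = "SM (zm A B)"
  have "?z \<oplus> ?z = ?z \<oplus> zm (S A) (S B)"
    using SM_plus[of "zm A B" "zm A B"] assms by simp
  then show ?thesis by (rule plus_left_cancel[rotated -1]) (use assms in simp_all)
qed

lemma SM_minus [simp]: "arrow f \<Longrightarrow> SM (\<ominus> f) = \<ominus> (SM f)"
  using SM_plus[of f "\<ominus> f"] by (intro plus_eq_zero_minus) simp_all

lemma SM_inj:
  assumes "SM f = SM g" "arrow f" "arrow g" "src f = src g" "tgt f = tgt g"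
  shows "f = g"
proof -
  have "bij_betw SM (mor D (src g) (tgt g)) (mor D (S (src g)) (S (tgt g)))"
    using F_iso[of "src g" "tgt g"] assms by (simp add: iso_def)
  then have "inj_on SM (mor D (src g) (tgt g))" by (rule bij_betw_imp_inj_on)
  from inj_onD[OF this assms(1)] show ?thesis using assms by simp
qed

lemma SM_surj:
  assumes "arrow h" "src h = S A" "tgt h = S B" "A \<in> Ob D" "B \<in> Ob D"
  obtains f where "arrow f" "src f = A" "tgt f = B" "SM f = h"
proof -
  have "bij_betw SM (mor D A B) (mor D (S A) (S B))"
    using F_iso[of A B] assms by (simp add: iso_def)
  then have "SM ` mor D A B = mor D (S A) (S B)" by (rule bij_betw_imp_surj_on)
  moreover have "h \<in> mor D (S A) (S B)" using assms by simp
  ultimately obtain f where "f \<in> mor D A B" "SM f = h" by (metis imageE)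
  then show ?thesis using that mor_arrow assms(4,5) by metis
qed

abbreviation shift :: "'o \<Rightarrow> 'o \<Rightarrow> 'm" where "shift \<equiv> sum_shift D \<Sigma>"

lemma shift_rowm:
  assumes "A \<in> Ob D" "B \<in> Ob D"
  shows "shift A B = rowm (SM (In1 D A B)) (SM (In2 D A B))"
  unfolding sum_shift_def using assms by simp

lemma
  assumes "A \<in> Ob D" "B \<in> Ob D"
  shows arrow_shift [simp]: "arrow (shift A B)"
    and src_shift [simp]: "src (shift A B) = Sum D (S A) (S B)"
    and tgt_shift [simp]: "tgt (shift A B) = S (Sum D A B)"
  using assms by (simp_all add: shift_rowm)

text \<open>Since \<Sigma> need not preserve the chosen biproducts strictly, \<open>shift\<close>
  has to be carried along in all matrix computations under \<Sigma>.\<close>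

lemma SM_colm:
  assumes "arrow f" "arrow g" "src f = src g" "tgt f = A" "tgt g = B"
  shows "SM (colm f g) = shift A B \<cdot> colm (SM f) (SM g)"
  using assms by (auto simp: shift_rowm colm_def[of f g])

lemma SM_rowm_shift:
  assumes "arrow f" "arrow g" "tgt f = tgt g" "src f = A" "src g = B"
  shows "SM (rowm f g) \<cdot> shift A B = rowm (SM f) (SM g)"
proof -
  have "SM (rowm f g) \<cdot> SM (In1 D A B) = SM f" "SM (rowm f g) \<cdot> SM (In2 D A B) = SM g"
    using assms SM_comp[of "In1 D A B" "rowm f g"] SM_comp[of "In2 D A B" "rowm f g"] by auto
  then show ?thesis using assms by (auto simp: shift_rowm)
qed

lemma SM_Pr_In [simp]:
  assumes "A \<in> Ob D" "B \<in> Ob D"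
  shows "SM (Pr1 D A B) \<cdot> SM (In1 D A B) = Id D (S A)"
    "SM (Pr2 D A B) \<cdot> SM (In2 D A B) = Id D (S B)"
    "SM (Pr1 D A B) \<cdot> SM (In2 D A B) = zm (S B) (S A)"
    "SM (Pr2 D A B) \<cdot> SM (In1 D A B) = zm (S A) (S B)"
  using assms by (simp_all add: SM_comp[symmetric] del: SM_comp)

lemma SM_mat_shift:
  assumes "arrow a" "arrow b" "arrow c" "arrow e" "src a = src c" "src b = src e"
    "tgt a = tgt b" "tgt c = tgt e" "src c = A" "src e = B" "tgt b = A'" "tgt e = B'"
  shows "SM (mat a b c e) \<cdot> shift A B = shift A' B' \<cdot> mat (SM a) (SM b) (SM c) (SM e)"
proof -
  have "SM (mat a b c e) \<cdot> shift A B = rowm (SM (colm a c)) (SM (colm b e))"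
    unfolding mat_def using assms by (intro SM_rowm_shift) (auto simp del: rowm_colms)
  also have "\<dots> = shift A' B' \<cdot> mat (SM a) (SM b) (SM c) (SM e)"
    using assms by (auto simp: SM_colm mat_def[of "SM a"] simp del: rowm_colms comp_rowm
        intro!: comp_rowm[symmetric])
  finally show ?thesis .
qed

lemma shift_inverse:
  assumes "A \<in> Ob D" "B \<in> Ob D"
  shows "colm (SM (Pr1 D A B)) (SM (Pr2 D A B)) \<cdot> shift A B = Id D (Sum D (S A) (S B))"
    "shift A B \<cdot> colm (SM (Pr1 D A B)) (SM (Pr2 D A B)) = Id D (S (Sum D A B))"
proof -
  show "colm (SM (Pr1 D A B)) (SM (Pr2 D A B)) \<cdot> shift A B = Id D (Sum D (S A) (S B))"
    using assms by (simp add: shift_rowm)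
  have "SM (In1 D A B) \<cdot> SM (Pr1 D A B) \<oplus> SM (In2 D A B) \<cdot> SM (Pr2 D A B) =
      SM (In1 D A B \<cdot> Pr1 D A B \<oplus> In2 D A B \<cdot> Pr2 D A B)" using assms by simp
  then show "shift A B \<cdot> colm (SM (Pr1 D A B)) (SM (Pr2 D A B)) = Id D (S (Sum D A B))"
    using assms In_Pr[of A B] by (simp add: shift_rowm)
qed

end

section \<open>Sequences and rotation\<close>

locale positive_angulated_category = angulated_category n D \<Sigma> P
  for n :: nat
    and D :: "('o, 'm) addcat" (structure)
    and \<Sigma> :: "('o, 'm) endofunctor"
    and P :: "('o, 'm) chain set" +
  assumes n_pos: "1 \<le> n"
begin

abbreviation seq :: "('o, 'm) chain \<Rightarrow> bool" where "seq \<equiv> sigma_seq n D \<Sigma>"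

abbreviation seq_map :: "('o, 'm) chain \<Rightarrow> ('o, 'm) chain \<Rightarrow> (nat \<Rightarrow> 'm) \<Rightarrow> bool" where
  "seq_map \<equiv> sigma_seq_map n D \<Sigma>"

abbreviation rot :: "('o, 'm) chain \<Rightarrow> ('o, 'm) chain" where "rot \<equiv> left_rotation n D \<Sigma>"

text \<open>Degree \<open>n + 2\<close> is degree \<open>0\<close> shifted by \<open>\<Sigma>\<close>.\<close>

definition cyc_ob :: "('o, 'm) chain \<Rightarrow> nat \<Rightarrow> 'o" where
  "cyc_ob X i = (if i \<le> Suc n then Obj X i else S (Obj X 0))"

definition cyc_map :: "(nat \<Rightarrow> 'm) \<Rightarrow> nat \<Rightarrow> 'm" where
  "cyc_map f i = (if i \<le> Suc n then f i else SM (f 0))"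

lemma cyc_ob_simps [simp]:
  "i \<le> Suc n \<Longrightarrow> cyc_ob X i = Obj X i" "cyc_ob X (Suc (Suc n)) = S (Obj X 0)"
  by (simp_all add: cyc_ob_def)

lemma cyc_map_simps [simp]:
  "i \<le> Suc n \<Longrightarrow> cyc_map f i = f i" "cyc_map f (Suc (Suc n)) = SM (f 0)"
  by (simp_all add: cyc_map_def)

lemma le_Suc_n_cases:
  assumes "i \<le> Suc n" "\<And>i. i \<le> n \<Longrightarrow> Q i" "Q (Suc n)"
  shows "Q i"
  using assms le_Suc_eq by metis

lemma seqI:
  assumes "\<And>i. i \<le> Suc n \<Longrightarrow> Obj X i \<in> Ob D"
    "\<And>i. i \<le> Suc n \<Longrightarrow> arrow (Dif X i) \<and> src (Dif X i) = Obj X i \<and> tgt (Dif X i) = cyc_ob X (Suc i)"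
  shows "seq X"
proof -
  have O: "Obj X i \<in> Ob D" if "i \<le> Suc n" for i using assms(1) that .
  have "Dif X i \<in> mor D (Obj X i) (Obj X (Suc i))" if "i \<le> n" for i
    using assms(2)[of i] O that by simp
  then show ?thesis unfolding sigma_seq_def using assms(2)[of "Suc n"] O by simp
qed

lemma seqD:
  assumes "seq X"
  shows "i \<le> Suc n \<Longrightarrow> Obj X i \<in> Ob D" "i \<le> Suc n \<Longrightarrow> arrow (Dif X i)"
    "i \<le> Suc n \<Longrightarrow> src (Dif X i) = Obj X i" "i \<le> n \<Longrightarrow> tgt (Dif X i) = Obj X (Suc i)"
    "tgt (Dif X (Suc n)) = S (Obj X 0)"
proof -
  have O: "Obj X i \<in> Ob D" if "i \<le> Suc n" for i using assms that by (simp add: sigma_seq_def)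
  then show "i \<le> Suc n \<Longrightarrow> Obj X i \<in> Ob D" .
  have d: "arrow (Dif X i) \<and> src (Dif X i) = Obj X i \<and> tgt (Dif X i) = Obj X (Suc i)" if
    "i \<le> n" for i
  proof -
    have "Dif X i \<in> mor D (Obj X i) (Obj X (Suc i))" using assms that
      by (simp add: sigma_seq_def del: mor_iff)
    then show ?thesis using that O[of i] O[of "Suc i"] by simp
  qed
  moreover have l: "arrow (Dif X (Suc n)) \<and> src (Dif X (Suc n)) = Obj X (Suc n) \<and>
      tgt (Dif X (Suc n)) = S (Obj X 0)"
    using assms O by (simp add: sigma_seq_def)
  ultimately have "arrow (Dif X i) \<and> src (Dif X i) = Obj X i" if "i \<le> Suc n" for i
    using that by (metis le_Suc_eq)
  then show "i \<le> Suc n \<Longrightarrow> arrow (Dif X i)" "i \<le> Suc n \<Longrightarrow> src (Dif X i) = Obj X i"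
    by simp_all
  show "i \<le> n \<Longrightarrow> tgt (Dif X i) = Obj X (Suc i)" "tgt (Dif X (Suc n)) = S (Obj X 0)"
    using d l by simp_all
qed

lemma seqD_cyc:
  assumes "seq X" "i \<le> Suc n"
  shows "tgt (Dif X i) = cyc_ob X (Suc i)" "cyc_ob X (Suc i) \<in> Ob D"
  by (rule le_Suc_n_cases[OF assms(2)]; simp add: seqD[OF assms(1)])+

lemma seq_mapI:
  assumes "\<And>i. i \<le> Suc n \<Longrightarrow> arrow (f i) \<and> src (f i) = Obj X i \<and> tgt (f i) = Obj Y i"
    "\<And>i. i \<le> Suc n \<Longrightarrow> cyc_map f (Suc i) \<cdot> Dif X i = Dif Y i \<cdot> f i"
  shows "seq_map X Y f"
proof -
  have "f i \<in> mor D (Obj X i) (Obj Y i)" if "i \<le> Suc n" for i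
    using assms(1)[OF that] arrow_mor[of "f i"] by simp
  moreover have "f (Suc i) \<cdot> Dif X i = Dif Y i \<cdot> f i" if "i \<le> n" for i
    using assms(2)[of i] that by simp
  ultimately show ?thesis
    unfolding sigma_seq_map_def using assms(2)[of "Suc n"] by (simp del: mor_iff)
qed

lemma seq_mapD:
  assumes "seq_map X Y f" "seq X" "seq Y"
  shows "i \<le> Suc n \<Longrightarrow> arrow (f i)" "i \<le> Suc n \<Longrightarrow> src (f i) = Obj X i"
    "i \<le> Suc n \<Longrightarrow> tgt (f i) = Obj Y i"
    "i \<le> n \<Longrightarrow> f (Suc i) \<cdot> Dif X i = Dif Y i \<cdot> f i"
    "SM (f 0) \<cdot> Dif X (Suc n) = Dif Y (Suc n) \<cdot> f (Suc n)"
proof -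
  have "f i \<in> mor D (Obj X i) (Obj Y i)" if "i \<le> Suc n" for i
    using assms(1) that by (simp add: sigma_seq_map_def del: mor_iff)
  then show "i \<le> Suc n \<Longrightarrow> arrow (f i)" "i \<le> Suc n \<Longrightarrow> src (f i) = Obj X i"
      "i \<le> Suc n \<Longrightarrow> tgt (f i) = Obj Y i"
    using mor_iff seqD(1)[OF assms(2)] seqD(1)[OF assms(3)] by metis+
  show "i \<le> n \<Longrightarrow> f (Suc i) \<cdot> Dif X i = Dif Y i \<cdot> f i"
      "SM (f 0) \<cdot> Dif X (Suc n) = Dif Y (Suc n) \<cdot> f (Suc n)"
    using assms(1) by (simp_all add: sigma_seq_map_def del: mor_iff)
qed

lemma seq_mapD_cyc:
  assumes "seq_map X Y f" "seq X" "seq Y" "i \<le> Suc n"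
  shows "cyc_map f (Suc i) \<cdot> Dif X i = Dif Y i \<cdot> f i"
    "arrow (cyc_map f (Suc i))" "src (cyc_map f (Suc i)) = cyc_ob X (Suc i)"
    "tgt (cyc_map f (Suc i)) = cyc_ob Y (Suc i)"
  by (rule le_Suc_n_cases[OF assms(4)]; simp add: seq_mapD[OF assms(1-3)])+

text \<open>Composing each square of f with the inverses on both sides gives the square of g, so
  isomorphisms of sequences can be checked degreewise.\<close>

lemma seq_map_inverse:
  assumes X: "seq X" and Y: "seq Y" and f: "seq_map X Y f"
    and g: "\<And>i. i \<le> Suc n \<Longrightarrow> arrow (g i) \<and> src (g i) = Obj Y i \<and> tgt (g i) = Obj X i"
    and gf: "\<And>i. i \<le> Suc n \<Longrightarrow> g i \<cdot> f i = Id D (Obj X i)"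
    and fg: "\<And>i. i \<le> Suc n \<Longrightarrow> f i \<cdot> g i = Id D (Obj Y i)"
  shows "seq_map Y X g"
proof (rule seq_mapI)
  note [simp] = seqD[OF X] seqD[OF Y] seq_mapD(1-3)[OF f X Y] g
    seqD_cyc[OF X] seqD_cyc[OF Y] seq_mapD_cyc(2-4)[OF f X Y] gf fg
  fix i assume i [simp]: "i \<le> Suc n"
  have [simp]: "arrow (cyc_map g (Suc i))" "src (cyc_map g (Suc i)) = cyc_ob Y (Suc i)"
      "tgt (cyc_map g (Suc i)) = cyc_ob X (Suc i)"
    and c: "cyc_map g (Suc i) \<cdot> cyc_map f (Suc i) = Id D (cyc_ob X (Suc i))"
    by (rule le_Suc_n_cases[OF i]; simp add: SM_comp[symmetric] del: SM_comp)+
  have "cyc_map g (Suc i) \<cdot> Dif Y i = cyc_map g (Suc i) \<cdot> (Dif Y i \<cdot> (f i \<cdot> g i))" by simp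
  also have "\<dots> = cyc_map g (Suc i) \<cdot> ((Dif Y i \<cdot> f i) \<cdot> g i)"
    by (subst comp_assoc'[of "g i"]) (simp_all del: fg)
  also have "\<dots> = cyc_map g (Suc i) \<cdot> (cyc_map f (Suc i) \<cdot> Dif X i \<cdot> g i)"
    by (subst seq_mapD_cyc(1)[OF f X Y i]) simp
  also have "\<dots> = cyc_map g (Suc i) \<cdot> cyc_map f (Suc i) \<cdot> (Dif X i \<cdot> g i)" by simp
  also have "\<dots> = Dif X i \<cdot> g i" unfolding c by simp
  finally show "cyc_map g (Suc i) \<cdot> Dif Y i = Dif X i \<cdot> g i" .
qed (rule g)

lemma angle_isoI:
  assumes X: "X \<in> P" and Y: "seq Y" and f: "seq_map X Y f"
    and g: "\<And>i. i \<le> Suc n \<Longrightarrow> arrow (g i) \<and> src (g i) = Obj Y i \<and> tgt (g i) = Obj X i"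
    and gf: "\<And>i. i \<le> Suc n \<Longrightarrow> g i \<cdot> f i = Id D (Obj X i)"
    and fg: "\<And>i. i \<le> Suc n \<Longrightarrow> f i \<cdot> g i = Id D (Obj Y i)"
  shows "Y \<in> P"
proof -
  have "seq_map Y X g"
    by (rule seq_map_inverse[OF angle_seq[OF X] Y f]) (fact g gf fg)+
  then have "sigma_seq_isomorphic n D \<Sigma> X Y"
    unfolding sigma_seq_isomorphic_def using f gf fg by (intro exI[of _ f] exI[of _ g]) simp
  then show ?thesis using F1_iso X Y by blast
qed

lemma angle_isoI':
  assumes Y: "Y \<in> P" and X: "seq X" and f: "seq_map X Y f"
    and g: "\<And>i. i \<le> Suc n \<Longrightarrow> arrow (g i) \<and> src (g i) = Obj Y i \<and> tgt (g i) = Obj X i"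
    and gf: "\<And>i. i \<le> Suc n \<Longrightarrow> g i \<cdot> f i = Id D (Obj X i)"
    and fg: "\<And>i. i \<le> Suc n \<Longrightarrow> f i \<cdot> g i = Id D (Obj Y i)"
  shows "X \<in> P"
proof (rule angle_isoI[OF Y X, of g f])
  show "seq_map Y X g"
    by (rule seq_map_inverse[OF X angle_seq[OF Y] f]) (fact g gf fg)+
  show "arrow (f i) \<and> src (f i) = Obj X i \<and> tgt (f i) = Obj Y i" if "i \<le> Suc n" for i
    using seq_mapD(1-3)[OF f X angle_seq[OF Y] that] by simp
qed (fact gf fg)+

text \<open>A record also carries values beyond degree n + 1, which mean nothing. Equality of
  records is too fine, and this relation takes its place.\<close>

definition agree :: "('o, 'm) chain \<Rightarrow> ('o, 'm) chain \<Rightarrow> bool" where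
  "agree X Y \<longleftrightarrow> (\<forall>i \<le> Suc n. Obj X i = Obj Y i \<and> Dif X i = Dif Y i)"

lemma agree_sym: "agree X Y \<Longrightarrow> agree Y X"
  by (simp add: agree_def)

lemma agree_seq: "\<lbrakk>agree X Y; seq X\<rbrakk> \<Longrightarrow> seq Y"
  by (auto simp: agree_def sigma_seq_def simp del: mor_iff)

lemma agree_seq_map: "\<lbrakk>agree X X'; agree Y Y'; seq_map X Y f\<rbrakk> \<Longrightarrow> seq_map X' Y' f"
  by (auto simp: agree_def sigma_seq_map_def simp del: mor_iff)

lemma agree_angle:
  assumes "agree X Y" "X \<in> P"
  shows "Y \<in> P"
proof (rule angle_isoI[OF assms(2), of _ "\<lambda>i. Id D (Obj X i)" "\<lambda>i. Id D (Obj X i)"])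
  have X: "seq X" using assms(2) by (rule angle_seq)
  note [simp] = seqD[OF X]
  show "seq Y" using agree_seq[OF assms(1) X] .
  have eq: "\<And>i. i \<le> Suc n \<Longrightarrow> Obj Y i = Obj X i" "\<And>i. i \<le> Suc n \<Longrightarrow> Dif Y i = Dif X i"
    using assms(1) by (simp_all add: agree_def)
  note [simp] = eq
  show "seq_map X Y (\<lambda>i. Id D (Obj X i))"
  proof (rule seq_mapI)
    fix i assume "i \<le> Suc n"
    then show "cyc_map (\<lambda>i. Id D (Obj X i)) (Suc i) \<cdot> Dif X i = Dif Y i \<cdot> Id D (Obj X i)"
      by (rule le_Suc_n_cases) simp_all
  qed simp
qed (use assms seqD(1)[OF angle_seq[OF assms(2)]] in \<open>simp_all add: agree_def\<close>)

lemma rot_simps [simp]: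
  "i \<le> n \<Longrightarrow> Obj (rot X) i = Obj X (Suc i)" "Obj (rot X) (Suc n) = S (Obj X 0)"
  "i \<le> n \<Longrightarrow> Dif (rot X) i = Dif X (Suc i)"
  by (simp_all add: left_rotation_def)

lemma Dif_rot_last [simp]: "seq X \<Longrightarrow> Dif (rot X) (Suc n) = sg n (SM (Dif X 0))"
  using seqD(1-4)[of X 0] seqD(1)[of X "Suc 0"] by (simp add: left_rotation_def sg_def)

lemma seq_rot:
  assumes "seq X"
  shows "seq (rot X)"
proof (rule seqI)
  note [simp] = seqD[OF assms] assms
  fix i assume i: "i \<le> Suc n"
  show "Obj (rot X) i \<in> Ob D" using i by (rule le_Suc_n_cases) simp_all
  have t: "tgt (Dif X (Suc i)) = Obj (rot X) (Suc i)" if "i \<le> n" for i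
    using that by (cases "i = n") simp_all
  show "arrow (Dif (rot X) i) \<and> src (Dif (rot X) i) = Obj (rot X) i \<and>
      tgt (Dif (rot X) i) = cyc_ob (rot X) (Suc i)"
    by (rule le_Suc_n_cases[OF i]) (simp_all add: t)
qed

lemma rot_angle: "X \<in> P \<Longrightarrow> rot X \<in> P"
  using F2 angle_seq by blast

lemma seq_map_rot:
  assumes "seq_map X Y f" "seq X" "seq Y"
  shows "seq_map (rot X) (rot Y) (\<lambda>i. cyc_map f (Suc i))"
proof (rule seq_mapI)
  note f = seq_mapD[OF assms]
  note [simp] = f(1-3) seqD[OF assms(2)] seqD[OF assms(3)] assms(2,3)
  fix i assume i: "i \<le> Suc n"
  show "arrow (cyc_map f (Suc i)) \<and> src (cyc_map f (Suc i)) = Obj (rot X) i \<and>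
      tgt (cyc_map f (Suc i)) = Obj (rot Y) i"
    using i by (rule le_Suc_n_cases) simp_all
  show "cyc_map (\<lambda>i. cyc_map f (Suc i)) (Suc i) \<cdot> Dif (rot X) i = Dif (rot Y) i \<cdot> cyc_map f (Suc i)"
    using i
  proof (rule le_Suc_n_cases)
    fix i assume "i \<le> n"
    then show "cyc_map (\<lambda>i. cyc_map f (Suc i)) (Suc i) \<cdot> Dif (rot X) i =
        Dif (rot Y) i \<cdot> cyc_map f (Suc i)"
      using f(4)[of "Suc i"] f(5) by (cases "i = n") simp_all
  next
    show "cyc_map (\<lambda>i. cyc_map f (Suc i)) (Suc (Suc n)) \<cdot> Dif (rot X) (Suc n) =
        Dif (rot Y) (Suc n) \<cdot> cyc_map f (Suc (Suc n))"
      using arg_cong[OF f(4)[of 0], of SM] by simp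
  qed
qed

text \<open>\<Sigma> is bijective on objects and on hom groups, and the sign \<open>sg n\<close> is
  its own inverse, so the last map of X can be desuspended to a first map of R.\<close>

lemma right_rotation:
  assumes "seq X"
  obtains R where "seq R" "agree (rot R) X"
proof -
  note [simp] = seqD[OF assms]
  obtain B where B [simp]: "B \<in> Ob D" and SB [simp]: "S B = Obj X (Suc n)"
    using S_surj[of "Obj X (Suc n)"] by auto
  obtain d where d [simp]: "arrow d" "src d = B" "tgt d = Obj X 0"
    and Sd: "SM d = sg n (Dif X (Suc n))"
    using SM_surj[of "sg n (Dif X (Suc n))" B "Obj X 0"] by auto
  define R :: "('o, 'm) chain" where "R = \<lparr>Obj = (\<lambda>i. if i = 0 then B else Obj X (i - 1)),
    Dif = (\<lambda>i. if i = 0 then d else Dif X (i - 1))\<rparr>"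
  have R: "seq R"
  proof (rule seqI)
    fix i assume i: "i \<le> Suc n"
    show "Obj R i \<in> Ob D" using i by (simp add: R_def)
    show "arrow (Dif R i) \<and> src (Dif R i) = Obj R i \<and> tgt (Dif R i) = cyc_ob R (Suc i)"
    proof (cases i)
      case (Suc j)
      then show ?thesis using i by (cases "j = n") (simp_all add: R_def)
    qed (simp add: R_def)
  qed
  moreover have "agree (rot R) X"
    unfolding agree_def
  proof (intro allI impI)
    fix i assume i: "i \<le> Suc n"
    show "Obj (rot R) i = Obj X i \<and> Dif (rot R) i = Dif X i"
      by (rule le_Suc_n_cases[OF i]) (simp_all add: R, simp_all add: R_def Sd)
  qed
  ultimately show ?thesis by (rule that)
qed

lemma right_rotationD:
  assumes "seq R" "agree (rot R) X"
  shows "S (Obj R 0) = Obj X (Suc n)" "i \<le> n \<Longrightarrow> Obj R (Suc i) = Obj X i"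
    "i \<le> n \<Longrightarrow> Dif R (Suc i) = Dif X i" "SM (Dif R 0) = sg n (Dif X (Suc n))"
proof -
  have *: "Obj (rot R) i = Obj X i" "Dif (rot R) i = Dif X i" if "i \<le> Suc n" for i
    using assms(2) that by (simp_all add: agree_def)
  show "S (Obj R 0) = Obj X (Suc n)" using *(1)[of "Suc n"] by simp
  show "i \<le> n \<Longrightarrow> Obj R (Suc i) = Obj X i" using *(1)[of i] by simp
  show "i \<le> n \<Longrightarrow> Dif R (Suc i) = Dif X i" using *(2)[of i] by simp
  have "sg n (SM (Dif R 0)) = Dif X (Suc n)" using *(2)[of "Suc n"] assms(1) by simp
  from arg_cong[OF this, of "sg n"] show "SM (Dif R 0) = sg n (Dif X (Suc n))"
    using seqD(2-3)[OF assms(1), of 0] by simp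
qed

lemma right_rotation_angle:
  assumes "seq R" "agree (rot R) X" "X \<in> P"
  shows "R \<in> P"
  using agree_angle[OF agree_sym[OF assms(2)] assms(3)] F2[OF assms(1)] by simp

section \<open>Trivial angles in all positions\<close>

definition triv_seq :: "nat \<Rightarrow> 'o \<Rightarrow> ('o, 'm) chain" where
  "triv_seq k U = \<lparr>Obj = Obj (triv D k U),
     Dif = (\<lambda>i. if i \<le> n then Dif (triv D k U) i
       else zm (Obj (triv D k U) (Suc n)) (S (Obj (triv D k U) 0)))\<rparr>"

lemma Obj_triv_seq: "Obj (triv_seq k U) i = (if i = k \<or> i = Suc k then U else Zer D)"
  by (simp add: triv_seq_def triv_def Let_def)

lemma Dif_triv_seq:
  "i \<le> n \<Longrightarrow> Dif (triv_seq k U) i = (if i = k then Id D U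
    else zm (Obj (triv_seq k U) i) (Obj (triv_seq k U) (Suc i)))"
  "Dif (triv_seq k U) (Suc n) = zm (Obj (triv_seq k U) (Suc n)) (S (Obj (triv_seq k U) 0))"
  unfolding Obj_triv_seq by (simp_all add: triv_seq_def triv_def Let_def)

lemma seq_triv:
  assumes "U \<in> Ob D" "k \<le> n"
  shows "seq (triv_seq k U)"
proof (rule seqI)
  fix i assume i: "i \<le> Suc n"
  show O: "Obj (triv_seq k U) i \<in> Ob D" for i using assms by (simp add: Obj_triv_seq)
  show "arrow (Dif (triv_seq k U) i) \<and> src (Dif (triv_seq k U) i) = Obj (triv_seq k U) i \<and>
      tgt (Dif (triv_seq k U) i) = cyc_ob (triv_seq k U) (Suc i)"
    using i
  proof (rule le_Suc_n_cases)
    fix i assume i: "i \<le> n"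
    then show "arrow (Dif (triv_seq k U) i) \<and> src (Dif (triv_seq k U) i) = Obj (triv_seq k U) i \<and>
        tgt (Dif (triv_seq k U) i) = cyc_ob (triv_seq k U) (Suc i)"
      using O[of i] O[of "Suc i"] assms by (cases "i = k") (simp_all add: Dif_triv_seq,
        simp_all add: Obj_triv_seq)
  qed (use O in \<open>simp add: Dif_triv_seq\<close>)
qed

text \<open>Induction on k, reading (F2) backwards: the rotation of
  \<open>triv_seq (Suc k) U\<close> is \<open>triv_seq k U\<close> up to replacing the zero object
  in degree n + 1 by its image under \<Sigma>, which is again a zero object.\<close>

lemma triv_angle:
  assumes "U \<in> Ob D" "k \<le> n"
  shows "triv_seq k U \<in> P"
  using assms(2)
proof (induction k)
  case 0
  have "agree (trivial_angle n D \<Sigma> U) (triv_seq 0 U)"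
    using n_pos by (auto simp: agree_def trivial_angle_def triv_seq_def triv_def)
  then show ?case using agree_angle F1_trivial[OF assms(1)] by blast
next
  case (Suc k)
  let ?X = "triv_seq k U" and ?Y = "rot (triv_seq (Suc k) U)"
  have X: "seq ?X" and Y: "seq (triv_seq (Suc k) U)" using Suc.prems assms(1)
    by (simp_all add: seq_triv)
  define f where "f i = (if i \<le> n then Id D (Obj ?X i) else zm (Zer D) (S (Zer D)))" for i
  define g where "g i = (if i \<le> n then Id D (Obj ?X i) else zm (S (Zer D)) (Zer D))" for i
  have Yo: "Obj ?Y i = Obj ?X i" "Dif ?Y i = Dif ?X i" if "i < n" for i
    using that by (simp_all add: Obj_triv_seq Dif_triv_seq)
  have Yn: "Obj ?Y n = Obj ?X n" by (simp add: Obj_triv_seq)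
  have O [simp]: "Obj ?X i \<in> Ob D" for i using assms(1) by (simp add: Obj_triv_seq)
  have SZ: "zm (S (Zer D)) (S (Zer D)) = Id D (S (Zer D))"
    using SM_Id[of "Zer D"] by simp
  have L: "Obj ?X (Suc n) = Zer D" "Obj ?Y (Suc n) = S (Zer D)"
    using Suc.prems by (simp_all add: Obj_triv_seq)
  have f: "seq_map ?X ?Y f"
  proof (rule seq_mapI)
    fix i assume i: "i \<le> Suc n"
    show "arrow (f i) \<and> src (f i) = Obj ?X i \<and> tgt (f i) = Obj ?Y i"
      using i
    proof (rule le_Suc_n_cases)
      show "arrow (f i) \<and> src (f i) = Obj ?X i \<and> tgt (f i) = Obj ?Y i" if "i \<le> n" for i
        using that Yo(1)[of i] Yn by (cases "i = n") (simp_all add: f_def del: rot_simps)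
    qed (simp add: f_def L del: rot_simps)
    consider "i < n" | "i = n" | "i = Suc n" using i by linarith
    then show "cyc_map f (Suc i) \<cdot> Dif ?X i = Dif ?Y i \<cdot> f i"
    proof cases
      case 1
      then show ?thesis using seqD(1-4)[OF X, of i] Yo(2)[of i]
        by (simp add: f_def del: rot_simps)
    next
      case 2
      then show ?thesis using Suc.prems assms(1) by (simp add: f_def Dif_triv_seq Obj_triv_seq)
    next
      case 3
      then show ?thesis using Suc.prems assms(1) Y
        by (auto simp: f_def Dif_triv_seq Obj_triv_seq)
    qed
  qed
  have "?Y \<in> P"
  proof (rule angle_isoI[OF _ seq_rot[OF Y] f, of g])
    show "?X \<in> P" using Suc by simp
    fix i assume i: "i \<le> Suc n"
    show "arrow (g i) \<and> src (g i) = Obj ?Y i \<and> tgt (g i) = Obj ?X i"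
      using i
    proof (rule le_Suc_n_cases)
      show "arrow (g i) \<and> src (g i) = Obj ?Y i \<and> tgt (g i) = Obj ?X i" if "i \<le> n" for i
        using that Yo(1)[of i] Yn by (cases "i = n") (simp_all add: g_def del: rot_simps)
    qed (simp add: g_def L del: rot_simps)
    show "g i \<cdot> f i = Id D (Obj ?X i)"
      by (rule le_Suc_n_cases[OF i]) (simp_all add: f_def g_def L)
    show "f i \<cdot> g i = Id D (Obj ?Y i)"
      using i
    proof (rule le_Suc_n_cases)
      show "f i \<cdot> g i = Id D (Obj ?Y i)" if "i \<le> n" for i
        using that Yo(1)[of i] Yn by (cases "i = n") (simp_all add: f_def g_def del: rot_simps)
    qed (simp add: f_def g_def L SZ del: rot_simps)
  qed
  then show ?case using F2[OF Y] by simp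
qed

subsection \<open>Exactness of angles\<close>

lemma sg_inject: "\<lbrakk>sg k f = sg k g; arrow f; arrow g\<rbrakk> \<Longrightarrow> f = g"
  by (metis sg_simps(6))

lemma F3_arrows:
  assumes "X \<in> P" "Y \<in> P" "arrow a" "arrow b" "src a = Obj X 0" "tgt a = Obj Y 0"
    "src b = Obj X (Suc 0)" "tgt b = Obj Y (Suc 0)" "b \<cdot> Dif X 0 = Dif Y 0 \<cdot> a"
  obtains \<phi> where "seq_map X Y \<phi>" "\<phi> 0 = a" "\<phi> (Suc 0) = b"
  using F3[OF assms(1,2), of a b] assms(3-) seqD(1)[OF angle_seq[OF assms(1)]]
    seqD(1)[OF angle_seq[OF assms(2)]] by auto

text \<open>Rotation reduces this to i = 0. There the pair (1, d) starts a morphism from the trivial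
  angle on \<open>Obj X 0\<close>; as the third term of that angle is zero, the second square forces
  d d = 0.\<close>

lemma Dif_Dif:
  assumes "X \<in> P" "i \<le> n"
  shows "Dif X (Suc i) \<cdot> Dif X i = zm (Obj X i) (cyc_ob X (Suc (Suc i)))"
  using assms
proof (induction i arbitrary: X)
  case 0
  let ?T = "triv_seq 0 (Obj X 0)"
  note [simp] = seqD[OF angle_seq[OF 0(1)]] n_pos[simplified]
  have T: "?T \<in> P" by (rule triv_angle) simp_all
  obtain \<phi> where \<phi>: "seq_map ?T X \<phi>" "\<phi> 0 = Id D (Obj X 0)" "\<phi> (Suc 0) = Dif X 0"
    by (rule F3_arrows[OF T 0(1), of "Id D (Obj X 0)" "Dif X 0"])
      (simp_all add: Obj_triv_seq Dif_triv_seq)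
  note m = seq_mapD[OF \<phi>(1) angle_seq[OF T] angle_seq[OF 0(1)]]
  have "\<phi> (Suc (Suc 0)) \<cdot> zm (Obj X 0) (Zer D) = Dif X (Suc 0) \<cdot> Dif X 0"
    using m(4)[of "Suc 0"] by (simp add: Dif_triv_seq Obj_triv_seq \<phi>)
  moreover have "arrow (\<phi> (Suc (Suc 0)))" "src (\<phi> (Suc (Suc 0))) = Zer D"
    "tgt (\<phi> (Suc (Suc 0))) = Obj X (Suc (Suc 0))"
    using m(1-3)[of "Suc (Suc 0)"] by (simp_all add: Obj_triv_seq)
  ultimately show ?case by simp
next
  case (Suc i)
  have "cyc_ob (rot X) (Suc (Suc i)) = cyc_ob X (Suc (Suc (Suc i)))"
    using Suc.prems(2) by (cases "Suc i = n") auto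
  then show ?case using Suc.IH[OF rot_angle[OF Suc.prems(1)]] Suc.prems(2) by simp
qed

lemma SM_Dif_Dif:
  assumes "X \<in> P"
  shows "SM (Dif X 0) \<cdot> Dif X (Suc n) = zm (Obj X (Suc n)) (S (Obj X (Suc 0)))"
proof -
  have X: "seq X" using assms by (rule angle_seq)
  note [simp] = seqD[OF X]
  have "sg n (SM (Dif X 0) \<cdot> Dif X (Suc n)) = zm (Obj X (Suc n)) (S (Obj X (Suc 0)))"
    using Dif_Dif[OF rot_angle[OF assms], of n] X by simp
  from arg_cong[OF this, of "sg n"] show ?thesis by simp
qed

text \<open>(F3) extends morphisms to the right only, so for j = 0 the factor is found at the far
  end: f starts a morphism from a rotated trivial angle to \<open>rot X\<close>, and its last
  component is \<Sigma> of the required g. Larger j follow by rotation.\<close>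

lemma exact_covariant:
  assumes "X \<in> P" "j \<le> n" "arrow f" "tgt f = Obj X (Suc j)"
    "Dif X (Suc j) \<cdot> f = zm (src f) (cyc_ob X (Suc (Suc j)))"
  shows "\<exists>g. arrow g \<and> src g = src f \<and> tgt g = Obj X j \<and> Dif X j \<cdot> g = f"
  using assms
proof (induction j arbitrary: X)
  case 0
  let ?T = "triv_seq 0 (src f)"
  have X: "seq X" using 0(1) by (rule angle_seq)
  note [simp] = seqD[OF X] n_pos[simplified] 0(3,4)
  have T: "?T \<in> P" by (rule triv_angle) simp_all
  have "zm (Zer D) (Obj X (Suc (Suc 0))) \<cdot> Dif (rot ?T) 0 = Dif (rot X) 0 \<cdot> f"
    using 0(5) by (simp add: Obj_triv_seq Dif_triv_seq)
  then obtain \<phi> where \<phi>: "seq_map (rot ?T) (rot X) \<phi>" "\<phi> 0 = f"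
    using F3_arrows[OF rot_angle[OF T] rot_angle[OF 0(1)], of f "zm (Zer D) (Obj X (Suc (Suc 0)))"]
    by (simp add: Obj_triv_seq) blast
  note m = seq_mapD[OF \<phi>(1) seq_rot[OF angle_seq[OF T]] seq_rot[OF X]]
  have [simp]: "arrow (\<phi> (Suc n))" "src (\<phi> (Suc n)) = S (src f)" "tgt (\<phi> (Suc n)) = S (Obj X 0)"
    using m(1-3)[of "Suc n"] by (simp_all add: Obj_triv_seq)
  have "sg n (SM f) = sg n (SM (Dif X 0) \<cdot> \<phi> (Suc n))"
    using m(5) \<phi>(2) X angle_seq[OF T] by (simp add: Dif_triv_seq)
  then have *: "SM f = SM (Dif X 0) \<cdot> \<phi> (Suc n)"
    by (rule sg_inject[of n]) simp_all
  obtain g where g [simp]: "arrow g" "src g = src f" "tgt g = Obj X 0" and "SM g = \<phi> (Suc n)"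
    by (rule SM_surj[of "\<phi> (Suc n)" "src f" "Obj X 0"]) simp_all
  then have "SM (Dif X 0 \<cdot> g) = SM f" by (simp add: *)
  then have "Dif X 0 \<cdot> g = f" by (rule SM_inj) simp_all
  then show ?case using g by blast
next
  case (Suc j)
  have "cyc_ob (rot X) (Suc (Suc j)) = cyc_ob X (Suc (Suc (Suc j)))"
    using Suc.prems(2) by (cases "Suc j = n") auto
  then show ?case using Suc.IH[OF rot_angle[OF Suc.prems(1)]] Suc.prems by simp
qed

text \<open>For j = 0 the pair (0, g) starts a morphism from X to the trivial angle in degrees 1 and
  2, and its next component is the factor h. Larger j follow by rotation.\<close>

lemma exact_contravariant:
  assumes "X \<in> P" "j \<le> n" "arrow g" "src g = Obj X (Suc j)"
    "g \<cdot> Dif X j = zm (Obj X j) (tgt g)"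
  shows "\<exists>h. arrow h \<and> src h = cyc_ob X (Suc (Suc j)) \<and> tgt h = tgt g \<and> h \<cdot> Dif X (Suc j) = g"
  using assms
proof (induction j arbitrary: X)
  case 0
  let ?T = "triv_seq (Suc 0) (tgt g)"
  have X: "seq X" using 0(1) by (rule angle_seq)
  note [simp] = seqD[OF X] n_pos[simplified] 0(3,4)
  have T: "?T \<in> P" by (rule triv_angle) simp_all
  obtain \<phi> where \<phi>: "seq_map X ?T \<phi>" "\<phi> (Suc 0) = g"
    by (rule F3_arrows[OF 0(1) T, of "zm (Obj X 0) (Zer D)" g])
      (simp_all add: Obj_triv_seq Dif_triv_seq 0(5))
  note m = seq_mapD[OF \<phi>(1) X angle_seq[OF T]]
  have "\<phi> (Suc (Suc 0)) \<cdot> Dif X (Suc 0) = g"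
    using m(4)[of "Suc 0"] by (simp add: \<phi>(2) Dif_triv_seq)
  moreover have "arrow (\<phi> (Suc (Suc 0)))" "src (\<phi> (Suc (Suc 0))) = Obj X (Suc (Suc 0))"
    "tgt (\<phi> (Suc (Suc 0))) = tgt g"
    using m(1-3)[of "Suc (Suc 0)"] by (simp_all add: Obj_triv_seq)
  ultimately show ?case by auto
next
  case (Suc j)
  have "cyc_ob (rot X) (Suc (Suc j)) = cyc_ob X (Suc (Suc (Suc j)))"
    using Suc.prems(2) by (cases "Suc j = n") auto
  then show ?case using Suc.IH[OF rot_angle[OF Suc.prems(1)]] Suc.prems by simp
qed

text \<open>This is exactness of \<open>rot X\<close> in degree n + 1, applied to
  \<open>SM g\<close> and then desuspended.\<close>

lemma exact_contravariant_0:
  assumes "X \<in> P" "arrow g" "src g = Obj X 0"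
    "SM g \<cdot> Dif X (Suc n) = zm (Obj X (Suc n)) (S (tgt g))"
  shows "\<exists>h. arrow h \<and> src h = Obj X (Suc 0) \<and> tgt h = tgt g \<and> h \<cdot> Dif X 0 = g"
proof -
  have X: "seq X" using assms(1) by (rule angle_seq)
  note [simp] = seqD[OF X] assms(2,3) X
  obtain h where h [simp]: "arrow h" "src h = S (Obj X (Suc 0))" "tgt h = S (tgt g)"
    and eq: "h \<cdot> sg n (SM (Dif X 0)) = SM g"
    using exact_contravariant[OF rot_angle[OF assms(1)], of n "SM g"] assms(4) by auto
  obtain k where k [simp]: "arrow k" "src k = Obj X (Suc 0)" "tgt k = tgt g" "SM k = sg n h"
    by (rule SM_surj[of "sg n h" "Obj X (Suc 0)" "tgt g"]) simp_all
  have "k \<cdot> Dif X 0 = g" by (rule SM_inj) (use eq in simp_all)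
  then show ?thesis using k by blast
qed

subsection \<open>Direct summands and homotopy retracts\<close>

abbreviation dsum :: "('o, 'm) chain \<Rightarrow> ('o, 'm) chain \<Rightarrow> ('o, 'm) chain" where
  "dsum \<equiv> direct_sum n D \<Sigma>"

lemma Obj_dsum [simp]: "Obj (dsum X Y) i = Sum D (Obj X i) (Obj Y i)"
  by (simp add: direct_sum_def)

lemma Dif_dsum:
  assumes "seq X" "seq Y"
  shows "i \<le> n \<Longrightarrow> Dif (dsum X Y) i = mat (Dif X i) (zm (Obj Y i) (Obj X (Suc i)))
      (zm (Obj X i) (Obj Y (Suc i))) (Dif Y i)"
    "Dif (dsum X Y) (Suc n) = shift (Obj X 0) (Obj Y 0) \<cdot>
      mat (Dif X (Suc n)) (zm (Obj Y (Suc n)) (S (Obj X 0)))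
        (zm (Obj X (Suc n)) (S (Obj Y 0))) (Dif Y (Suc n))"
  using seqD[OF assms(1)] seqD[OF assms(2)] by (simp_all add: direct_sum_def)

lemma seq_dsum:
  assumes "seq X" "seq Y"
  shows "seq (dsum X Y)"
proof (rule seqI)
  note [simp] = seqD[OF assms(1)] seqD[OF assms(2)]
  fix i assume i [simp]: "i \<le> Suc n"
  show "Obj (dsum X Y) i \<in> Ob D" by simp
  show "arrow (Dif (dsum X Y) i) \<and> src (Dif (dsum X Y) i) = Obj (dsum X Y) i \<and>
      tgt (Dif (dsum X Y) i) = cyc_ob (dsum X Y) (Suc i)"
    using i by (rule le_Suc_n_cases) (simp_all add: Dif_dsum assms)
qed

lemma seq_map_colm:
  assumes "seq_map Z X p" "seq_map Z Y q" "seq X" "seq Y" "seq Z"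
  shows "seq_map Z (dsum X Y) (\<lambda>j. colm (p j) (q j))"
proof (rule seq_mapI)
  note p = seq_mapD[OF assms(1,5,3)] and q = seq_mapD[OF assms(2,5,4)]
  note [simp] = p(1-3) q(1-3) seqD[OF assms(3)] seqD[OF assms(4)] seqD[OF assms(5)]
  fix i assume i [simp]: "i \<le> Suc n"
  show "arrow (colm (p i) (q i)) \<and> src (colm (p i) (q i)) = Obj Z i \<and>
      tgt (colm (p i) (q i)) = Obj (dsum X Y) i" by simp
  show "cyc_map (\<lambda>j. colm (p j) (q j)) (Suc i) \<cdot> Dif Z i = Dif (dsum X Y) i \<cdot> colm (p i) (q i)"
    using i
  proof (rule le_Suc_n_cases)
    fix i assume "i \<le> n"
    then show "cyc_map (\<lambda>j. colm (p j) (q j)) (Suc i) \<cdot> Dif Z i = Dif (dsum X Y) i \<cdot>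
      colm (p i) (q i)"
      by (simp add: Dif_dsum assms p(4) q(4))
  next
    show "cyc_map (\<lambda>j. colm (p j) (q j)) (Suc (Suc n)) \<cdot> Dif Z (Suc n) =
        Dif (dsum X Y) (Suc n) \<cdot> colm (p (Suc n)) (q (Suc n))"
      by (simp add: Dif_dsum assms SM_colm p(5) q(5))
  qed
qed

lemma seq_map_rowm:
  assumes "seq_map X Z i" "seq_map Y Z s" "seq X" "seq Y" "seq Z"
  shows "seq_map (dsum X Y) Z (\<lambda>j. rowm (i j) (s j))"
proof (rule seq_mapI)
  note p = seq_mapD[OF assms(1,3,5)] and q = seq_mapD[OF assms(2,4,5)]
  note [simp] = p(1-3) q(1-3) seqD[OF assms(3)] seqD[OF assms(4)] seqD[OF assms(5)]
  fix k assume k [simp]: "k \<le> Suc n"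
  show "arrow (rowm (i k) (s k)) \<and> src (rowm (i k) (s k)) = Obj (dsum X Y) k \<and>
      tgt (rowm (i k) (s k)) = Obj Z k" by simp
  show "cyc_map (\<lambda>j. rowm (i j) (s j)) (Suc k) \<cdot> Dif (dsum X Y) k = Dif Z k \<cdot> rowm (i k) (s k)"
    using k
  proof (rule le_Suc_n_cases)
    fix k assume "k \<le> n"
    then show "cyc_map (\<lambda>j. rowm (i j) (s j)) (Suc k) \<cdot> Dif (dsum X Y) k = Dif Z k \<cdot>
      rowm (i k) (s k)"
      by (simp add: Dif_dsum assms p(4) q(4))
  next
    have "SM (rowm (i 0) (s 0)) \<cdot> (shift (Obj X 0) (Obj Y 0) \<cdot> x) = rowm (SM (i 0)) (SM (s 0)) \<cdot> x"
      if "arrow x" "tgt x = Sum D (S (Obj X 0)) (S (Obj Y 0))" for x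
      using that SM_rowm_shift[of "i 0" "s 0" "Obj X 0" "Obj Y 0"]
        comp_assoc'[of x "shift (Obj X 0) (Obj Y 0)" "SM (rowm (i 0) (s 0))"] by simp
    then show "cyc_map (\<lambda>j. rowm (i j) (s j)) (Suc (Suc n)) \<cdot> Dif (dsum X Y) (Suc n) =
        Dif Z (Suc n) \<cdot> rowm (i (Suc n)) (s (Suc n))"
      by (simp add: Dif_dsum assms p(5) q(5))
  qed
qed

text \<open>The complement of \<open>i\<close> is made into a sequence using the splittings of the \<open>i j\<close>; then \<open>X\<close> is a
  direct summand of \<open>Z\<close>.\<close>

lemma retract_angle:
  assumes Z: "Z \<in> P" and X: "seq X" and i: "seq_map X Z i" and p: "seq_map Z X p"
    and pi: "\<And>j. j \<le> Suc n \<Longrightarrow> p j \<cdot> i j = Id D (Obj X j)"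
    and compl: "\<And>j. j \<le> Suc n \<Longrightarrow> complemented (i j)"
  shows "X \<in> P"
proof -
  have Zs: "seq Z" using Z by (rule angle_seq)
  note i' = seq_mapD[OF i X Zs] and p' = seq_mapD[OF p Zs X]
  note ic = seq_mapD_cyc[OF i X Zs] and pc = seq_mapD_cyc[OF p Zs X]
  note [simp] = i'(1-3) p'(1-3) seqD[OF X] seqD[OF Zs] pi
  note [simp] = ic(2-4) pc(2-4) seqD_cyc[OF X] seqD_cyc[OF Zs]
  have "\<exists>\<sigma> q. arrow \<sigma> \<and> arrow q \<and> tgt \<sigma> = Obj Z j \<and> src q = Obj Z j \<and> tgt q = src \<sigma> \<and>
      q \<cdot> \<sigma> = Id D (src \<sigma>) \<and> q \<cdot> i j = zm (Obj X j) (src \<sigma>) \<and>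
      p j \<cdot> \<sigma> = zm (src \<sigma>) (Obj X j) \<and> i j \<cdot> p j \<oplus> \<sigma> \<cdot> q = Id D (Obj Z j)"
    if "j \<le> Suc n" for j
    by (rule complemented_retraction[OF compl[OF that], of "p j"])
      (use that in simp_all, metis)
  then obtain \<sigma> q where sq: "\<And>j. j \<le> Suc n \<Longrightarrow> arrow (\<sigma> j) \<and> arrow (q j) \<and> tgt (\<sigma> j) = Obj Z j \<and>
      src (q j) = Obj Z j \<and> tgt (q j) = src (\<sigma> j) \<and> q j \<cdot> \<sigma> j = Id D (src (\<sigma> j)) \<and>
      q j \<cdot> i j = zm (Obj X j) (src (\<sigma> j)) \<and>
      p j \<cdot> \<sigma> j = zm (src (\<sigma> j)) (Obj X j) \<and> i j \<cdot> p j \<oplus> \<sigma> j \<cdot> q j = Id D (Obj Z j)"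
    by metis
  then have [simp]: "arrow (\<sigma> j)" "arrow (q j)" "tgt (\<sigma> j) = Obj Z j" "src (q j) = Obj Z j"
      "tgt (q j) = src (\<sigma> j)" "q j \<cdot> \<sigma> j = Id D (src (\<sigma> j))"
      "q j \<cdot> i j = zm (Obj X j) (src (\<sigma> j))" "p j \<cdot> \<sigma> j = zm (src (\<sigma> j)) (Obj X j)"
      "i j \<cdot> p j \<oplus> \<sigma> j \<cdot> q j = Id D (Obj Z j)" if "j \<le> Suc n" for j
    using that by blast+
  \<comment> \<open>The complements, with the differential that d induces on them.\<close>
  define W :: "('o, 'm) chain" where
    "W = \<lparr>Obj = (\<lambda>j. src (\<sigma> j)), Dif = (\<lambda>j. cyc_map q (Suc j) \<cdot> Dif Z j \<cdot> \<sigma> j)\<rparr>"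
  have [simp]: "Obj W = (\<lambda>j. src (\<sigma> j))" "Dif W = (\<lambda>j. cyc_map q (Suc j) \<cdot> Dif Z j \<cdot> \<sigma> j)"
    by (simp_all add: W_def)
  have qc: "arrow (cyc_map q (Suc j)) \<and> src (cyc_map q (Suc j)) = cyc_ob Z (Suc j) \<and>
      tgt (cyc_map q (Suc j)) = cyc_ob W (Suc j) \<and>
      cyc_map q (Suc j) \<cdot> cyc_map i (Suc j) = zm (cyc_ob X (Suc j)) (cyc_ob W (Suc j))"
    if "j \<le> Suc n" for j
    by (rule le_Suc_n_cases[OF that]) (simp_all add: SM_comp[symmetric] del: SM_comp)
  then have [simp]: "arrow (cyc_map q (Suc j))" "src (cyc_map q (Suc j)) = cyc_ob Z (Suc j)"
      "tgt (cyc_map q (Suc j)) = cyc_ob W (Suc j)" if "j \<le> Suc n" for j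
    using that by blast+
  have W: "seq W"
    by (rule seqI) simp_all
  have q: "seq_map Z W q"
  proof (rule seq_mapI)
    fix j assume j [simp]: "j \<le> Suc n"
    have W_ob: "cyc_ob W (Suc j) \<in> Ob D" using seqD_cyc[OF W j] by simp
    have \<sigma>q: "\<sigma> j \<cdot> q j = \<ominus> (i j \<cdot> p j) \<oplus> Id D (Obj Z j)"
    proof -
      have "\<sigma> j \<cdot> q j = \<ominus> (i j \<cdot> p j) \<oplus> (i j \<cdot> p j \<oplus> \<sigma> j \<cdot> q j)"
        by (rule plus_minus_cancel(2)[symmetric]) simp_all
      then show ?thesis by simp
    qed
    have 1: "Dif Z j \<cdot> (i j \<cdot> p j) = cyc_map i (Suc j) \<cdot> (Dif X j \<cdot> p j)"
      using ic(1)[of j] comp_assoc'[of "p j" "i j" "Dif Z j"]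
        comp_assoc'[of "p j" "Dif X j" "cyc_map i (Suc j)"] by simp
    have 2: "cyc_map q (Suc j) \<cdot> (cyc_map i (Suc j) \<cdot> x) = zm (src x) (cyc_ob W (Suc j))"
      if "arrow x" "tgt x = cyc_ob X (Suc j)" for x
      by (rule comp_zero_assoc) (use qc[OF j] that in simp_all)
    \<comment> \<open>Here q d \<sigma> q = q d - q d i p, and q d i = q i d = 0.\<close>
    have "Dif W j \<cdot> q j = cyc_map q (Suc j) \<cdot> (Dif Z j \<cdot> (\<sigma> j \<cdot> q j))" by simp
    also have "\<dots> = cyc_map q (Suc j) \<cdot> Dif Z j"
      unfolding \<sigma>q using W_ob by (simp add: 1 2)
    finally show "cyc_map q (Suc j) \<cdot> Dif Z j = Dif W j \<cdot> q j" by simp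
  qed simp
  \<comment> \<open>The isomorphism from Z is the column (p, q); its inverse [i, \<sigma>] has to be
    given only degreewise.\<close>
  have "dsum X W \<in> P"
  proof (rule angle_isoI[OF Z seq_dsum[OF X W] seq_map_colm[OF p q X W Zs],
        of "\<lambda>j. rowm (i j) (\<sigma> j)"])
    fix j assume [simp]: "j \<le> Suc n"
    show "rowm (i j) (\<sigma> j) \<cdot> colm (p j) (q j) = Id D (Obj Z j)" by simp
  qed simp_all
  then show ?thesis using F1_summand X W by blast
qed

text \<open>Adding up the trivial angles on \<open>Obj X 1, \<dots>, Obj X (n + 1)\<close> one at a time turns the
  homotopy \<open>g f \<simeq> id\<close> into a strict retraction.\<close>

lemma homotopy_retract_angle:
  assumes Y: "Y \<in> P" and X: "seq X" and f: "seq_map X Y f" and g: "seq_map Y X g"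
    and f0: "complemented (f 0)"
    and s: "\<And>j. j \<le> n \<Longrightarrow> arrow (s j) \<and> src (s j) = Obj X (Suc j) \<and> tgt (s j) = Obj X j"
    and gf0: "g 0 \<cdot> f 0 = Id D (Obj X 0) \<oplus> s 0 \<cdot> Dif X 0"
    and gf: "\<And>j. j < n \<Longrightarrow> g (Suc j) \<cdot> f (Suc j) =
      Id D (Obj X (Suc j)) \<oplus> (Dif X j \<cdot> s j \<oplus> s (Suc j) \<cdot> Dif X (Suc j))"
    and gfn: "g (Suc n) \<cdot> f (Suc n) = Id D (Obj X (Suc n)) \<oplus> Dif X n \<cdot> s n"
    and sn: "Dif X n \<cdot> s n = zm (Obj X (Suc n)) (Obj X (Suc n))"
    and dd: "\<And>j. j < n \<Longrightarrow> Dif X (Suc j) \<cdot> Dif X j = zm (Obj X j) (Obj X (Suc (Suc j)))"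
    and d0: "SM (Dif X 0) \<cdot> Dif X (Suc n) = zm (Obj X (Suc n)) (S (Obj X (Suc 0)))"
  shows "X \<in> P"
proof -
  have Ys: "seq Y" using Y by (rule angle_seq)
  note f' = seq_mapD[OF f X Ys] and g' = seq_mapD[OF g Ys X]
  note [simp] = f'(1-3) g'(1-3) seqD[OF X] seqD[OF Ys]
  have [simp]: "arrow (s j)" "src (s j) = Obj X (Suc j)" "tgt (s j) = Obj X j" if "j \<le> n" for j
    using s[OF that] by simp_all
  \<comment> \<open>After m steps the retraction is strict below degree m, the error s d is left in
    degree m, and p i is still g f above it. In degree n + 1 no error is left.\<close>
  have "\<exists>Z i p. Z \<in> P \<and> seq_map X Z i \<and> seq_map Z X p \<and> (\<forall>j \<le> m. complemented (i j)) \<and>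
      (\<forall>j < m. p j \<cdot> i j = Id D (Obj X j)) \<and>
      p m \<cdot> i m = (if m \<le> n then Id D (Obj X m) \<oplus> s m \<cdot> Dif X m else Id D (Obj X m)) \<and>
      (\<forall>j. m < j \<longrightarrow> j \<le> Suc n \<longrightarrow> p j \<cdot> i j = g j \<cdot> f j)" if "m \<le> Suc n" for m
    using that
  proof (induction m)
    case 0
    show ?case
      by (rule exI[of _ Y], rule exI[of _ f], rule exI[of _ g])
        (use Y f g f0 gf0 in simp)
  next
    case (Suc m)
    then have m [simp]: "m \<le> n" "m \<le> Suc n" by simp_all
    obtain Z i p where Z: "Z \<in> P" and i: "seq_map X Z i" and p: "seq_map Z X p"
      and compl: "\<And>j. j \<le> m \<Longrightarrow> complemented (i j)"
      and pi: "\<And>j. j < m \<Longrightarrow> p j \<cdot> i j = Id D (Obj X j)"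
      and pim: "p m \<cdot> i m = Id D (Obj X m) \<oplus> s m \<cdot> Dif X m"
      and pig: "\<And>j. m < j \<Longrightarrow> j \<le> Suc n \<Longrightarrow> p j \<cdot> i j = g j \<cdot> f j"
      using Suc m by (metis Suc_leD)
    have Zs: "seq Z" using Z by (rule angle_seq)
    note i' = seq_mapD[OF i X Zs] and p' = seq_mapD[OF p Zs X]
    note [simp] = i'(1-3) p'(1-3) seqD[OF Zs]
    define U where "U = Obj X (Suc m)"
    have [simp]: "U \<in> Ob D" by (simp add: U_def)
    define T where "T = triv_seq m U"
    have T: "T \<in> P" unfolding T_def by (rule triv_angle) simp_all
    have Ts: "seq T" using T by (rule angle_seq)
    note [simp] = seqD[OF Ts]
    \<comment> \<open>The composite v u is -s d in degree m and -d s in degree m + 1. The first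
      cancels the current error, the second cancels one of the two homotopy terms in the next
      degree.\<close>
    define u where "u j = (if j = m then Dif X m else if j = Suc m then Id D U
      else zm (Obj X j) (Zer D))" for j
    define v where "v j = (if j = m then \<ominus> (s m) else if j = Suc m then \<ominus> (Dif X m \<cdot> s m)
      else zm (Zer D) (Obj X j))" for j
    have uT: "arrow (u j) \<and> src (u j) = Obj X j \<and> tgt (u j) = Obj T j" if "j \<le> Suc n" for j
      using that by (simp add: u_def T_def Obj_triv_seq U_def)
    have vT: "arrow (v j) \<and> src (v j) = Obj T j \<and> tgt (v j) = Obj X j" if "j \<le> Suc n" for j
      using that by (simp add: v_def T_def Obj_triv_seq U_def)
    have [simp]: "arrow (u j)" "src (u j) = Obj X j" "tgt (u j) = Obj T j"
      "arrow (v j)" "src (v j) = Obj T j" "tgt (v j) = Obj X j" if "j \<le> Suc n" for j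
      using uT vT that by blast+
    have Tz: "Obj T j = Zer D" if "j \<noteq> m" "j \<noteq> Suc m" for j
      using that by (simp add: T_def Obj_triv_seq)
    have dT: "Dif T j = (if j = m then Id D U else zm (Obj T j) (Obj T (Suc j)))" if "j \<le> n" for j
      using that by (simp add: T_def Dif_triv_seq)
    have dTn: "Dif T (Suc n) = zm (Obj T (Suc n)) (S (Obj T 0))"
      by (simp add: T_def Dif_triv_seq)
    have Tm: "Obj T m = U" "Obj T (Suc m) = U" by (simp_all add: T_def Obj_triv_seq)
    have u: "seq_map X T u"
    proof (rule seq_mapI)
      fix j assume j: "j \<le> Suc n"
      show "cyc_map u (Suc j) \<cdot> Dif X j = Dif T j \<cdot> u j"
        using j
      proof (rule le_Suc_n_cases)
        fix j assume j [simp]: "j \<le> n"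
        have [simp]: "j \<le> Suc n" by (rule le_SucI[OF j])
        consider "j = m" | "Suc j = m" | "j \<noteq> m" "Suc j \<noteq> m" by auto
        then show "cyc_map u (Suc j) \<cdot> Dif X j = Dif T j \<cdot> u j"
        proof cases
          case 1
          then show ?thesis by (simp add: dT, simp add: u_def U_def)
        next
          case 2
          then have "j \<noteq> m" "j \<noteq> Suc m" "j < n" using m(1) by linarith+
          moreover from this have "u j = zm (Obj X j) (Zer D)" "Obj T j = Zer D"
            by (simp_all add: u_def Tz)
          moreover have "u m = Dif X m" by (simp add: u_def)
          ultimately show ?thesis using dd[of j] 2 by (simp add: dT Tm U_def)
        next
          case 3
          then have "u (Suc j) = zm (Obj X (Suc j)) (Zer D)" "Obj T (Suc j) = Zer D"
              "Dif T j = zm (Obj T j) (Zer D)"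
            by (simp_all add: u_def Tz dT)
          then show ?thesis by simp
        qed
      next
        \<comment> \<open>Only for m = 0 does the trivial angle meet degree 0, and there the square
          is the relation \<open>d0\<close>.\<close>
        show "cyc_map u (Suc (Suc n)) \<cdot> Dif X (Suc n) = Dif T (Suc n) \<cdot> u (Suc n)"
        proof (cases "m = 0")
          case True
          then show ?thesis using d0 Tm by (simp add: dTn, simp add: u_def U_def)
        next
          case False
          then show ?thesis by (simp add: dTn, simp add: u_def Tz)
        qed
      qed
    qed (use uT in blast)
    have v: "seq_map T X v"
    proof (rule seq_mapI)
      fix j assume j: "j \<le> Suc n"
      show "cyc_map v (Suc j) \<cdot> Dif T j = Dif X j \<cdot> v j"
        using j
      proof (rule le_Suc_n_cases)
        fix j assume j [simp]: "j \<le> n"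
        have [simp]: "j \<le> Suc n" by (rule le_SucI[OF j])
        consider "j = m" | "j = Suc m" | "j \<noteq> m" "j \<noteq> Suc m" by auto
        then show "cyc_map v (Suc j) \<cdot> Dif T j = Dif X j \<cdot> v j"
        proof cases
          case 1
          then show ?thesis by (simp add: dT, simp add: v_def U_def)
        next
          case 2
          then have "Dif X (Suc m) \<cdot> (Dif X m \<cdot> s m) = zm (src (s m)) (Obj X (Suc (Suc m)))"
            using j dd[of m] by (intro comp_zero_assoc[of _ _ "Obj X m"]) simp_all
          then show ?thesis using 2 j by (simp add: dT Tm, simp add: v_def U_def)
        next
          case 3
          then have "v j = zm (Zer D) (Obj X j)" "Obj T j = Zer D"
              "Dif T j = zm (Zer D) (Obj T (Suc j))"
            by (simp_all add: v_def Tz dT)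
          then show ?thesis by simp
        qed
      next
        \<comment> \<open>For m = n the trivial angle reaches degree n + 1, where v is -d s; this
          vanishes by \<open>sn\<close>.\<close>
        show "cyc_map v (Suc (Suc n)) \<cdot> Dif T (Suc n) = Dif X (Suc n) \<cdot> v (Suc n)"
        proof (cases "m = n")
          case True
          then show ?thesis using sn Tm by (simp add: dTn, simp add: v_def U_def)
        next
          case False
          then have "m < n" using m(1) by linarith
          then show ?thesis by (simp add: dTn, simp add: v_def Tz)
        qed
      qed
    qed (use vT in blast)
    let ?i = "\<lambda>j. colm (i j) (u j)" and ?p = "\<lambda>j. rowm (p j) (v j)"
    \<comment> \<open>In degree m + 1 the identity entry of u provides the complement, and lower
      degrees keep theirs. So the induction can start from a complement of \<open>f 0\<close>
      alone.\<close>
    have c1: "\<forall>j \<le> Suc m. complemented (?i j)"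
    proof (intro allI impI)
      fix j assume j: "j \<le> Suc m"
      show "complemented (?i j)"
      proof (cases "j = Suc m")
        case True
        then have "complemented (colm (i j) (Id D U))"
          by (intro complemented_colm_iso[of _ _ "Id D U"]) (simp_all add: U_def)
        then show ?thesis using True by (simp add: u_def)
      next
        case False
        then have "j \<le> m" using j by simp
        moreover from this have "j \<le> Suc n" using m(1) by linarith
        ultimately show ?thesis using compl by (intro complemented_colm) simp_all
      qed
    qed
    have c2: "?p j \<cdot> ?i j = Id D (Obj X j)" if "j < Suc m" for j
    proof (cases "j = m")
      case True
      have "v m \<cdot> u m = \<ominus> (s m \<cdot> Dif X m)" by (simp add: u_def v_def)
      then show ?thesis using True pim by (simp add: plus_ac)
    next
      case False
      then have "j < m" and [simp]: "j \<le> Suc n" using that m(1) by linarith+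
      moreover from this have "v j \<cdot> u j = zm (Obj X j) (Obj X j)"
        by (simp add: u_def v_def)
      ultimately show ?thesis using pi by simp
    qed
    have c3: "?p (Suc m) \<cdot> ?i (Suc m) = (if Suc m \<le> n
        then Id D (Obj X (Suc m)) \<oplus> s (Suc m) \<cdot> Dif X (Suc m) else Id D (Obj X (Suc m)))"
    proof -
      have "v (Suc m) \<cdot> u (Suc m) = \<ominus> (Dif X m \<cdot> s m)" by (simp add: u_def v_def U_def)
      then have "?p (Suc m) \<cdot> ?i (Suc m) = g (Suc m) \<cdot> f (Suc m) \<oplus> \<ominus> (Dif X m \<cdot> s m)"
        using pig[of "Suc m"] by simp
      moreover have "m < n" if "m \<noteq> n" using that m(1) by linarith
      ultimately show ?thesis using gf[of m] gfn by (cases "m = n") (simp_all add: plus_ac)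
    qed
    have c4: "?p j \<cdot> ?i j = g j \<cdot> f j" if "Suc m < j" "j \<le> Suc n" for j
      using that pig[of j] by (simp add: u_def v_def)
    show ?case
      by (rule exI[of _ "dsum Z T"], rule exI[of _ ?i], rule exI[of _ ?p])
        (intro conjI allI impI F1_sum[OF Z T] seq_map_colm[OF i u Zs Ts X]
          seq_map_rowm[OF p v Zs Ts X] c1 c2 c3 c4; assumption)
  qed
  from this[of "Suc n"] obtain Z i p where "Z \<in> P" "seq_map X Z i" "seq_map Z X p"
    "\<forall>j \<le> Suc n. complemented (i j)" "\<forall>j < Suc n. p j \<cdot> i j = Id D (Obj X j)"
    "p (Suc n) \<cdot> i (Suc n) = Id D (Obj X (Suc n))"
    by auto
  then show ?thesis using X by (intro retract_angle[of Z X i p]) (auto simp: le_eq_less_or_eq)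
qed

subsection \<open>Cones and rotation\<close>

abbreviation cn :: "('o, 'm) chain \<Rightarrow> ('o, 'm) chain \<Rightarrow> (nat \<Rightarrow> 'm) \<Rightarrow> ('o, 'm) chain" where
  "cn \<equiv> cone n D \<Sigma>"

lemma Obj_cone:
  "i \<le> Suc n \<Longrightarrow> Obj (cn X Y \<phi>) i = Sum D (cyc_ob X (Suc i)) (Obj Y i)"
  by (auto simp: cone_def Let_def cyc_ob_def)

lemma Dif_cone:
  assumes "seq X" "seq Y" "seq_map X Y \<phi>"
  shows "i \<le> n \<Longrightarrow> Dif (cn X Y \<phi>) i = mat (\<ominus> (Dif X (Suc i)))
      (zm (Obj Y i) (cyc_ob X (Suc (Suc i)))) (\<phi> (Suc i)) (Dif Y i)"
    "Dif (cn X Y \<phi>) (Suc n) = shift (Obj X (Suc 0)) (Obj Y 0) \<cdot> mat (\<ominus> (SM (Dif X 0)))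
      (zm (Obj Y (Suc n)) (S (Obj X (Suc 0)))) (SM (\<phi> 0)) (Dif Y (Suc n))"
proof -
  note [simp] = seqD[OF assms(1)] seqD[OF assms(2)] seqD_cyc[OF assms(1)]
    seq_mapD(1-3)[OF assms(3,1,2)]
  show "Dif (cn X Y \<phi>) i = mat (\<ominus> (Dif X (Suc i)))
      (zm (Obj Y i) (cyc_ob X (Suc (Suc i)))) (\<phi> (Suc i)) (Dif Y i)" if "i \<le> n"
    using that by (cases "i = n") (simp_all add: cone_def Let_def)
  show "Dif (cn X Y \<phi>) (Suc n) = shift (Obj X (Suc 0)) (Obj Y 0) \<cdot> mat (\<ominus> (SM (Dif X 0)))
      (zm (Obj Y (Suc n)) (S (Obj X (Suc 0)))) (SM (\<phi> 0)) (Dif Y (Suc n))"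
    by (simp add: cone_def Let_def)
qed

lemma seq_cone:
  assumes "seq X" "seq Y" "seq_map X Y \<phi>"
  shows "seq (cn X Y \<phi>)"
proof (rule seqI)
  note [simp] = seqD[OF assms(1)] seqD[OF assms(2)] seqD_cyc[OF assms(1)]
    seq_mapD(1-3)[OF assms(3,1,2)]
  fix i assume i [simp]: "i \<le> Suc n"
  show "Obj (cn X Y \<phi>) i \<in> Ob D" by (simp add: Obj_cone)
  show "arrow (Dif (cn X Y \<phi>) i) \<and> src (Dif (cn X Y \<phi>) i) = Obj (cn X Y \<phi>) i \<and>
      tgt (Dif (cn X Y \<phi>) i) = cyc_ob (cn X Y \<phi>) (Suc i)"
    using i by (rule le_Suc_n_cases) (simp_all add: Dif_cone assms Obj_cone)
qed

text \<open>Taking cones commutes with rotation up to an isomorphism that is the identity in degrees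
  0 to n. In degree n + 1 it combines \<open>shift\<close> with a sign.\<close>

lemma cone_rot_angle:
  assumes X: "seq X" and Y: "seq Y" and \<psi>: "seq_map X Y \<psi>" and C: "cn X Y \<psi> \<in> P"
  shows "cn (rot X) (rot Y) (\<lambda>i. cyc_map \<psi> (Suc i)) \<in> P"
proof -
  let ?xb = "Obj X (Suc 0)" and ?ya = "Obj Y 0"
  let ?\<phi> = "\<lambda>i. cyc_map \<psi> (Suc i)"
  let ?C = "cn X Y \<psi>" and ?R = "cn (rot X) (rot Y) ?\<phi>"
  have Cs: "seq ?C" using C by (rule angle_seq)
  have rX: "seq (rot X)" and rY: "seq (rot Y)" using X Y by (simp_all add: seq_rot)
  have \<phi>: "seq_map (rot X) (rot Y) ?\<phi>" using \<psi> X Y by (rule seq_map_rot)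
  note \<psi>' = seq_mapD[OF \<psi> X Y]
  note [simp] = X Y \<psi>'(1-3) seqD[OF X] seqD[OF Y] seqD_cyc[OF X]
    seq_mapD_cyc(2-4)[OF \<psi> X Y] n_pos[simplified]
  have cX: "cyc_ob (rot X) (Suc i) = cyc_ob X (Suc (Suc i))" if "i \<le> n" for i
    using that by (cases "i = n") auto
  have cX': "Obj (rot X) (Suc i) = cyc_ob X (Suc (Suc i))" if "i \<le> n" for i
    using cX[OF that] that by simp
  have O: "Obj ?R i = Obj (rot ?C) i" if "i \<le> n" for i
    using that by (simp add: Obj_cone cX')
  have On: "Obj ?R (Suc n) = Sum D (S ?xb) (S ?ya)"
    "Obj (rot ?C) (Suc n) = S (Sum D ?xb ?ya)"
    by (simp_all add: Obj_cone)
  have O': "Obj ?R i \<in> Ob D" if "i \<le> Suc n" for i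
    using seqD(1)[OF seq_cone[OF rX rY \<phi>]] that .
  \<comment> \<open>Rotating first puts the sign (-1)^n on \<Sigma>d of X and of Y separately;
    rotating last puts it on \<Sigma> of the whole first differential of the cone. A sign on
    \<Sigma> of \<open>Obj X 1\<close> reconciles the two.\<close>
  let ?m = "mat (sg n (Id D (S ?xb))) (zm (S ?ya) (S ?xb))
    (zm (S ?xb) (S ?ya)) (Id D (S ?ya))"
  define f where "f i = (if i \<le> n then Id D (Obj ?R i) else shift ?xb ?ya \<cdot> ?m)" for i
  define g where "g i = (if i \<le> n then Id D (Obj ?R i)
    else ?m \<cdot> colm (SM (Pr1 D ?xb ?ya)) (SM (Pr2 D ?xb ?ya)))" for i
  have f: "seq_map ?R (rot ?C) f"
  proof (rule seq_mapI)
    fix i assume i: "i \<le> Suc n"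
    show "arrow (f i) \<and> src (f i) = Obj ?R i \<and> tgt (f i) = Obj (rot ?C) i"
      using i by (rule le_Suc_n_cases) (simp_all add: f_def O' On Obj_cone cX')
    show "cyc_map f (Suc i) \<cdot> Dif ?R i = Dif (rot ?C) i \<cdot> f i"
      using i
    proof (rule le_Suc_n_cases)
      fix i assume i [simp]: "i \<le> n"
      have [simp]: "i \<le> Suc n" by (rule le_SucI[OF i])
      show "cyc_map f (Suc i) \<cdot> Dif ?R i = Dif (rot ?C) i \<cdot> f i"
      proof (cases "i = n")
        case False
        then have [simp]: "Suc i \<le> n" using i by linarith
        have "Dif ?R i = Dif (rot ?C) i" by (simp add: Dif_cone rX rY \<phi> \<psi> cX cX')
        then show ?thesis using seqD(1-4)[OF seq_cone[OF rX rY \<phi>], of i] by (simp add: f_def)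
      next
        case True
        show ?thesis unfolding True by (simp add: f_def Dif_cone rX rY \<phi> \<psi> O' Obj_cone)
      qed
    next
      have "SM (Dif ?C 0) \<cdot> (shift ?xb ?ya \<cdot> ?m) =
          SM (Dif ?C 0) \<cdot> shift ?xb ?ya \<cdot> ?m"
        by (rule comp_assoc'[symmetric]) (simp_all add: Dif_cone \<psi>)
      also have "\<dots> = shift (Obj X (Suc (Suc 0))) (Obj Y (Suc 0)) \<cdot>
          mat (\<ominus> (SM (Dif X (Suc 0)))) (zm (S ?ya) (S (Obj X (Suc (Suc 0)))))
            (SM (\<psi> (Suc 0))) (SM (Dif Y 0)) \<cdot> ?m"
        by (subst Dif_cone(1)[OF X Y \<psi>], simp,
            subst SM_mat_shift[where A' = "Obj X (Suc (Suc 0))" and B' = "Obj Y (Suc 0)"]) simp_all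
      also have "\<dots> = shift (Obj X (Suc (Suc 0))) (Obj Y (Suc 0)) \<cdot>
          mat (\<ominus> (sg n (SM (Dif X (Suc 0))))) (zm (S ?ya) (S (Obj X (Suc (Suc 0)))))
            (sg n (SM (\<psi> (Suc 0)))) (SM (Dif Y 0))"
        by (subst comp_assoc') simp_all
      finally show "cyc_map f (Suc (Suc n)) \<cdot> Dif ?R (Suc n) = Dif (rot ?C) (Suc n) \<cdot> f (Suc n)"
        using Cs seqD(1-3)[OF Cs, of 0] by (simp add: f_def Dif_cone(2) rX rY \<phi> O' Obj_cone,
            subst sg_comp(2)[symmetric], simp_all del: sg_comp)
    qed
  qed
  show ?thesis
  proof (rule angle_isoI'[OF rot_angle[OF C] seq_cone[OF rX rY \<phi>] f, of g])
    fix i assume i: "i \<le> Suc n"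
    show "arrow (g i) \<and> src (g i) = Obj (rot ?C) i \<and> tgt (g i) = Obj ?R i"
      using i by (rule le_Suc_n_cases) (simp_all add: g_def O' On Obj_cone cX')
    have mm: "?m \<cdot> ?m = Id D (Sum D (S ?xb) (S ?ya))" by simp
    have mm': "?m \<cdot> (?m \<cdot> x) = x" if "arrow x" "tgt x = Sum D (S ?xb) (S ?ya)" for x
      using arg_cong[OF mm, of "\<lambda>y. y \<cdot> x"] that by (simp del: mat_mat)
    note sh = shift_inverse[of "Obj X (Suc 0)" "Obj Y 0"]
    show "g i \<cdot> f i = Id D (Obj ?R i)"
      using i
    proof (rule le_Suc_n_cases)
      have "?m \<cdot> colm (SM (Pr1 D ?xb ?ya)) (SM (Pr2 D ?xb ?ya)) \<cdot>
          (shift ?xb ?ya \<cdot> ?m) =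
        ?m \<cdot> (colm (SM (Pr1 D ?xb ?ya)) (SM (Pr2 D ?xb ?ya)) \<cdot>
          shift ?xb ?ya) \<cdot> ?m"
        by (simp del: mat_mat mat_colm colm_comp)
      then show "g (Suc n) \<cdot> f (Suc n) = Id D (Obj ?R (Suc n))"
        using mm by (simp add: f_def g_def sh On del: mat_mat mat_colm colm_comp)
    qed (simp add: f_def g_def O')
    show "f i \<cdot> g i = Id D (Obj (rot ?C) i)"
      using i
    proof (rule le_Suc_n_cases)
      show "f (Suc n) \<cdot> g (Suc n) = Id D (Obj (rot ?C) (Suc n))"
        using sh by (simp add: f_def g_def mm' On Obj_cone del: mat_mat mat_colm colm_comp)
    qed (simp add: f_def g_def O[symmetric] O' del: rot_simps)
  qed
qed

lemma cone_right_rotation: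
  assumes R: "seq R" "agree (rot R) X" and R': "seq R'" "agree (rot R') Y"
    and \<psi>: "seq_map R R' \<psi>" and C: "cn R R' \<psi> \<in> P"
  shows "seq_map X Y (\<lambda>i. cyc_map \<psi> (Suc i))" "cn X Y (\<lambda>i. cyc_map \<psi> (Suc i)) \<in> P"
proof -
  show "seq_map X Y (\<lambda>i. cyc_map \<psi> (Suc i))"
    using agree_seq_map[OF R(2) R'(2) seq_map_rot[OF \<psi> R(1) R'(1)]] .
  have "agree (cn (rot R) (rot R') (\<lambda>i. cyc_map \<psi> (Suc i))) (cn X Y (\<lambda>i. cyc_map \<psi> (Suc i)))"
    using R(2) R'(2) n_pos by (auto simp: agree_def cone_def Let_def simp del: rot_simps
      Dif_rot_last)
  then show "cn X Y (\<lambda>i. cyc_map \<psi> (Suc i)) \<in> P"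
    using agree_angle cone_rot_angle[OF R(1) R'(1) \<psi> C] by blast
qed

lemma F4_first:
  assumes "X \<in> P" "Y \<in> P" "arrow a" "arrow b" "src a = Obj X 0" "tgt a = Obj Y 0"
    "src b = Obj X (Suc 0)" "tgt b = Obj Y (Suc 0)" "b \<cdot> Dif X 0 = Dif Y 0 \<cdot> a"
  obtains \<phi> where "seq_map X Y \<phi>" "\<phi> 0 = a" "\<phi> (Suc 0) = b" "cn X Y \<phi> \<in> P"
  using F4[OF assms(1,2), of a b] assms(3-) seqD(1)[OF angle_seq[OF assms(1)]]
    seqD(1)[OF angle_seq[OF assms(2)]] by auto

text \<open>Right rotation moves degrees n + 1 and 0 to degrees 0 and 1, where (F4) allows a choice.
  For this c is desuspended, and the square \<open>sq\<close> becomes the first square.\<close>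

lemma F4_ends:
  assumes X: "X \<in> P" and Y: "Y \<in> P" and [simp]: "arrow a" "arrow c" "src a = Obj X 0"
    "tgt a = Obj Y 0"
    "src c = Obj X (Suc n)" "tgt c = Obj Y (Suc n)"
    and sq: "SM a \<cdot> Dif X (Suc n) = Dif Y (Suc n) \<cdot> c"
  obtains \<phi> where "seq_map X Y \<phi>" "\<phi> 0 = a" "\<phi> (Suc n) = c" "cn X Y \<phi> \<in> P"
proof -
  obtain R where R: "seq R" "agree (rot R) X" using right_rotation[OF angle_seq[OF X]] .
  obtain R' where R': "seq R'" "agree (rot R') Y" using right_rotation[OF angle_seq[OF Y]] .
  note r = right_rotationD[OF R] and r' = right_rotationD[OF R']
  note [simp] = seqD[OF R(1)] seqD[OF R'(1)] seqD[OF angle_seq[OF X]] seqD[OF angle_seq[OF Y]]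
  obtain c' where c' [simp]: "arrow c'" "src c' = Obj R 0" "tgt c' = Obj R' 0" "SM c' = c"
    by (rule SM_surj[of c "Obj R 0" "Obj R' 0"]) (simp_all add: r(1) r'(1))
  have "a \<cdot> Dif R 0 = Dif R' 0 \<cdot> c'"
    by (rule SM_inj) (simp_all add: r r' sq)
  then obtain \<psi> where \<psi>: "seq_map R R' \<psi>" "\<psi> 0 = c'" "\<psi> (Suc 0) = a" "cn R R' \<psi> \<in> P"
    using F4_first[OF right_rotation_angle[OF R X] right_rotation_angle[OF R' Y], of c' a]
    by (auto simp: r r')
  show ?thesis
    by (rule that[OF cone_right_rotation(1)[OF R R' \<psi>(1,4)] _ _ cone_right_rotation(2)[OF R R'
      \<psi>(1,4)]])
      (simp_all add: \<psi>)
qed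

text \<open>Using \<open>F4_ends\<close> in place of (F4), the same rotation argument prescribes the
  pair one place further to the left.\<close>

lemma F4_last:
  assumes X: "X \<in> P" and Y: "Y \<in> P" and [simp]: "arrow b" "arrow c" "src b = Obj X n"
    "tgt b = Obj Y n"
    "src c = Obj X (Suc n)" "tgt c = Obj Y (Suc n)"
    and sq: "c \<cdot> Dif X n = Dif Y n \<cdot> b"
  obtains \<phi> where "seq_map X Y \<phi>" "\<phi> n = b" "\<phi> (Suc n) = c" "cn X Y \<phi> \<in> P"
proof -
  obtain R where R: "seq R" "agree (rot R) X" using right_rotation[OF angle_seq[OF X]] .
  obtain R' where R': "seq R'" "agree (rot R') Y" using right_rotation[OF angle_seq[OF Y]] .
  note r = right_rotationD[OF R] and r' = right_rotationD[OF R']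
  note [simp] = seqD[OF R(1)] seqD[OF R'(1)] seqD[OF angle_seq[OF X]] seqD[OF angle_seq[OF Y]]
  obtain c' where c' [simp]: "arrow c'" "src c' = Obj R 0" "tgt c' = Obj R' 0" "SM c' = c"
    by (rule SM_surj[of c "Obj R 0" "Obj R' 0"]) (simp_all add: r(1) r'(1))
  obtain \<psi> where \<psi>: "seq_map R R' \<psi>" "\<psi> 0 = c'" "\<psi> (Suc n) = b" "cn R R' \<psi> \<in> P"
    by (rule F4_ends[OF right_rotation_angle[OF R X] right_rotation_angle[OF R' Y], of c' b])
      (simp_all add: r r' sq)
  show ?thesis
    by (rule that[OF cone_right_rotation(1)[OF R R' \<psi>(1,4)] _ _ cone_right_rotation(2)[OF R R'
      \<psi>(1,4)]])
      (simp_all add: \<psi>)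
qed

subsection \<open>Removing contractible summands from cones\<close>

text \<open>This packs a complex and an extension into one \<Sigma>-sequence. The value of the
  record in degree n + 1 is meaningless for a complex and is overwritten.\<close>

definition with_ext :: "('o, 'm) chain \<Rightarrow> 'm \<Rightarrow> ('o, 'm) chain" where
  "with_ext X \<delta> = X\<lparr>Dif := (Dif X)(Suc n := \<delta>)\<rparr>"

lemma with_ext_simps [simp]:
  "Obj (with_ext X \<delta>) = Obj X" "i \<noteq> Suc n \<Longrightarrow> Dif (with_ext X \<delta>) i = Dif X i"
  "Dif (with_ext X \<delta>) (Suc n) = \<delta>"
  by (simp_all add: with_ext_def)

text \<open>The identity \<open>\<phi> 0\<close> is an entry of the last map of the cone. It cancels
  \<Sigma> of \<open>Obj X 0\<close> in degree n + 1 against \<open>Obj Y 0\<close> in degree 0. As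
  this contraction runs through the last map, beyond the range k <= n of \<open>gauss_angle\<close>,
  the retraction is written out.\<close>

lemma mapping_cone_angle:
  assumes X: "X \<in> P" and Y: "Y \<in> P" and \<phi>: "seq_map X Y \<phi>" and C: "cn X Y \<phi> \<in> P"
    and XY: "Obj X 0 = Obj Y 0" and \<phi>0: "\<phi> 0 = Id D (Obj X 0)"
  shows "with_ext (mapping_cone n D X Y \<phi>) (SM (Dif X 0) \<cdot> Dif Y (Suc n)) \<in> P" (is "?V \<in> P")
proof -
  let ?C = "cn X Y \<phi>" and ?xa = "Obj X 0" and ?xb = "Obj X (Suc 0)" and ?ya = "Obj Y 0" and ?ye =
    "Obj Y (Suc n)"
  have Xs: "seq X" and Ys: "seq Y" and Cs: "seq ?C" using X Y C by (simp_all add: angle_seq)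
  note m = seq_mapD[OF \<phi> Xs Ys]
  note [simp] = seqD[OF Xs] seqD[OF Ys] m(1-3) n_pos[simplified] seqD_cyc[OF Xs]
  have n0 [simp]: "n \<noteq> 0" "0 < n" using n_pos by linarith+
  have O: "Obj ?V i = Obj ?C i" if "0 < i" "i \<le> n" for i
    using that by (simp add: mapping_cone_def Let_def numeral_2_eq_2 Obj_cone)
  have O0: "Obj ?V 0 = Obj X (Suc 0)" "Obj ?V (Suc n) = Obj Y (Suc n)"
    by (simp_all add: mapping_cone_def Let_def numeral_2_eq_2)
  have C0: "Obj ?C 0 = Sum D ?xb ?ya"
    "Obj ?C (Suc n) = Sum D (S ?xa) ?ye"
    by (simp_all add: Obj_cone)
  have d0: "Dif ?V 0 = colm (\<ominus> (Dif X (Suc 0))) (\<phi> (Suc 0))"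
    by (simp add: mapping_cone_def Let_def numeral_2_eq_2)
  have d: "Dif ?V i = Dif ?C i" if "0 < i" "i < n" for i
    using that by (simp add: mapping_cone_def Let_def numeral_2_eq_2 Dif_cone Xs Ys \<phi>)
  have dn: "Dif ?V n = rowm (\<phi> (Suc n)) (Dif Y n)"
    by (simp add: mapping_cone_def Let_def numeral_2_eq_2)
  have cd: "Dif ?C i = mat (\<ominus> (Dif X (Suc i)))
      (zm (Obj Y i) (cyc_ob X (Suc (Suc i)))) (\<phi> (Suc i)) (Dif Y i)" if "i \<le> n" for i
    using that by (simp add: Dif_cone Xs Ys \<phi>)
  have cdn: "Dif ?C (Suc n) = shift ?xb ?ya \<cdot> mat (\<ominus> (SM (Dif X 0)))
      (zm ?ye (S ?xb)) (Id D (S ?ya)) (Dif Y (Suc n))"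
    using \<phi>0 by (simp add: Dif_cone Xs Ys \<phi> XY)
  have \<rho>: "Dif Y (Suc n) \<cdot> \<phi> (Suc n) = Dif X (Suc n)"
    "Dif Y (Suc n) \<cdot> Dif Y n = zm (Obj Y n) (S ?ya)"
    using m(5) \<phi>0 Dif_Dif[OF Y, of n] by (simp_all add: XY)
  have x: "\<phi> (Suc 0) \<cdot> Dif X 0 = Dif Y 0" "Dif X (Suc 0) \<cdot> Dif X 0 = zm ?xa (Obj X (Suc (Suc 0)))"
    using m(4)[of 0] \<phi>0 Dif_Dif[OF X, of 0] by (simp_all add: XY)
  have V: "seq ?V"
  proof (rule seqI)
    fix i assume i: "i \<le> Suc n"
    consider "i = 0" | "0 < i" "i < n" | "i = n" | "i = Suc n" using i by linarith
    then have "Obj ?V i \<in> Ob D \<and> arrow (Dif ?V i) \<and> src (Dif ?V i) = Obj ?V i \<and> tgt (Dif ?V i) =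
      cyc_ob ?V (Suc i)"
    proof cases
      case 1
      have "Obj ?V (Suc 0) = Sum D (Obj X (Suc (Suc 0))) (Obj Y (Suc 0))"
        using O[of "Suc 0"] by (simp add: Obj_cone del: with_ext_simps)
      then show ?thesis using 1 by (simp add: d0 O0 del: with_ext_simps)
    next
      case 2
      then show ?thesis using O[of i] O[of "Suc i"] seqD(1-4)[OF Cs, of i]
        by (simp add: d del: with_ext_simps)
    next
      case 3
      then show ?thesis using O[of n] by (simp add: dn O0 Obj_cone del: with_ext_simps(1,2))
    next
      case 4
      then show ?thesis by (simp add: O0 XY[symmetric] del: with_ext_simps(1,2))
    qed
    then show "Obj ?V i \<in> Ob D" "arrow (Dif ?V i) \<and> src (Dif ?V i) = Obj ?V i \<and> tgt (Dif ?V i) =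
      cyc_ob ?V (Suc i)"
      by blast+
  qed
  \<comment> \<open>In degree n + 1 the entry -d of Y makes the component in \<Sigma> of
    \<open>Obj Y 0\<close> vanish after the last map. Dually, the entry \<open>Dif X 0\<close> of
    \<open>g 0\<close> makes the composite with the last map vanish on \<Sigma> of
    \<open>Obj X 0\<close>.\<close>
  define f where "f i = (if i = 0 then In1 D ?xb ?ya
    else if i \<le> n then Id D (Obj ?V i)
    else colm (\<ominus> (Dif Y (Suc n))) (Id D ?ye))" for i
  define g where "g i = (if i = 0 then rowm (Id D ?xb) (Dif X 0)
    else if i \<le> n then Id D (Obj ?V i) else Pr2 D (S ?xa) ?ye)" for i
  have fT: "arrow (f i) \<and> src (f i) = Obj ?V i \<and> tgt (f i) = Obj ?C i" if i: "i \<le> Suc n" for i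
    using i
  proof (rule le_Suc_n_cases)
    show "arrow (f i) \<and> src (f i) = Obj ?V i \<and> tgt (f i) = Obj ?C i" if "i \<le> n" for i
      using that O[of i] seqD(1)[OF V, of i] by (cases "i = 0")
        (simp_all add: f_def C0 O0 del: with_ext_simps)
  qed (simp add: f_def C0 O0 XY del: with_ext_simps)
  have gT: "arrow (g i) \<and> src (g i) = Obj ?C i \<and> tgt (g i) = Obj ?V i" if i: "i \<le> Suc n" for i
    using i
  proof (rule le_Suc_n_cases)
    show "arrow (g i) \<and> src (g i) = Obj ?C i \<and> tgt (g i) = Obj ?V i" if "i \<le> n" for i
      using that O[of i] seqD(1)[OF V, of i] by (cases "i = 0")
        (simp_all add: g_def C0 O0 XY del: with_ext_simps)
  qed (simp add: g_def C0 O0 XY del: with_ext_simps)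
  have cases: "Q i" if "i \<le> Suc n" "Q 0" "\<And>i. 0 < i \<Longrightarrow> i < n \<Longrightarrow> Q i" "Q n" "Q (Suc n)" for Q i
    using that by (metis le_Suc_eq le_neq_implies_less neq0_conv)
  have f: "seq_map ?V ?C f"
  proof (rule seq_mapI)
    fix i assume i: "i \<le> Suc n"
    show "arrow (f i) \<and> src (f i) = Obj ?V i \<and> tgt (f i) = Obj ?C i" using fT[OF i] .
    show "cyc_map f (Suc i) \<cdot> Dif ?V i = Dif ?C i \<cdot> f i"
      using i
    proof (rule cases)
      show "cyc_map f (Suc 0) \<cdot> Dif ?V 0 = Dif ?C 0 \<cdot> f 0"
        using O[of "Suc 0"] by (simp add: f_def d0 cd Obj_cone del: with_ext_simps)
      show "cyc_map f (Suc i) \<cdot> Dif ?V i = Dif ?C i \<cdot> f i" if "0 < i" "i < n" for i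
        using that seqD(2-4)[OF V, of i] by (simp add: f_def d del: with_ext_simps)
      show "cyc_map f (Suc n) \<cdot> Dif ?V n = Dif ?C n \<cdot> f n"
        using O[of n] by (simp add: f_def dn cd Obj_cone \<rho> XY del: with_ext_simps)
      show "cyc_map f (Suc (Suc n)) \<cdot> Dif ?V (Suc n) = Dif ?C (Suc n) \<cdot> f (Suc n)"
        by (simp add: f_def cdn XY shift_rowm plus_assoc del: with_ext_simps(1,2))
    qed
  qed
  have g: "seq_map ?C ?V g"
  proof (rule seq_mapI)
    fix i assume i: "i \<le> Suc n"
    show "arrow (g i) \<and> src (g i) = Obj ?C i \<and> tgt (g i) = Obj ?V i" using gT[OF i] .
    show "cyc_map g (Suc i) \<cdot> Dif ?C i = Dif ?V i \<cdot> g i"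
      using i
    proof (rule cases)
      show "cyc_map g (Suc 0) \<cdot> Dif ?C 0 = Dif ?V 0 \<cdot> g 0"
        using O[of "Suc 0"] by (simp add: g_def d0 cd Obj_cone x XY del: with_ext_simps)
      show "cyc_map g (Suc i) \<cdot> Dif ?C i = Dif ?V i \<cdot> g i" if "0 < i" "i < n" for i
        using that seqD(2-4)[OF V, of i] by (simp add: g_def d del: with_ext_simps)
      show "cyc_map g (Suc n) \<cdot> Dif ?C n = Dif ?V n \<cdot> g n"
        using O[of n] by (simp add: g_def dn cd Obj_cone del: with_ext_simps)
      have "SM (g 0) \<cdot> Dif ?C (Suc n) = SM (g 0) \<cdot> shift ?xb ?ya \<cdot>
          mat (\<ominus> (SM (Dif X 0))) (zm ?ye (S ?xb))
            (Id D (S ?ya)) (Dif Y (Suc n))"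
        unfolding cdn by (rule comp_assoc'[symmetric]) (simp_all add: g_def XY)
      also have "SM (g 0) \<cdot> shift ?xb ?ya = rowm (Id D (S ?xb)) (SM (Dif X 0))"
        by (simp add: g_def SM_rowm_shift XY)
      finally show "cyc_map g (Suc (Suc n)) \<cdot> Dif ?C (Suc n) = Dif ?V (Suc n) \<cdot> g (Suc n)"
        by (simp add: XY, simp add: g_def XY Pr_rowm)
    qed
  qed
  show ?thesis
  proof (rule retract_angle[OF C V f g])
    show "g i \<cdot> f i = Id D (Obj ?V i)" if "i \<le> Suc n" for i
      using that
    proof (rule le_Suc_n_cases)
      show "g i \<cdot> f i = Id D (Obj ?V i)" if "i \<le> n" for i
        using that seqD(1)[OF V, of i] by (cases "i = 0")
          (simp_all add: f_def g_def O0 XY del: with_ext_simps)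
    qed (simp add: f_def g_def O0 XY del: with_ext_simps)
    show "complemented (f i)" if "i \<le> Suc n" for i
      using that
    proof (rule le_Suc_n_cases)
      show "complemented (f i)" if "i \<le> n" for i
        using that seqD(1)[OF V, of i] by (cases "i = 0") (simp_all add: f_def del: with_ext_simps)
      show "complemented (f (Suc n))"
        by (simp add: f_def) (rule complemented_colm_iso[of _ _ "Id D ?ye"]; simp)
    qed
  qed
qed

text \<open>The identity in degree n + 1 is an entry of the cone differential leaving degree n.
  Cancelling it leaves \<open>Obj Y n\<close> in degree n and \<Sigma> of \<open>Obj X 0\<close> in
  degree n + 1. Up to signs this is the left rotation of the cocone, so (F2) gives the
  claim.\<close>

lemma mapping_cocone_angle:
  assumes X: "X \<in> P" and Y: "Y \<in> P" and \<phi>: "seq_map X Y \<phi>" and C: "cn X Y \<phi> \<in> P"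
    and XY: "Obj X (Suc n) = Obj Y (Suc n)" and \<phi>n: "\<phi> (Suc n) = Id D (Obj X (Suc n))"
  shows "with_ext (mapping_cocone n D X Y \<phi>) (Dif X (Suc n) \<cdot> Dif Y n) \<in> P" (is "?N \<in> P")
proof -
  let ?C = "cn X Y \<phi>" and ?xa = "Obj X 0" and ?xb = "Obj X (Suc 0)" and ?ya = "Obj Y 0" and ?xe =
    "Obj X (Suc n)"
  have Xs: "seq X" and Ys: "seq Y" and Cs: "seq ?C" using X Y C by (simp_all add: angle_seq)
  note m = seq_mapD[OF \<phi> Xs Ys]
  note [simp] = seqD[OF Xs] seqD[OF Ys] m(1-3) n_pos[simplified] seqD_cyc[OF Xs] XY[symmetric]
  have n0 [simp]: "n \<noteq> 0" "0 < n" using n_pos by linarith+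
  let ?n = "n - Suc 0"
  have n1 [simp]: "Suc ?n = n" "?n \<le> n" "?n < n" "?n \<le> Suc n" using n0 by linarith+
  have N_ob: "Obj ?N 0 = Obj X 0" "Obj ?N (Suc n) = Obj Y n"
    "\<And>i. i < n \<Longrightarrow> Obj ?N (Suc i) = Sum D (Obj X (Suc i)) (Obj Y i)"
    by (simp_all add: mapping_cocone_def Let_def)
  have N0: "Dif ?N 0 = colm (Dif X 0) (\<phi> 0)"
    by (simp add: mapping_cocone_def Let_def)
  have Nd: "Dif ?N (Suc i) = mat (Dif X (Suc i)) (zm (Obj Y i) (Obj X (Suc (Suc i))))
      (\<phi> (Suc i)) (\<ominus> (Dif Y i))" if "i < ?n" for i
  proof -
    have "Suc i < n" using that by linarith
    then show ?thesis by (simp add: mapping_cocone_def Let_def)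
  qed
  have "tgt (Dif Y ?n) = Obj Y n" using seqD(4)[OF Ys, of ?n] by simp
  note [simp] = this
  have Nn: "Dif ?N n = rowm (\<phi> n) (\<ominus> (Dif Y ?n))"
    by (simp add: mapping_cocone_def Let_def)
  have NSn: "Dif ?N (Suc n) = Dif X (Suc n) \<cdot> Dif Y n" by simp
  have N: "seq ?N"
  proof (rule seqI)
    fix i assume i: "i \<le> Suc n"
    have O: "Obj ?N i \<in> Ob D" if "i \<le> Suc n" for i
    proof (cases i)
      case 0
      then show ?thesis by (simp add: N_ob del: with_ext_simps)
    next
      case (Suc j)
      then show ?thesis using that N_ob(2) N_ob(3)[of j]
        by (cases "j = n") (simp_all del: with_ext_simps)
    qed
    show "Obj ?N i \<in> Ob D" using O i .
    consider "i = 0" | j where "i = Suc j" "j < ?n" | "i = n" | "i = Suc n"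
      using i by (metis Suc_lessI le_Suc_eq le_neq_implies_less n1(1) not0_implies_Suc not_less_eq)
    then show "arrow (Dif ?N i) \<and> src (Dif ?N i) = Obj ?N i \<and> tgt (Dif ?N i) = cyc_ob ?N (Suc i)"
    proof cases
      case 1
      then show ?thesis using N_ob(3)[of 0] by (simp add: N0 N_ob del: with_ext_simps)
    next
      case 2
      then have "Suc j < n" "j < n" by linarith+
      then show ?thesis using 2 N_ob(3)[of j] N_ob(3)[of "Suc j"]
        by (simp add: Nd del: with_ext_simps)
    next
      case 3
      then show ?thesis using N_ob(3)[of ?n] by (simp add: Nn N_ob del: with_ext_simps)
    next
      case 4
      then show ?thesis by (simp add: N_ob del: with_ext_simps(1,2))
    qed
  qed
  let ?V = "rot ?N"
  have V: "seq ?V" using N by (rule seq_rot)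
  have V_ob: "Obj ?V n = Obj Y n" "Obj ?V (Suc n) = S ?xa"
    "\<And>i. i < n \<Longrightarrow> Obj ?V i = Sum D (Obj X (Suc i)) (Obj Y i)"
    using N_ob by (simp_all del: with_ext_simps)
  have Vd: "\<And>i. i < ?n \<Longrightarrow> Dif ?V i = mat (Dif X (Suc i)) (zm (Obj Y i) (Obj X (Suc (Suc i))))
      (\<phi> (Suc i)) (\<ominus> (Dif Y i))"
    "Dif ?V ?n = rowm (\<phi> n) (\<ominus> (Dif Y ?n))" "Dif ?V n = Dif X (Suc n) \<cdot> Dif Y n"
    "Dif ?V (Suc n) = sg n (shift ?xb ?ya \<cdot> colm (SM (Dif X 0)) (SM (\<phi> 0)))"
    using Nd Nn N0 N by (simp_all add: SM_colm del: with_ext_simps(1,2))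
  have C_ob: "Obj ?C n = Sum D ?xe (Obj Y n)"
    "Obj ?C (Suc n) = Sum D (S ?xa) ?xe"
    "\<And>i. i < n \<Longrightarrow> Obj ?C i = Sum D (Obj X (Suc i)) (Obj Y i)"
    by (simp_all add: Obj_cone)
  have Cd: "\<And>i. i < n \<Longrightarrow> Dif ?C i = mat (\<ominus> (Dif X (Suc i)))
      (zm (Obj Y i) (Obj X (Suc (Suc i)))) (\<phi> (Suc i)) (Dif Y i)"
    "Dif ?C n = mat (\<ominus> (Dif X (Suc n)))
      (zm (Obj Y n) (S ?xa)) (Id D ?xe) (Dif Y n)"
    "Dif ?C (Suc n) = shift ?xb ?ya \<cdot> mat (\<ominus> (SM (Dif X 0)))
      (zm ?xe (S ?xb)) (SM (\<phi> 0)) (Dif Y (Suc n))"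
    by (simp_all add: Dif_cone Xs Ys \<phi> \<phi>n)
  have e: "Dif Y n \<cdot> \<phi> n = Dif X n" "Dif Y n \<cdot> Dif Y ?n = zm (Obj Y ?n) ?xe"
    "SM (\<phi> 0) \<cdot> Dif X (Suc n) = Dif Y (Suc n)"
    "SM (Dif X 0) \<cdot> Dif X (Suc n) = zm ?xe (S ?xb)"
    using m(4)[of n] \<phi>n Dif_Dif[OF Y, of ?n] m(5) SM_Dif_Dif[OF X] by simp_all
  \<comment> \<open>The cone has differentials -d on X and d on Y, the cocone d on X and -d on Y,
    and both have the entry \<phi>. Conjugating by diag(1, -1) flips \<phi>; the alternating sign in
    f and g then flips the whole differential.\<close>
  define J where "J i = mat (Id D (Obj X (Suc i))) (zm (Obj Y i) (Obj X (Suc i)))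
    (zm (Obj X (Suc i)) (Obj Y i)) (\<ominus> (Id D (Obj Y i)))" for i
  have J [simp]: "arrow (J i)" "src (J i) = Sum D (Obj X (Suc i)) (Obj Y i)"
    "tgt (J i) = Sum D (Obj X (Suc i)) (Obj Y i)"
    "J i \<cdot> J i = Id D (Sum D (Obj X (Suc i)) (Obj Y i))"
    if "i < n" for i
    using that by (simp_all add: J_def)
  \<comment> \<open>In degree n the column has zero composite into \<open>Obj Y (Suc n)\<close>, so
    its image under the cone differential lies in the surviving summand.\<close>
  define f where "f i = sg i (if i < n then J i else if i = n
    then colm (Dif Y n) (\<ominus> (Id D (Obj Y n)))
    else In1 D (S ?xa) ?xe)" for i
  define g where "g i = sg i (if i < n then J i else if i = n then \<ominus> (Pr2 D ?xe (Obj Y n))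
    else rowm (Id D (S ?xa)) (Dif X (Suc n)))" for i
  let ?J = "mat (Id D (S ?xb)) (zm (S ?ya) (S ?xb))
    (zm (S ?xb) (S ?ya)) (\<ominus> (Id D (S ?ya)))"
  have J0: "SM (J 0) \<cdot> (shift ?xb ?ya \<cdot> x) = shift ?xb ?ya \<cdot> (?J \<cdot> x)"
    if "arrow x" "tgt x = Sum D (S ?xb) (S ?ya)" for x
  proof -
    have "SM (J 0) \<cdot> shift ?xb ?ya = shift ?xb ?ya \<cdot> ?J"
      unfolding J_def
      by (subst SM_mat_shift[where A' = "Obj X (Suc 0)" and B' = "Obj Y 0"]) simp_all
    from arg_cong[OF this, of "\<lambda>y. y \<cdot> x"] show ?thesis using that by simp
  qed
  have cases: "Q i" if "i \<le> Suc n" "\<And>i. i < ?n \<Longrightarrow> Q i" "Q ?n" "Q n" "Q (Suc n)" for Q i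
    using that by (metis Suc_lessI le_Suc_eq le_neq_implies_less less_antisym n1(1))
  have cases': "Q i" if "i \<le> Suc n" "\<And>i. i < n \<Longrightarrow> Q i" "Q n" "Q (Suc n)" for Q i
    using that by (metis le_Suc_eq le_neq_implies_less)
  have f: "seq_map ?V ?C f"
  proof (rule seq_mapI)
    fix i assume i: "i \<le> Suc n"
    show "arrow (f i) \<and> src (f i) = Obj ?V i \<and> tgt (f i) = Obj ?C i"
      using i by (rule cases') (simp_all add: f_def V_ob C_ob del: with_ext_simps rot_simps)
    show "cyc_map f (Suc i) \<cdot> Dif ?V i = Dif ?C i \<cdot> f i"
      using i
    proof (rule cases)
      fix i assume i: "i < ?n"
      then have [simp]: "Suc i < n" "i < n" "i \<le> n" "i \<le> Suc n" "Suc i \<le> n" by linarith+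
      show "cyc_map f (Suc i) \<cdot> Dif ?V i = Dif ?C i \<cdot> f i"
        using i by (simp add: f_def Vd Cd J_def del: with_ext_simps rot_simps)
    next
      have "cyc_map f n \<cdot> Dif ?V ?n = Dif ?C ?n \<cdot> f ?n"
        using sg_simps(4)[of _ ?n] by (simp add: f_def Vd Cd e J_def del: rot_simps)
      then show "cyc_map f (Suc ?n) \<cdot> Dif ?V ?n = Dif ?C ?n \<cdot> f ?n" by simp
      show "cyc_map f (Suc n) \<cdot> Dif ?V n = Dif ?C n \<cdot> f n"
        by (simp add: f_def Vd Cd e In_colm del: rot_simps)
      show "cyc_map f (Suc (Suc n)) \<cdot> Dif ?V (Suc n) = Dif ?C (Suc n) \<cdot> f (Suc n)"
      proof -
        have "colm (\<ominus> (SM (Dif X 0))) (SM (\<phi> 0)) = \<ominus> (colm (SM (Dif X 0)) (\<ominus> (SM (\<phi> 0))))"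
          by simp
        then show ?thesis
          by (simp add: f_def Vd Cd J0 del: with_ext_simps rot_simps Dif_rot_last minus_colm)
      qed
    qed
  qed
  have g: "seq_map ?C ?V g"
  proof (rule seq_mapI)
    fix i assume i: "i \<le> Suc n"
    show "arrow (g i) \<and> src (g i) = Obj ?C i \<and> tgt (g i) = Obj ?V i"
      using i by (rule cases') (simp_all add: g_def V_ob C_ob del: with_ext_simps rot_simps)
    show "cyc_map g (Suc i) \<cdot> Dif ?C i = Dif ?V i \<cdot> g i"
      using i
    proof (rule cases)
      fix i assume i: "i < ?n"
      then have [simp]: "Suc i < n" "i < n" "i \<le> n" "i \<le> Suc n" "Suc i \<le> n" by linarith+
      show "cyc_map g (Suc i) \<cdot> Dif ?C i = Dif ?V i \<cdot> g i"
        using i by (simp add: g_def Vd Cd J_def del: with_ext_simps rot_simps)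
    next
      have "cyc_map g n \<cdot> Dif ?C ?n = Dif ?V ?n \<cdot> g ?n"
        using sg_simps(4)[of _ ?n] by (simp add: g_def Vd Cd e J_def del: rot_simps)
      then show "cyc_map g (Suc ?n) \<cdot> Dif ?C ?n = Dif ?V ?n \<cdot> g ?n" by simp
      show "cyc_map g (Suc n) \<cdot> Dif ?C n = Dif ?V n \<cdot> g n"
        by (simp add: g_def Vd Cd e Pr_rowm del: rot_simps)
      show "cyc_map g (Suc (Suc n)) \<cdot> Dif ?C (Suc n) = Dif ?V (Suc n) \<cdot> g (Suc n)"
      proof -
        let ?z = "zm ?xe (S ?xb)"
        have "mat (\<ominus> (SM (Dif X 0))) ?z (\<ominus> (SM (\<phi> 0))) (\<ominus> (Dif Y (Suc n))) =
            \<ominus> (mat (SM (Dif X 0)) ?z (SM (\<phi> 0)) (Dif Y (Suc n)))"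
          by simp
        moreover have "shift ?xb ?ya \<cdot> mat (SM (Dif X 0)) ?z (SM (\<phi> 0)) (Dif Y (Suc n)) =
            rowm (shift ?xb ?ya \<cdot> colm (SM (Dif X 0)) (SM (\<phi> 0)))
              (shift ?xb ?ya \<cdot> colm ?z (Dif Y (Suc n)))"
          unfolding mat_def by (rule comp_rowm) simp_all
        ultimately show ?thesis
          by (simp add: g_def Vd Cd J0 e del: with_ext_simps rot_simps Dif_rot_last minus_mat)
      qed
    qed
  qed
  have "?V \<in> P"
  proof (rule retract_angle[OF C V f g])
    show "g i \<cdot> f i = Id D (Obj ?V i)" if "i \<le> Suc n" for i
      using that by (rule cases') (simp_all add: f_def g_def V_ob del: with_ext_simps rot_simps)
    show "complemented (f i)" if "i \<le> Suc n" for i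
      using that
    proof (rule cases')
      show "complemented (f i)" if "i < n" for i
        using that complemented_iso[of "J i" "J i"] by (simp add: f_def complemented_sg)
      show "complemented (f n)"
        by (simp add: f_def complemented_sg complemented_colm_iso[of _ _
          "\<ominus> (Id D (Obj Y n))"] del: sg_colm)
      show "complemented (f (Suc n))"
        by (simp add: f_def complemented_sg complemented_minus)
    qed
  qed
  then show ?thesis using F2[OF N] by simp
qed

text \<open>Gaussian elimination of the contractible summand spanned by \<open>a\<close> and \<open>Dif Z k \<cdot> a\<close>.\<close>

lemma gauss_angle:
  fixes k
  assumes Z: "Z \<in> P" and k: "k \<le> n"
    and [simp]: "arrow a" "tgt a = Obj Z k" "arrow b" "src b = Obj Z (Suc k)" "tgt b = src a"
    and bda: "b \<cdot> (Dif Z k \<cdot> a) = Id D (src a)"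
    and [simp]: "arrow \<sigma>" "tgt \<sigma> = Obj Z k" "arrow q" "src q = Obj Z k" "tgt q = src \<sigma>"
    and \<sigma>: "q \<cdot> \<sigma> = Id D (src \<sigma>)" "a \<cdot> (b \<cdot> Dif Z k) \<oplus> \<sigma> \<cdot> q = Id D (Obj Z k)"
    and [simp]: "arrow \<tau>" "tgt \<tau> = Obj Z (Suc k)" "arrow r" "src r = Obj Z (Suc k)" "tgt r = src \<tau>"
    and \<tau>: "r \<cdot> \<tau> = Id D (src \<tau>)" "Dif Z k \<cdot> (a \<cdot> b) \<oplus> \<tau> \<cdot> r = Id D (Obj Z (Suc k))"
  defines "i \<equiv> \<lambda>j. if j = k then \<sigma> else if j = Suc k then \<tau> else Id D (Obj Z j)"
    and "p \<equiv> \<lambda>j. if j = k then q else if j = Suc k then r else Id D (Obj Z j)"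
  shows "\<lparr>Obj = \<lambda>j. src (i j), Dif = \<lambda>j. cyc_map p (Suc j) \<cdot> (Dif Z j \<cdot> i j)\<rparr> \<in> P" (is "?V \<in> P")
proof -
  have Zs: "seq Z" using Z by (rule angle_seq)
  note [simp] = seqD[OF Zs] n_pos[simplified] k seqD_cyc[OF Zs]
  have n0 [simp]: "n \<noteq> 0" "0 < n" using n_pos by linarith+
  have k' [simp]: "k \<le> Suc n" "Suc k \<le> Suc n" using k by linarith+
  have [simp]: "arrow (i j)" "tgt (i j) = Obj Z j" "arrow (p j)" "src (p j) = Obj Z j"
    "tgt (p j) = src (i j)"
    "p j \<cdot> i j = Id D (src (i j))" if "j \<le> Suc n" for j
    using that \<sigma>(1) \<tau>(1) by (simp_all add: i_def p_def)
  have ci [simp]: "arrow (cyc_map i (Suc j))" "tgt (cyc_map i (Suc j)) = cyc_ob Z (Suc j)"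
    "src (cyc_map i (Suc j)) = cyc_ob ?V (Suc j)"
    "arrow (cyc_map p (Suc j))" "src (cyc_map p (Suc j)) = cyc_ob Z (Suc j)"
    "tgt (cyc_map p (Suc j)) = cyc_ob ?V (Suc j)" if "j \<le> Suc n" for j
    by (rule le_Suc_n_cases[OF that]; simp)+
  have V: "seq ?V" by (rule seqI) simp_all
  \<comment> \<open>The complementarity assumptions give only products and sums. The vanishing
    relations between the two splittings result from multiplying the sums by \<sigma>, r and \<tau>
    and applying \<open>bda\<close>.\<close>
  have bd\<sigma>: "b \<cdot> (Dif Z k \<cdot> \<sigma>) = zm (src \<sigma>) (src a)"
  proof -
    have "a \<cdot> (b \<cdot> (Dif Z k \<cdot> \<sigma>)) \<oplus> \<sigma> = \<sigma>"
      using arg_cong[OF \<sigma>(2), of "\<lambda>x. x \<cdot> \<sigma>"] by (simp add: \<sigma>(1))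
    then have "\<sigma> \<oplus> a \<cdot> (b \<cdot> (Dif Z k \<cdot> \<sigma>)) = \<sigma> \<oplus> zm (src \<sigma>) (Obj Z k)"
      using plus_commute[of \<sigma> "a \<cdot> (b \<cdot> (Dif Z k \<cdot> \<sigma>))"] by simp
    then have "a \<cdot> (b \<cdot> (Dif Z k \<cdot> \<sigma>)) = zm (src \<sigma>) (Obj Z k)"
      by (rule plus_left_cancel[rotated -1]) simp_all
    from arg_cong[OF this, of "\<lambda>x. b \<cdot> (Dif Z k \<cdot> x)"]
    have "b \<cdot> (Dif Z k \<cdot> a) \<cdot> (b \<cdot> (Dif Z k \<cdot> \<sigma>)) = zm (src \<sigma>) (src a)" by simp
    then show ?thesis by (simp add: bda)
  qed
  have rda: "r \<cdot> (Dif Z k \<cdot> a) = zm (src a) (src \<tau>)"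
  proof -
    have "r \<cdot> (Dif Z k \<cdot> (a \<cdot> b)) \<oplus> r = r"
    proof -
      have "r \<cdot> (\<tau> \<cdot> r) = r" using arg_cong[OF \<tau>(1), of "\<lambda>x. x \<cdot> r"] by simp
      then show ?thesis using arg_cong[OF \<tau>(2), of "\<lambda>x. r \<cdot> x"] by simp
    qed
    then have "r \<oplus> r \<cdot> (Dif Z k \<cdot> (a \<cdot> b)) = r \<oplus> zm (Obj Z (Suc k)) (src \<tau>)"
      using plus_commute[of r "r \<cdot> (Dif Z k \<cdot> (a \<cdot> b))"] by simp
    then have "r \<cdot> (Dif Z k \<cdot> (a \<cdot> b)) = zm (Obj Z (Suc k)) (src \<tau>)"
      by (rule plus_left_cancel[rotated -1]) simp_all
    from arg_cong[OF this, of "\<lambda>x. x \<cdot> (Dif Z k \<cdot> a)"]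
    have "r \<cdot> (Dif Z k \<cdot> (a \<cdot> (b \<cdot> (Dif Z k \<cdot> a)))) = zm (src a) (src \<tau>)" by simp
    then show ?thesis by (simp add: bda)
  qed
  have b\<tau>: "b \<cdot> \<tau> = zm (src \<tau>) (src a)"
  proof -
    have "Dif Z k \<cdot> (a \<cdot> (b \<cdot> \<tau>)) \<oplus> \<tau> = \<tau>"
      using arg_cong[OF \<tau>(2), of "\<lambda>x. x \<cdot> \<tau>"] by (simp add: \<tau>(1))
    then have "\<tau> \<oplus> Dif Z k \<cdot> (a \<cdot> (b \<cdot> \<tau>)) = \<tau> \<oplus> zm (src \<tau>) (Obj Z (Suc k))"
      using plus_commute[of \<tau> "Dif Z k \<cdot> (a \<cdot> (b \<cdot> \<tau>))"] by simp
    then have "Dif Z k \<cdot> (a \<cdot> (b \<cdot> \<tau>)) = zm (src \<tau>) (Obj Z (Suc k))"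
      by (rule plus_left_cancel[rotated -1]) simp_all
    from arg_cong[OF this, of "\<lambda>x. b \<cdot> x"]
    have "b \<cdot> (Dif Z k \<cdot> a) \<cdot> (b \<cdot> \<tau>) = zm (src \<tau>) (src a)" by simp
    then show ?thesis by (simp add: bda)
  qed
  have \<sigma>q: "\<sigma> \<cdot> q = \<ominus> (a \<cdot> (b \<cdot> Dif Z k)) \<oplus> Id D (Obj Z k)"
    using plus_minus_cancel(2)[of "a \<cdot> (b \<cdot> Dif Z k)" "\<sigma> \<cdot> q"] \<sigma>(2) by simp
  have \<tau>r: "\<tau> \<cdot> r = \<ominus> (Dif Z k \<cdot> (a \<cdot> b)) \<oplus> Id D (Obj Z (Suc k))"
    using plus_minus_cancel(2)[of "Dif Z k \<cdot> (a \<cdot> b)" "\<tau> \<cdot> r"] \<tau>(2) by simp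
  have dd: "Dif Z (Suc k) \<cdot> (Dif Z k \<cdot> x) = zm (src x) (cyc_ob Z (Suc (Suc k)))"
    if "arrow x" "tgt x = Obj Z k" for x
    by (rule comp_zero_assoc[OF Dif_Dif[OF Z k]]) (use that seqD_cyc[OF Zs, of "Suc k"] in simp_all)
  \<comment> \<open>This is the square of i, and fact 2 is the square of p. In degrees k and k + 1,
    i p differs from the identity by a b d and d a b, which are killed by d d = 0 or by the
    relations just shown.\<close>
  have 1: "cyc_map i (Suc j) \<cdot> (cyc_map p (Suc j) \<cdot> (Dif Z j \<cdot> i j)) = Dif Z j \<cdot> i j"
    if j: "j \<le> Suc n" for j
  proof -
    have A: "cyc_map i (Suc j) \<cdot> (cyc_map p (Suc j) \<cdot> (Dif Z j \<cdot> i j)) =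
        cyc_map i (Suc j) \<cdot> cyc_map p (Suc j) \<cdot> (Dif Z j \<cdot> i j)"
      using j by simp
    consider "j = k" | "Suc j = k" | "j = Suc n" "k = 0" | "Suc j \<noteq> k" "j \<noteq> k" "j = Suc n \<longrightarrow> k \<noteq> 0"
      by blast
    then show ?thesis
    proof cases
      case 1
      have "\<tau> \<cdot> r \<cdot> (Dif Z k \<cdot> \<sigma>) = Dif Z k \<cdot> \<sigma>" unfolding \<tau>r by (simp add: bd\<sigma>)
      then show ?thesis using 1 by (simp add: i_def p_def)
    next
      case 2
      then have [simp]: "j \<le> n" "j \<le> Suc n" using k by linarith+
      have "Dif Z k \<cdot> Dif Z j = zm (Obj Z j) (Obj Z (Suc k))"
        using Dif_Dif[OF Z, of j] 2 by simp
      then have "\<sigma> \<cdot> q \<cdot> Dif Z j = Dif Z j" unfolding \<sigma>q using 2 by simp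
      then show ?thesis using 2 by (auto simp: i_def p_def)
    next
      case 3
      \<comment> \<open>Degree k = 0 occurs once more as degree n + 2, behind the last map, so the
        relation used here is \<open>SM_Dif_Dif\<close>.\<close>
      have "SM (\<sigma> \<cdot> q) \<cdot> Dif Z (Suc n) = Dif Z (Suc n)"
        unfolding \<sigma>q using 3 SM_Dif_Dif[OF Z] by simp
      then show ?thesis using 3 by (simp add: i_def p_def)
    next
      case 4
      have "cyc_map i (Suc j) \<cdot> cyc_map p (Suc j) = Id D (cyc_ob Z (Suc j))"
        using j
        by (rule le_Suc_n_cases[of _ "\<lambda>j. j \<noteq> k \<longrightarrow> Suc j \<noteq> k \<longrightarrow> (j = Suc n \<longrightarrow> k \<noteq> 0) \<longrightarrow>
            cyc_map i (Suc j) \<cdot> cyc_map p (Suc j) = Id D (cyc_ob Z (Suc j))", rule_format])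
          (use 4 in \<open>auto simp: i_def p_def\<close>)
      then show ?thesis unfolding A using j by simp
    qed
  qed
  have 2: "cyc_map p (Suc j) \<cdot> (Dif Z j \<cdot> (i j \<cdot> p j)) = cyc_map p (Suc j) \<cdot> Dif Z j"
    if j [simp]: "j \<le> Suc n" for j
  proof -
    consider "j = k" | "j = Suc k" | "j \<noteq> k" "j \<noteq> Suc k" by blast
    then show ?thesis
    proof cases
      case 1
      have "r \<cdot> (Dif Z k \<cdot> (a \<cdot> (b \<cdot> Dif Z k))) = zm (Obj Z k) (src \<tau>)"
        using arg_cong[OF rda, of "\<lambda>x. x \<cdot> (b \<cdot> Dif Z k)"] by simp
      then have "r \<cdot> (Dif Z k \<cdot> (\<sigma> \<cdot> q)) = r \<cdot> Dif Z k" unfolding \<sigma>q by simp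
      then show ?thesis using 1 by (simp add: i_def p_def)
    next
      case 2
      have "Dif Z (Suc k) \<cdot> (\<tau> \<cdot> r) = Dif Z (Suc k)" unfolding \<tau>r by (simp add: dd)
      then show ?thesis using 2 by (simp add: i_def p_def)
    next
      case 3
      then show ?thesis by (simp add: i_def p_def)
    qed
  qed
  show ?thesis
  proof (rule retract_angle[OF Z V])
    show "seq_map ?V Z i" by (rule seq_mapI) (simp_all add: 1)
    show "seq_map Z ?V p" by (rule seq_mapI) (simp_all add: 2)
    show "p j \<cdot> i j = Id D (Obj ?V j)" if "j \<le> Suc n" for j using that by simp
    show "complemented (i j)" if "j \<le> Suc n" for j
    proof -
      consider "j = k" | "j = Suc k" | "j \<noteq> k" "j \<noteq> Suc k" by blast
      then show ?thesis
      proof cases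
        case 1
        have "complemented \<sigma>"
          by (rule complementedI[of \<sigma> q a "b \<cdot> Dif Z k"])
            (use bda bd\<sigma> \<sigma> plus_commute[of "\<sigma> \<cdot> q" "a \<cdot> (b \<cdot> Dif Z k)"] in simp_all)
        then show ?thesis using 1 by (simp add: i_def)
      next
        case 2
        have "complemented \<tau>"
          by (rule complementedI[of \<tau> r "Dif Z k \<cdot> a" b])
            (use bda b\<tau> \<tau> plus_commute[of "\<tau> \<cdot> r" "Dif Z k \<cdot> (a \<cdot> b)"] in simp_all)
        then show ?thesis using 2 by (simp add: i_def)
      next
        case 3
        then show ?thesis using that by (simp add: i_def)
      qed
    qed
  qed
qed

subsection \<open>Homotopy equivalence of angles\<close>

text \<open>Homotopies are indexed by the degree in which they land, one less than in the
  definition, which avoids subtraction on indices.\<close>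

lemma null_homotopicI:
  assumes X: "seq X" and Y: "seq Y"
    and t: "\<And>j. j \<le> n \<Longrightarrow> arrow (t j) \<and> src (t j) = Obj X (Suc j) \<and> tgt (t j) = Obj Y j"
    and h0: "h 0 = t 0 \<cdot> Dif X 0"
    and h: "\<And>j. j < n \<Longrightarrow> h (Suc j) = Dif Y j \<cdot> t j \<oplus> t (Suc j) \<cdot> Dif X (Suc j)"
    and hn: "h (Suc n) = Dif Y n \<cdot> t n"
  shows "null_homotopic D n X Y h"
  unfolding null_homotopic_def
proof (intro exI[of _ "\<lambda>i. t (i - 1)"] conjI ballI)
  note [simp] = seqD[OF X] seqD[OF Y]
  fix i assume i: "i \<in> {1..n + 1}"
  then obtain j where j [simp]: "i = Suc j" "j \<le> n" by (cases i) auto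
  have [simp]: "j \<le> Suc n" by (rule le_SucI[OF j(2)])
  show "t (i - 1) \<in> mor D (Obj X i) (Obj Y (i - 1))" using t[of j] by simp
next
  note [simp] = seqD[OF X] seqD[OF Y]
  fix i assume i: "i \<in> {1..n}"
  then obtain j where j [simp]: "i = Suc j" "j < n" "Suc j \<le> n" by (cases i) auto
  have [simp]: "j \<le> n" "j \<le> Suc n" using j by linarith+
  show "h i = add_mor D (Obj X i) (Obj Y i) (Dif Y (i - 1) \<cdot> t (i - 1)) (t (i + 1 - 1) \<cdot> Dif X i)"
    using t[of j] t[of "Suc j"] h[of j] by simp
qed (use h0 hn in simp_all)

lemma null_homotopicE:
  assumes X: "seq X" and Y: "seq Y" and "null_homotopic D n X Y h"
  obtains t where "\<And>j. j \<le> n \<Longrightarrow> arrow (t j) \<and> src (t j) = Obj X (Suc j) \<and> tgt (t j) = Obj Y j"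
    "h 0 = t 0 \<cdot> Dif X 0"
    "\<And>j. j < n \<Longrightarrow> h (Suc j) = Dif Y j \<cdot> t j \<oplus> t (Suc j) \<cdot> Dif X (Suc j)"
    "h (Suc n) = Dif Y n \<cdot> t n"
proof -
  note [simp] = seqD[OF X] seqD[OF Y]
  obtain s where s: "\<And>i. i \<in> {1..n + 1} \<Longrightarrow> s i \<in> mor D (Obj X i) (Obj Y (i - 1))"
      "h 0 = s 1 \<cdot> Dif X 0"
      "\<And>i. i \<in> {1..n} \<Longrightarrow> h i = add_mor D (Obj X i) (Obj Y i) (Dif Y (i - 1) \<cdot> s i) (s (i + 1) \<cdot>
        Dif X i)"
      "h (n + 1) = Dif Y n \<cdot> s (n + 1)"
    using assms(3) unfolding null_homotopic_def by blast
  have t: "arrow (s (Suc j)) \<and> src (s (Suc j)) = Obj X (Suc j) \<and> tgt (s (Suc j)) = Obj Y j" if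
    "j \<le> n" for j
    using s(1)[of "Suc j"] that by simp
  show ?thesis
  proof (rule that[of "\<lambda>j. s (Suc j)"])
    fix j assume j [simp]: "j < n"
    have [simp]: "j \<le> n" "j \<le> Suc n" "Suc j \<le> n" using j by linarith+
    show "h (Suc j) = Dif Y j \<cdot> s (Suc j) \<oplus> s (Suc (Suc j)) \<cdot> Dif X (Suc j)"
      using s(3)[of "Suc j"] t[of j] t[of "Suc j"] by simp
  qed (use s t in simp_all)
qed

lemma null_homotopic_with_ext [simp]:
  "null_homotopic D n (with_ext X \<delta>) (with_ext Y \<rho>) h = null_homotopic D n X Y h"
proof -
  have "(\<forall>i \<in> {1..n}. h i = add_mor D (Obj X i) (Obj Y i)
        (Dif (with_ext Y \<rho>) (i - 1) \<cdot> s i) (s (i + 1) \<cdot> Dif (with_ext X \<delta>) i)) \<longleftrightarrow>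
      (\<forall>i \<in> {1..n}. h i = add_mor D (Obj X i) (Obj Y i)
        (Dif Y (i - 1) \<cdot> s i) (s (i + 1) \<cdot> Dif X i))" for s
  proof (rule ball_cong[OF refl])
    fix i assume "i \<in> {1..n}"
    then have "i - 1 \<noteq> Suc n" "i \<noteq> Suc n" by auto
    then have eq: "Dif (with_ext Y \<rho>) (i - 1) = Dif Y (i - 1)" "Dif (with_ext X \<delta>) i = Dif X i"
      using with_ext_simps(2) by blast+
    show "(h i = add_mor D (Obj X i) (Obj Y i)
        (Dif (with_ext Y \<rho>) (i - 1) \<cdot> s i) (s (i + 1) \<cdot> Dif (with_ext X \<delta>) i)) \<longleftrightarrow>
      (h i = add_mor D (Obj X i) (Obj Y i) (Dif Y (i - 1) \<cdot> s i) (s (i + 1) \<cdot> Dif X i))"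
      by (simp only: eq)
  qed
  then show ?thesis unfolding null_homotopic_def with_ext_simps(1) by simp
qed

text \<open>The homotopy is built upwards from s 0 = 0. At each stage h - d s vanishes on the
  preceding differential, hence factors through the next one by exactness. The formula is obtained
  up to degree n; in degree n + 1 it would need h = d s.\<close>

lemma endomorphism_homotopy:
  assumes X: "X \<in> P"
    and h: "\<And>i. i \<le> Suc n \<Longrightarrow> arrow (h i) \<and> src (h i) = Obj X i \<and> tgt (h i) = Obj X i"
    and hd: "\<And>i. i \<le> n \<Longrightarrow> h (Suc i) \<cdot> Dif X i = Dif X i \<cdot> h i"
    and h0: "h 0 = zm (Obj X 0) (Obj X 0)"
  obtains s where "\<And>j. j \<le> n \<Longrightarrow> arrow (s j) \<and> src (s j) = Obj X (Suc j) \<and> tgt (s j) = Obj X j"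
    "s 0 = zm (Obj X (Suc 0)) (Obj X 0)"
    "\<And>j. j < n \<Longrightarrow> h (Suc j) = Dif X j \<cdot> s j \<oplus> s (Suc j) \<cdot> Dif X (Suc j)"
proof -
  have Xs: "seq X" using X by (rule angle_seq)
  note [simp] = seqD[OF Xs]
  have [simp]: "arrow (h i)" "src (h i) = Obj X i" "tgt (h i) = Obj X i" if "i \<le> Suc n" for i
    using h that by blast+
  have "\<exists>s. (\<forall>j \<le> m. arrow (s j) \<and> src (s j) = Obj X (Suc j) \<and> tgt (s j) = Obj X j) \<and>
      s 0 = zm (Obj X (Suc 0)) (Obj X 0) \<and>
      (\<forall>j < m. h (Suc j) = Dif X j \<cdot> s j \<oplus> s (Suc j) \<cdot> Dif X (Suc j)) \<and>
      Dif X m \<cdot> (s m \<cdot> Dif X m) = h (Suc m) \<cdot> Dif X m" if "m \<le> n" for m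
    using that
  proof (induction m)
    case 0
    show ?case
      using hd[of 0] by (intro exI[of _ "\<lambda>_. zm (Obj X (Suc 0)) (Obj X 0)"]) (simp add: h0)
  next
    case (Suc m)
    then have [simp]: "m \<le> n" "m \<le> Suc n" "m < n" "Suc m \<le> n" by simp_all
    obtain s where s: "\<forall>j \<le> m. arrow (s j) \<and> src (s j) = Obj X (Suc j) \<and> tgt (s j) = Obj X j"
      "s 0 = zm (Obj X (Suc 0)) (Obj X 0)"
      "\<forall>j < m. h (Suc j) = Dif X j \<cdot> s j \<oplus> s (Suc j) \<cdot> Dif X (Suc j)"
      "Dif X m \<cdot> (s m \<cdot> Dif X m) = h (Suc m) \<cdot> Dif X m"
      using Suc by auto
    have [simp]: "arrow (s m)" "src (s m) = Obj X (Suc m)" "tgt (s m) = Obj X m" using s(1) by auto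
    \<comment> \<open>The last invariant of the induction says exactly that this difference vanishes
      on \<open>Dif X m\<close>.\<close>
    let ?g = "h (Suc m) \<oplus> \<ominus> (Dif X m \<cdot> s m)"
    have "?g \<cdot> Dif X m = zm (Obj X m) (tgt ?g)" by (simp add: s(4))
    then obtain k where k [simp]: "arrow k" "src k = Obj X (Suc (Suc m))" "tgt k = Obj X (Suc m)"
      and kd: "k \<cdot> Dif X (Suc m) = ?g"
      using exact_contravariant[OF X \<open>m \<le> n\<close>, of ?g] by auto
    have dd: "Dif X (Suc m) \<cdot> (Dif X m \<cdot> s m) = zm (Obj X (Suc m)) (Obj X (Suc (Suc m)))"
      using comp_zero_assoc[of "Dif X (Suc m)" "Dif X m" "Obj X m" "Obj X (Suc (Suc m))"
        "s m"] Dif_Dif[OF X, of m]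
      by simp
    define s' where "s' = s(Suc m := k)"
    have 1: "\<forall>j \<le> Suc m. arrow (s' j) \<and> src (s' j) = Obj X (Suc j) \<and> tgt (s' j) = Obj X j"
      using s(1) by (auto simp: s'_def le_Suc_eq)
    have 2: "s' 0 = zm (Obj X (Suc 0)) (Obj X 0)" using s(2) by (simp add: s'_def)
    have "h (Suc m) = Dif X m \<cdot> s m \<oplus> k \<cdot> Dif X (Suc m)"
      unfolding kd by (simp add: plus_ac)
    then have 3: "h (Suc j) = Dif X j \<cdot> s' j \<oplus> s' (Suc j) \<cdot> Dif X (Suc j)" if "j < Suc m" for j
      using s(3) that by (cases "j = m") (simp_all add: s'_def)
    have "Dif X (Suc m) \<cdot> (k \<cdot> Dif X (Suc m)) = Dif X (Suc m) \<cdot> h (Suc m)"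
      unfolding kd by (simp add: dd)
    then have 4: "Dif X (Suc m) \<cdot> (s' (Suc m) \<cdot> Dif X (Suc m)) = h (Suc (Suc m)) \<cdot> Dif X (Suc m)"
      using hd[of "Suc m"] by (simp add: s'_def)
    show ?case using 1 2 3 4 by blast
  qed
  from this[of n] show ?thesis using that by auto
qed

text \<open>As k commutes with d, the maps k s form a homotopy for k h up to degree n. In degree n +
  1 both sides are zero, since d k s = k d s and k vanishes there.\<close>

lemma endomorphisms_comp_null_homotopic:
  assumes X: "X \<in> P"
    and h: "\<And>i. i \<le> Suc n \<Longrightarrow> arrow (h i) \<and> src (h i) = Obj X i \<and> tgt (h i) = Obj X i"
    and hd: "\<And>i. i \<le> n \<Longrightarrow> h (Suc i) \<cdot> Dif X i = Dif X i \<cdot> h i"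
    and h0: "h 0 = zm (Obj X 0) (Obj X 0)"
    and k: "\<And>i. i \<le> Suc n \<Longrightarrow> arrow (k i) \<and> src (k i) = Obj X i \<and> tgt (k i) = Obj X i"
    and kd: "\<And>i. i \<le> n \<Longrightarrow> k (Suc i) \<cdot> Dif X i = Dif X i \<cdot> k i"
    and kn: "k (Suc n) = zm (Obj X (Suc n)) (Obj X (Suc n))"
  shows "null_homotopic D n X X (\<lambda>i. k i \<cdot> h i)"
proof -
  have Xs: "seq X" using X by (rule angle_seq)
  obtain s where s: "\<And>j. j \<le> n \<Longrightarrow> arrow (s j) \<and> src (s j) = Obj X (Suc j) \<and> tgt (s j) = Obj X j"
    and s0: "s 0 = zm (Obj X (Suc 0)) (Obj X 0)"
    and sh: "\<And>j. j < n \<Longrightarrow> h (Suc j) = Dif X j \<cdot> s j \<oplus> s (Suc j) \<cdot> Dif X (Suc j)"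
    using endomorphism_homotopy[of X h] X h hd h0 by metis
  note [simp] = seqD[OF Xs]
  have [simp]: "arrow (h i)" "src (h i) = Obj X i" "tgt (h i) = Obj X i"
    "arrow (k i)" "src (k i) = Obj X i" "tgt (k i) = Obj X i" if "i \<le> Suc n" for i
    using h k that by blast+
  have [simp]: "arrow (s i)" "src (s i) = Obj X (Suc i)" "tgt (s i) = Obj X i" if "i \<le> n" for i
    using s that by blast+
  have ks: "k (Suc j) \<cdot> (Dif X j \<cdot> s j) = Dif X j \<cdot> (k j \<cdot> s j)" if "j \<le> n" for j
  proof -
    have [simp]: "j \<le> n" "j \<le> Suc n" using that by linarith+
    show ?thesis using arg_cong[OF kd[of j], of "\<lambda>x. x \<cdot> s j"] by simp
  qed
  show ?thesis
  proof (rule null_homotopicI[OF Xs Xs, of "\<lambda>j. k j \<cdot> s j"])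
    show "k (Suc j) \<cdot> h (Suc j) = Dif X j \<cdot> (k j \<cdot> s j) \<oplus> k (Suc j) \<cdot> s (Suc j) \<cdot> Dif X (Suc j)"
      if "j < n" for j
    proof -
      have [simp]: "j \<le> n" "j \<le> Suc n" "Suc j \<le> n" using that by linarith+
      show ?thesis using that by (simp add: sh ks)
    qed
    show "k (Suc n) \<cdot> h (Suc n) = Dif X n \<cdot> (k n \<cdot> s n)"
    proof -
      have "Dif X n \<cdot> (k n \<cdot> s n) = k (Suc n) \<cdot> (Dif X n \<cdot> s n)" by (rule ks[symmetric]) simp
      then show ?thesis by (simp add: kn)
    qed
  qed (simp_all add: h0 s0)
qed

lemma chain_map_seq_map:
  assumes "seq X" "seq Y" "seq_map X Y f"
  shows "chain_map D n X Y f"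
  using seq_mapD[OF assms(3,1,2)] seqD(1)[OF assms(1)] seqD(1)[OF assms(2)]
  by (simp add: chain_map_def)

text \<open>If \<open>f\<close> and \<open>g\<close> are morphisms which are identities on the ends,
  then \<open>g f - 1\<close> and \<open>f g - 1\<close> have
  null-homotopic squares, hence \<open>2 g - g f g\<close> is a homotopy inverse of \<open>f\<close>.\<close>

lemma angles_homotopy_equivalent:
  assumes X: "X \<in> P" and Y: "Y \<in> P" and e0: "Obj X 0 = Obj Y 0"
    and en: "Obj X (Suc n) = Obj Y (Suc n)"
    and d: "Dif X (Suc n) = Dif Y (Suc n)"
  shows "homotopy_equivalent D n (Obj X 0) (Obj X (Suc n)) X Y"
proof -
  have Xs: "seq X" and Ys: "seq Y" using X Y by (simp_all add: angle_seq)
  note [simp] = seqD[OF Xs] seqD[OF Ys]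
  obtain f where f: "seq_map X Y f" "f 0 = Id D (Obj X 0)" "f (Suc n) = Id D (Obj X (Suc n))"
    by (rule F4_ends[OF X Y, of "Id D (Obj X 0)" "Id D (Obj X (Suc n))"]) (simp_all add: e0 en d)
  obtain g where g: "seq_map Y X g" "g 0 = Id D (Obj X 0)" "g (Suc n) = Id D (Obj X (Suc n))"
    by (rule F4_ends[OF Y X, of "Id D (Obj X 0)" "Id D (Obj X (Suc n))"]) (simp_all add: e0 en d)
  note f' = seq_mapD[OF f(1) Xs Ys] and g' = seq_mapD[OF g(1) Ys Xs]
  note [simp] = f'(1-3) g'(1-3)
  have gd: "g (Suc i) \<cdot> (Dif Y i \<cdot> x) = Dif X i \<cdot> (g i \<cdot> x)" if "i \<le> n" "arrow x"
    "tgt x = Obj Y i" for i x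
    using arg_cong[OF g'(4)[OF that(1)], of "\<lambda>y. y \<cdot> x"] that by simp
  have fd: "f (Suc i) \<cdot> (Dif X i \<cdot> x) = Dif Y i \<cdot> (f i \<cdot> x)" if "i \<le> n" "arrow x"
    "tgt x = Obj X i" for i x
    using arg_cong[OF f'(4)[OF that(1)], of "\<lambda>y. y \<cdot> x"] that by simp
  define g1 where "g1 i = g i \<oplus> (g i \<oplus> \<ominus> (g i \<cdot> (f i \<cdot> g i)))" for i
  define h where "h i = g i \<cdot> f i \<oplus> \<ominus> (Id D (Obj X i))" for i
  define h' where "h' i = f i \<cdot> g i \<oplus> \<ominus> (Id D (Obj Y i))" for i
  have cf: "chain_map_between D n (Obj X 0) (Obj X (Suc n)) X Y f"
    using chain_map_seq_map[OF Xs Ys f(1)] f(2,3) by (simp add: chain_map_between_def)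
  have "chain_map D n Y X g1"
    unfolding chain_map_def
  proof (intro conjI allI impI)
    fix i assume "i \<le> n"
    then show "g1 (i + 1) \<cdot> Dif Y i = Dif X i \<cdot> g1 i"
      by (simp add: g1_def g'(4) f'(4) gd fd)
  qed (simp add: g1_def)
  then have cg: "chain_map_between D n (Obj X 0) (Obj X (Suc n)) Y X g1"
    using f(2,3) g(2,3) by (simp add: chain_map_between_def g1_def e0 en)
  \<comment> \<open>Expanding gives g1 f - 1 = -(g f - 1)(g f - 1), so the product lemma applies to
    h and its negative. The same computation with f and g exchanged serves Y.\<close>
  have "null_homotopic D n X X (\<lambda>i. \<ominus> (h i) \<cdot> h i)"
    by (rule endomorphisms_comp_null_homotopic[OF X])
      (simp_all add: h_def g'(4) f'(4) gd f g e0 en)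
  moreover have "\<ominus> (h i) \<cdot> h i = add_mor D (Obj X i) (Obj X i) (g1 i \<cdot>
    f i) (neg_mor D (Obj X i) (Obj X i) (Id D (Obj X i)))"
    if "i \<le> Suc n" for i
    using that by (simp add: h_def g1_def plus_ac)
  ultimately have 1: "homotopic_maps D n X X (\<lambda>i. g1 i \<cdot> f i) (\<lambda>i. Id D (Obj X i))"
    unfolding homotopic_maps_def null_homotopic_def by simp
  have "null_homotopic D n Y Y (\<lambda>i. \<ominus> (h' i) \<cdot> h' i)"
    by (rule endomorphisms_comp_null_homotopic[OF Y])
      (simp_all add: h'_def g'(4) f'(4) fd f g e0 en)
  moreover have "\<ominus> (h' i) \<cdot> h' i = add_mor D (Obj Y i) (Obj Y i) (f i \<cdot>
    g1 i) (neg_mor D (Obj Y i) (Obj Y i) (Id D (Obj Y i)))"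
    if "i \<le> Suc n" for i
    using that by (simp add: h'_def g1_def plus_ac)
  ultimately have 2: "homotopic_maps D n Y Y (\<lambda>i. f i \<cdot> g1 i) (\<lambda>i. Id D (Obj Y i))"
    unfolding homotopic_maps_def null_homotopic_def by simp
  show ?thesis unfolding homotopy_equivalent_def using cf cg 1 2 by blast
qed

section \<open>Complexes homotopy equivalent to an angle\<close>

lemma seq_with_ext:
  assumes "complex D n X" "arrow \<delta>" "src \<delta> = Obj X (Suc n)" "tgt \<delta> = S (Obj X 0)"
  shows "seq (with_ext X \<delta>)"
proof -
  have "\<delta> \<in> mor D (Obj X (Suc n)) (S (Obj X 0))" using assms(2-4) arrow_mor by metis
  then show ?thesis using assms(1) unfolding complex_def sigma_seq_def by (simp del: mor_iff)
qed

lemma angle_complex: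
  assumes "with_ext X \<delta> \<in> P"
  shows "complex D n X"
proof -
  let ?X = "with_ext X \<delta>"
  have "seq ?X" using assms by (rule angle_seq)
  note d = seqD[OF this]
  have o: "Obj X i \<in> Ob D" if "i \<le> Suc n" for i using d(1)[OF that] by simp
  have "Dif X (Suc i) \<cdot> Dif X i = zm (Obj X i) (Obj X (Suc (Suc i)))" if "i < n" for i
    using Dif_Dif[OF assms, of i] that by simp
  moreover have "arrow (Dif X i)" "src (Dif X i) = Obj X i" "tgt (Dif X i) = Obj X (Suc i)" if
    "i \<le> n" for i
    using d(2-4)[of i] that by simp_all
  ultimately show ?thesis using o unfolding complex_def by simp
qed

text \<open>Here Y is the homotopy retract, via g and then f. Both maps are identities on the ends,
  so the first component is complemented and the homotopy satisfies s d = 0 in degree 0 and d s = 0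
  in degree n + 1, as \<open>homotopy_retract_angle\<close> requires.\<close>

lemma homotopy_equivalent_angle:
  assumes X: "with_ext X \<delta> \<in> P" and Y: "complex D n Y"
    and e0: "Obj Y 0 = Obj X 0" and en: "Obj Y (Suc n) = Obj X (Suc n)"
    and eq: "homotopy_equivalent D n (Obj X 0) (Obj X (Suc n)) X Y"
  shows "with_ext Y \<delta> \<in> P"
proof -
  let ?X = "with_ext X \<delta>" and ?Y = "with_ext Y \<delta>"
  have Xs: "seq ?X" using X by (rule angle_seq)
  note xs = seqD[OF Xs]
  have [simp]: "arrow \<delta>" "src \<delta> = Obj X (Suc n)" "tgt \<delta> = S (Obj X 0)"
    using xs(2,3)[of "Suc n"] xs(5) by simp_all
  have Ys: "seq ?Y" using Y by (rule seq_with_ext) (simp_all add: e0 en)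
  have [simp]: "i \<le> Suc n \<Longrightarrow> Obj X i \<in> Ob D" "i \<le> Suc n \<Longrightarrow> Obj Y i \<in> Ob D"
    "i \<le> n \<Longrightarrow> arrow (Dif X i)" "i \<le> n \<Longrightarrow> src (Dif X i) = Obj X i"
    "i \<le> n \<Longrightarrow> tgt (Dif X i) = Obj X (Suc i)"
    "i \<le> n \<Longrightarrow> arrow (Dif Y i)" "i \<le> n \<Longrightarrow> src (Dif Y i) = Obj Y i"
    "i \<le> n \<Longrightarrow> tgt (Dif Y i) = Obj Y (Suc i)" for i
    using xs(1-4)[of i] seqD(1-4)[OF Ys, of i] by simp_all
  obtain f g where f: "chain_map_between D n (Obj X 0) (Obj X (Suc n)) X Y f"
    and g: "chain_map_between D n (Obj X 0) (Obj X (Suc n)) Y X g"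
    and fg: "homotopic_maps D n Y Y (\<lambda>i. f i \<cdot> g i) (\<lambda>i. Id D (Obj Y i))"
    using eq unfolding homotopy_equivalent_def by blast
  have [simp]: "arrow (f i)" "src (f i) = Obj X i" "tgt (f i) = Obj Y i"
    "arrow (g i)" "src (g i) = Obj Y i" "tgt (g i) = Obj X i" if "i \<le> Suc n" for i
    using f g that by (simp_all add: chain_map_between_def chain_map_def)
  have f': "\<And>i. i \<le> n \<Longrightarrow> f (Suc i) \<cdot> Dif X i = Dif Y i \<cdot> f i" "f 0 = Id D (Obj X 0)"
    "f (Suc n) = Id D (Obj X (Suc n))"
    and g': "\<And>i. i \<le> n \<Longrightarrow> g (Suc i) \<cdot> Dif Y i = Dif X i \<cdot> g i" "g 0 = Id D (Obj X 0)"
      "g (Suc n) = Id D (Obj X (Suc n))"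
    using f g by (simp_all add: chain_map_between_def chain_map_def)
  have fm: "seq_map ?X ?Y f"
  proof (rule seq_mapI)
    fix i assume "i \<le> Suc n"
    then show "cyc_map f (Suc i) \<cdot> Dif ?X i = Dif ?Y i \<cdot> f i"
      by (rule le_Suc_n_cases) (simp_all add: f')
  qed simp
  have gm: "seq_map ?Y ?X g"
  proof (rule seq_mapI)
    fix i assume "i \<le> Suc n"
    then show "cyc_map g (Suc i) \<cdot> Dif ?Y i = Dif ?X i \<cdot> g i"
      by (rule le_Suc_n_cases) (simp_all add: g')
  qed simp
  have "null_homotopic D n ?Y ?Y (\<lambda>i. add_mor D (Obj Y i) (Obj Y i) (f i \<cdot>
    g i) (neg_mor D (Obj Y i) (Obj Y i) (Id D (Obj Y i))))"
    using fg by (simp add: homotopic_maps_def)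
  then obtain s where s: "\<And>j. j \<le> n \<Longrightarrow> arrow (s j) \<and> src (s j) = Obj ?Y (Suc j) \<and> tgt (s j) =
    Obj ?Y j"
    and s0: "add_mor D (Obj Y 0) (Obj Y 0) (f 0 \<cdot>
      g 0) (neg_mor D (Obj Y 0) (Obj Y 0) (Id D (Obj Y 0))) = s 0 \<cdot> Dif ?Y 0"
    and sj: "\<And>j. j < n \<Longrightarrow> add_mor D (Obj Y (Suc j)) (Obj Y (Suc j)) (f (Suc j) \<cdot> g (Suc j))
        (neg_mor D (Obj Y (Suc j)) (Obj Y (Suc j)) (Id D (Obj Y (Suc j)))) =
      Dif ?Y j \<cdot> s j \<oplus> s (Suc j) \<cdot> Dif ?Y (Suc j)"
    and sn: "add_mor D (Obj Y (Suc n)) (Obj Y (Suc n)) (f (Suc n) \<cdot> g (Suc n))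
        (neg_mor D (Obj Y (Suc n)) (Obj Y (Suc n)) (Id D (Obj Y (Suc n)))) = Dif ?Y n \<cdot> s n"
    by (rule null_homotopicE[OF Ys Ys]) blast
  have [simp]: "arrow (s j)" "src (s j) = Obj Y (Suc j)" "tgt (s j) = Obj Y j" if "j \<le> n" for j
    using s[OF that] by simp_all
  have s0': "s 0 \<cdot> Dif Y 0 = zm (Obj Y 0) (Obj Y 0)"
    using s0 by (simp add: f' g' e0)
  have sn': "Dif Y n \<cdot> s n = zm (Obj Y (Suc n)) (Obj Y (Suc n))"
    using sn by (simp add: f' g' en)
  \<comment> \<open>This transports the vanishing of \<Sigma>d followed after \<delta> from X to
    Y.\<close>
  have d0: "Dif Y 0 = f (Suc 0) \<cdot> Dif X 0" using f'(1)[of 0] f'(2) by (simp add: e0)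
  show ?thesis
  proof (rule homotopy_retract_angle[OF X Ys gm fm, of s])
    show "f 0 \<cdot> g 0 = Id D (Obj ?Y 0) \<oplus> s 0 \<cdot> Dif ?Y 0"
      by (simp add: f' g' e0 s0'[unfolded e0])
    show "f (Suc j) \<cdot> g (Suc j) = Id D (Obj ?Y (Suc j)) \<oplus> (Dif ?Y j \<cdot> s j \<oplus> s (Suc j) \<cdot>
      Dif ?Y (Suc j))"
      if "j < n" for j
    proof -
      have [simp]: "j \<le> n" "j \<le> Suc n" "Suc j \<le> n" using that by linarith+
      show ?thesis
        by (rule iffD1[OF diff_eq_iff]) (use sj[OF that] that in simp_all)
    qed
    show "f (Suc n) \<cdot> g (Suc n) = Id D (Obj ?Y (Suc n)) \<oplus> Dif ?Y n \<cdot> s n"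
      by (simp add: f' g' en sn'[unfolded en])
    show "Dif ?Y n \<cdot> s n = zm (Obj ?Y (Suc n)) (Obj ?Y (Suc n))" using sn' by simp
    show "Dif ?Y (Suc j) \<cdot> Dif ?Y j = zm (Obj ?Y j) (Obj ?Y (Suc (Suc j)))" if "j < n" for j
      using Y that by (simp add: complex_def)
    show "SM (Dif ?Y 0) \<cdot> Dif ?Y (Suc n) = zm (Obj ?Y (Suc n)) (S (Obj ?Y (Suc 0)))"
      using SM_Dif_Dif[OF X] by (simp add: d0 en)
  qed (use s in \<open>simp_all add: g'\<close>)
qed

lemma homotopy_equivalent_refl:
  assumes "complex D n X"
  shows "homotopy_equivalent D n (Obj X 0) (Obj X (Suc n)) X X"
proof -
  \<comment> \<open>Adding a zero last map makes X a \<Sigma>-sequence, to which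
    \<open>null_homotopicI\<close> applies.\<close>
  let ?X = "with_ext X (zm (Obj X (Suc n)) (S (Obj X 0)))"
  have [simp]: "i \<le> Suc n \<Longrightarrow> Obj X i \<in> Ob D" for i using assms by (simp add: complex_def)
  have Xs: "seq ?X" using assms by (rule seq_with_ext) simp_all
  have [simp]: "i \<le> n \<Longrightarrow> arrow (Dif X i)" "i \<le> n \<Longrightarrow> src (Dif X i) = Obj X i"
    "i \<le> n \<Longrightarrow> tgt (Dif X i) = Obj X (Suc i)" for i
    using seqD(2-4)[OF Xs, of i] by simp_all
  let ?I = "\<lambda>i. Id D (Obj X i)"
  have 1: "chain_map_between D n (Obj X 0) (Obj X (Suc n)) X X ?I"
    by (simp add: chain_map_between_def chain_map_def)
  have "null_homotopic D n ?X ?X (\<lambda>i. add_mor D (Obj X i) (Obj X i) (?I i \<cdot>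
    ?I i) (neg_mor D (Obj X i) (Obj X i) (?I i)))"
    by (rule null_homotopicI[OF Xs Xs, of "\<lambda>j. zm (Obj X (Suc j)) (Obj X j)"]) simp_all
  then have 2: "homotopic_maps D n X X (\<lambda>i. ?I i \<cdot> ?I i) ?I"
    by (simp add: homotopic_maps_def)
  show ?thesis unfolding homotopy_equivalent_def
    by (intro exI[of _ ?I] conjI 1 2)
qed

end

section \<open>Extension closed subcategories\<close>

locale extension_closed_subcategory = positive_angulated_category n D \<Sigma> P
  for n :: nat
    and D :: "('o, 'm) addcat" (structure)
    and \<Sigma> :: "('o, 'm) endofunctor"
    and P :: "('o, 'm) chain set" +
  fixes \<B> :: "'o set"
  assumes sub_additive: "additive_subcategory D \<B>"
    and sub_extension_closed: "extension_closed n D \<Sigma> P \<B>"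
begin

abbreviation E :: "('o, 'm) addcat" where "E \<equiv> full_subcategory D \<B>"
abbreviation G :: "('o, 'm, 'm) bifunctor" where "G \<equiv> G_shift D \<Sigma>"
abbreviation r :: "'o \<Rightarrow> 'o \<Rightarrow> 'm \<Rightarrow> ('o, 'm) chain set" where "r \<equiv> r_sub n D P \<B>"

lemma sub_ob [simp]: "A \<in> \<B> \<Longrightarrow> A \<in> Ob D"
  and sub_Zer [simp]: "Zer D \<in> \<B>"
  and sub_Sum [simp]: "\<lbrakk>A \<in> \<B>; B \<in> \<B>\<rbrakk> \<Longrightarrow> Sum D A B \<in> \<B>"
  using sub_additive by (auto simp: additive_subcategory_def)

lemma E_simps [simp]:
  "Ob E = \<B>" "Hom E = Hom D" "Comp E = Comp D" "Id E = Id D" "Zer E = Zer D" "Sum E = Sum D"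
  "In1 E = In1 D" "In2 E = In2 D" "Pr1 E = Pr1 D" "Pr2 E = Pr2 D"
  by (simp_all add: full_subcategory_def)

lemma E_constructions [simp]:
  "col E = col D" "row E = row D" "matrix22 E = matrix22 D" "triv E = triv D"
  "mapping_cone n E = mapping_cone n D" "mapping_cocone n E = mapping_cocone n D"
proof -
  show c: "col E = col D" and r: "row E = row D" by (simp_all add: col_def row_def fun_eq_iff)
  show m: "matrix22 E = matrix22 D" by (simp add: matrix22_def fun_eq_iff c r)
  show "triv E = triv D" by (simp add: triv_def fun_eq_iff)
  show "mapping_cone n E = mapping_cone n D" "mapping_cocone n E = mapping_cocone n D"
    unfolding fun_eq_iff mapping_cone_def mapping_cocone_def E_simps c r m by simp_all
qed

lemma G_simps [simp]: "GOb G C A = Hom D C (S A)" "GMap G c a \<delta> = SM a \<cdot> \<delta> \<cdot> c"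
  by (simp_all add: G_shift_def)

lemma push_G [simp]:
  "\<lbrakk>arrow a; arrow \<delta>; src \<delta> = C; tgt \<delta> = S (src a)\<rbrakk> \<Longrightarrow> push E G C a \<delta> = SM a \<cdot> \<delta>"
  by (auto simp: push_def)

lemma pull_G [simp]:
  "\<lbrakk>arrow c; arrow \<delta>; src \<delta> = tgt c; tgt \<delta> = S A; A \<in> Ob D\<rbrakk> \<Longrightarrow> pull E G A c \<delta> = \<delta> \<cdot> c"
  by (auto simp: pull_def)

definition in_sub :: "('o, 'm) chain \<Rightarrow> bool" where
  "in_sub X \<longleftrightarrow> (\<forall>i \<le> Suc n. Obj X i \<in> \<B>)"

lemma in_subD: "in_sub X \<Longrightarrow> i \<le> Suc n \<Longrightarrow> Obj X i \<in> \<B>"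
  by (simp add: in_sub_def)

lemma complex_E: "complex E n X \<longleftrightarrow> complex D n X \<and> in_sub X"
  by (auto simp: complex_def in_sub_def simp del: mor_iff)

text \<open>\<B> is full, so chain maps and homotopies between complexes over \<B> are the same in
  both categories. Only the range of Y shrinks.\<close>

lemma homotopy_class_E:
  "homotopy_class E n X = {Y. complex D n Y \<and> in_sub Y \<and> Obj Y 0 = Obj X 0 \<and>
    Obj Y (Suc n) = Obj X (Suc n) \<and> homotopy_equivalent D n (Obj X 0) (Obj X (Suc n)) X Y}"
proof -
  have "homotopy_equivalent E n (Obj X 0) (Obj X (Suc n)) X Y =
      homotopy_equivalent D n (Obj X 0) (Obj X (Suc n)) X Y" for Y
    by (simp add: homotopy_equivalent_def homotopic_maps_def null_homotopic_def
        chain_map_between_def chain_map_def)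
  then show ?thesis by (auto simp: homotopy_class_def complexes_between_def complex_E)
qed

lemma homotopy_class_angle:
  assumes X: "with_ext X \<delta> \<in> P"
  shows "homotopy_class E n X = {Y. with_ext Y \<delta> \<in> P \<and> in_sub Y \<and> Obj Y 0 = Obj X 0 \<and>
    Obj Y (Suc n) = Obj X (Suc n)}"
proof -
  have "homotopy_equivalent D n (Obj X 0) (Obj X (Suc n)) X Y"
    if Y: "with_ext Y \<delta> \<in> P" and "Obj Y 0 = Obj X 0" "Obj Y (Suc n) = Obj X (Suc n)" for Y
  proof -
    have *: "homotopy_equivalent D n (Obj X 0) (Obj X (Suc n)) (with_ext X \<delta>) (with_ext Y \<delta>)"
      using angles_homotopy_equivalent[OF X Y] that by simp
    then show ?thesis
      by (simp add: homotopy_equivalent_def homotopic_maps_def chain_map_between_def chain_map_def)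
  qed
  then show ?thesis
    unfolding homotopy_class_E using homotopy_equivalent_angle[OF X] angle_complex by blast
qed

lemma with_ext_Dif [simp]: "with_ext X (Dif X (Suc n)) = X"
  by (simp add: with_ext_def)

lemma angles_in_iff:
  assumes "A \<in> \<B>" "C \<in> \<B>"
  shows "X \<in> angles_in n P \<B> C A \<delta> \<longleftrightarrow>
    X \<in> P \<and> Obj X 0 = A \<and> Obj X (Suc n) = C \<and> Dif X (Suc n) = \<delta> \<and> in_sub X"
proof -
  have "in_sub X \<longleftrightarrow> (\<forall>i \<in> {1..n}. Obj X i \<in> \<B>)" if "Obj X 0 = A" "Obj X (Suc n) = C"
  proof
    assume *: "\<forall>i \<in> {1..n}. Obj X i \<in> \<B>"
    show "in_sub X" unfolding in_sub_def
    proof (intro allI impI)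
      fix i assume "i \<le> Suc n"
      then consider "i = 0" | "i \<in> {1..n}" | "i = Suc n" by force
      then show "Obj X i \<in> \<B>" using that assms * by cases auto
    qed
  qed (simp add: in_sub_def)
  then show ?thesis by (auto simp: angles_in_def)
qed

lemma realising_angle:
  assumes "A \<in> \<B>" "C \<in> \<B>" "arrow \<delta>" "src \<delta> = C" "tgt \<delta> = S A"
  obtains X where "X \<in> P" "Obj X 0 = A" "Obj X (Suc n) = C" "Dif X (Suc n) = \<delta>" "in_sub X"
proof -
  have "\<delta> \<in> mor D C (S A)" using assms by simp
  then have "angles_in n P \<B> C A \<delta> \<noteq> {}"
    using sub_extension_closed assms(1,2) unfolding extension_closed_def by blast
  then show ?thesis using that angles_in_iff[OF assms(1,2)] by blast
qed

text \<open>The choice in \<open>r_sub\<close> is harmless: by \<open>homotopy_class_angle\<close>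
  the class of an angle depends only on its ends and its last map.\<close>

lemma r_eq:
  assumes X: "with_ext X \<delta> \<in> P" "in_sub X"
  shows "r (Obj X (Suc n)) (Obj X 0) \<delta> = homotopy_class E n X"
proof -
  let ?A = "Obj X 0" and ?C = "Obj X (Suc n)"
  have AC: "?A \<in> \<B>" "?C \<in> \<B>" using X(2) by (simp_all add: in_sub_def)
  have "with_ext X \<delta> \<in> angles_in n P \<B> ?C ?A \<delta>"
    using X by (simp add: angles_in_iff[OF AC]) (simp add: in_sub_def)
  then have "(SOME X. X \<in> angles_in n P \<B> ?C ?A \<delta>) \<in> angles_in n P \<B> ?C ?A \<delta>"
    by (rule someI)
  then obtain Y where Y: "Y = (SOME X. X \<in> angles_in n P \<B> ?C ?A \<delta>)"
    "Y \<in> P" "Obj Y 0 = ?A" "Obj Y (Suc n) = ?C" "Dif Y (Suc n) = \<delta>"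
    using angles_in_iff[OF AC] by blast
  have "with_ext Y \<delta> \<in> P" using Y(2,5) with_ext_Dif[of Y] by simp
  then show ?thesis
    unfolding r_sub_def Y(1)[symmetric] using homotopy_class_angle[OF X(1)]
      homotopy_class_angle[of Y \<delta>] Y(3,4)
    by simp
qed

lemma distinguished_iff:
  "distinguished n E G r X \<delta> \<longleftrightarrow> with_ext X \<delta> \<in> P \<and> in_sub X"
proof
  assume X: "with_ext X \<delta> \<in> P \<and> in_sub X"
  have "\<delta> \<in> mor D (Obj X (Suc n)) (S (Obj X 0))"
    using angle_seq[of "with_ext X \<delta>"] X by (simp add: sigma_seq_def del: mor_iff)
  then show "distinguished n E G r X \<delta>"
    using X r_eq[of X \<delta>] angle_complex[of X \<delta>]
      by (simp add: distinguished_def complex_E del: mor_iff)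
next
  assume "distinguished n E G r X \<delta>"
  then have X: "complex D n X" "in_sub X" "\<delta> \<in> mor D (Obj X (Suc n)) (S (Obj X 0))"
    and cl: "homotopy_class E n X = r (Obj X (Suc n)) (Obj X 0) \<delta>"
    by (simp_all add: distinguished_def complex_E del: mor_iff)
  have AC: "Obj X 0 \<in> \<B>" "Obj X (Suc n) \<in> \<B>" using X(2) by (simp_all add: in_sub_def)
  obtain Y where Y: "Y \<in> P" "Obj Y 0 = Obj X 0" "Obj Y (Suc n) = Obj X (Suc n)" "Dif Y (Suc n) = \<delta>"
    "in_sub Y"
    using realising_angle[OF AC, of \<delta>] X(3) AC by auto
  have Y': "with_ext Y \<delta> \<in> P" using Y(1,4) with_ext_Dif[of Y] by simp
  \<comment> \<open>By reflexivity X lies in its own class, which is also the class of the angle Y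
    and thus consists of angles.\<close>
  have "X \<in> homotopy_class E n X"
    unfolding homotopy_class_E using X homotopy_equivalent_refl by simp
  also have "\<dots> = homotopy_class E n Y" unfolding cl using r_eq[OF Y' Y(5)] Y(2,3) by simp
  finally show "with_ext X \<delta> \<in> P \<and> in_sub X" unfolding homotopy_class_angle[OF Y'] by simp
qed

lemma distinguished_angle: "\<lbrakk>X \<in> P; in_sub X\<rbrakk> \<Longrightarrow> distinguished n E G r X (Dif X (Suc n))"
  by (simp add: distinguished_iff)

section \<open>Additive structure, exangles and realisation over the subcategory\<close>

lemma additive_category_E: "additive_category E"
proof (rule additive_category.intro)
  fix A B A' B' f assume "A \<in> Ob E" "B \<in> Ob E" "A' \<in> Ob E" "B' \<in> Ob E" "f \<in> mor E A B"
    "f \<in> mor E A' B'"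
  then show "A = A' \<and> B = B'" by auto
qed (simp_all add: hom_group zero_initial zero_terminal In_Pr)

lemma biadditive_functor_E: "biadditive_functor E G"
proof -
  have "biadditive_functor_axioms E G"
  proof (rule biadditive_functor_axioms.intro)
    fix C C' A A' c a
    assume "C \<in> Ob E" "C' \<in> Ob E" "A \<in> Ob E" "A' \<in> Ob E" "c \<in> mor E C' C" "a \<in> mor E A A'"
    then show "GMap G c a \<in> hom (GOb G C A) (GOb G C' A')"
      by (auto simp: hom_def)
  qed (auto simp: hom_group)
  then show ?thesis by (rule biadditive_functor.intro[OF additive_category_E])
qed

lemma kernel_eq_imageI:
  assumes "\<And>f. \<lbrakk>f \<in> carrier A; h f = \<one>\<^bsub>B\<^esub>\<rbrakk> \<Longrightarrow> \<exists>g \<in> T. k g = f"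
    and "\<And>g. g \<in> T \<Longrightarrow> k g \<in> carrier A \<and> h (k g) = \<one>\<^bsub>B\<^esub>"
  shows "kernel A B h = k ` T"
  unfolding kernel_def using assms by blast

text \<open>Exactness is tested only on objects of \<B>, where hom groups and extension groups are
  those of D, so exactness of angles suffices.\<close>

lemma exangle_E:
  assumes "distinguished n E G r X \<delta>"
  shows "exangle n E G X \<delta>"
proof -
  let ?X = "with_ext X \<delta>"
  have X: "?X \<in> P" and Xs: "in_sub X" using assms by (simp_all add: distinguished_iff)
  note xs = seqD[OF angle_seq[OF X]]
  have [simp]: "i \<le> Suc n \<Longrightarrow> Obj X i \<in> Ob D" "i \<le> n \<Longrightarrow> arrow (Dif X i)"
    "i \<le> n \<Longrightarrow> src (Dif X i) = Obj X i" "i \<le> n \<Longrightarrow> tgt (Dif X i) = Obj X (Suc i)" for i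
    using xs(1-4)[of i] by simp_all
  have [simp]: "arrow \<delta>" "src \<delta> = Obj X (Suc n)" "tgt \<delta> = S (Obj X 0)"
    using xs(2,3)[of "Suc n"] xs(5) by simp_all
  have dd: "Dif X (Suc i) \<cdot> Dif X i = zm (Obj X i) (Obj X (Suc (Suc i)))" if "i < n" for i
    using Dif_Dif[OF X, of i] that by simp
  have ddn: "\<delta> \<cdot> Dif X n = zm (Obj X n) (S (Obj X 0))"
    using Dif_Dif[OF X, of n] by simp
  have ddS: "SM (Dif X 0) \<cdot> \<delta> = zm (Obj X (Suc n)) (S (Obj X (Suc 0)))"
    using SM_Dif_Dif[OF X] by simp
  have 1: "kernel (Hom D T (Obj X i)) (Hom D T (Obj X (i + 1))) (\<lambda>f. Dif X i \<cdot> f) =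
      (\<lambda>f. Dif X (i - 1) \<cdot> f) ` mor D T (Obj X (i - 1))" if T: "T \<in> \<B>" and i: "i \<in> {1..n}" for T i
  proof -
    obtain j where j [simp]: "i = Suc j" "j < n" "Suc j \<le> n" using i by (cases i) auto
    have [simp]: "j \<le> n" "j \<le> Suc n" "j \<noteq> n" "j \<noteq> Suc n" using j(2) by linarith+
    have [simp]: "T \<in> Ob D" using T by simp
    have "\<exists>g. arrow g \<and> src g = T \<and> tgt g = Obj X j \<and> Dif X j \<cdot> g = f"
      if "arrow f" "src f = T" "tgt f = Obj X (Suc j)"
        "Dif X (Suc j) \<cdot> f = zm T (Obj X (Suc (Suc j)))" for f
      using exact_covariant[OF X, of j f] that by simp
    moreover have "Dif X (Suc j) \<cdot> (Dif X j \<cdot> g) = zm (src g) (Obj X (Suc (Suc j)))"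
      if "arrow g" "tgt g = Obj X j" for g
      by (rule comp_zero_assoc[OF dd]) (simp_all add: that)
    ultimately show ?thesis
      by (intro kernel_eq_imageI) (simp_all add: Bex_def)
  qed
  have 2: "kernel (Hom D T (Obj X (n + 1))) (GOb G T (Obj X 0)) (\<lambda>f. pull E G (Obj X 0) f \<delta>) =
      (\<lambda>f. Dif X n \<cdot> f) ` mor D T (Obj X n)" if T: "T \<in> \<B>" for T
  proof -
    have [simp]: "T \<in> Ob D" using T by simp
    have "\<exists>g. arrow g \<and> src g = T \<and> tgt g = Obj X n \<and> Dif X n \<cdot> g = f"
      if "arrow f" "src f = T" "tgt f = Obj X (Suc n)" "\<delta> \<cdot> f = zm T (S (Obj X 0))" for f
      using exact_covariant[OF X, of n f] that by simp
    moreover have "\<delta> \<cdot> (Dif X n \<cdot> g) = zm (src g) (S (Obj X 0))"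
      if "arrow g" "tgt g = Obj X n" for g
      by (rule comp_zero_assoc[OF ddn]) (simp_all add: that)
    ultimately show ?thesis
      by (intro kernel_eq_imageI) (simp_all add: Bex_def)
  qed
  have 3: "kernel (Hom D (Obj X i) T) (Hom D (Obj X (i - 1)) T) (\<lambda>g. g \<cdot> Dif X (i - 1)) =
      (\<lambda>g. g \<cdot> Dif X i) ` mor D (Obj X (i + 1)) T" if T: "T \<in> \<B>" and i: "i \<in> {1..n}" for T i
  proof -
    obtain j where j [simp]: "i = Suc j" "j < n" "Suc j \<le> n" using i by (cases i) auto
    have [simp]: "j \<le> n" "j \<le> Suc n" "j \<noteq> n" "j \<noteq> Suc n" using j(2) by linarith+
    have [simp]: "T \<in> Ob D" using T by simp
    have "\<exists>g. arrow g \<and> src g = Obj X (Suc (Suc j)) \<and> tgt g = T \<and> g \<cdot> Dif X (Suc j) = f"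
      if "arrow f" "tgt f = T" "src f = Obj X (Suc j)" "f \<cdot> Dif X j = zm (Obj X j) T" for f
      using exact_contravariant[OF X, of j f] that by simp
    moreover have "g \<cdot> (Dif X (Suc j) \<cdot> Dif X j) = zm (Obj X j) (tgt g)"
      if "arrow g" "src g = Obj X (Suc (Suc j))" for g
      by (simp add: dd that)
    ultimately show ?thesis
      by (intro kernel_eq_imageI) (simp_all add: Bex_def)
  qed
  have 4: "kernel (Hom D (Obj X 0) T) (GOb G (Obj X (n + 1)) T) (\<lambda>g. push E G (Obj X (n + 1)) g \<delta>) =
      (\<lambda>g. g \<cdot> Dif X 0) ` mor D (Obj X 1) T" if T: "T \<in> \<B>" for T
  proof -
    have [simp]: "T \<in> Ob D" using T by simp
    have "\<exists>h. arrow h \<and> src h = Obj X (Suc 0) \<and> tgt h = T \<and> h \<cdot> Dif X 0 = g"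
      if "arrow g" "tgt g = T" "src g = Obj X 0" "SM g \<cdot> \<delta> = zm (Obj X (Suc n)) (S T)" for g
      using exact_contravariant_0[OF X, of g] that by simp
    moreover have "SM g \<cdot> (SM (Dif X 0) \<cdot> \<delta>) = zm (Obj X (Suc n)) (S (tgt g))"
      if "arrow g" "src g = Obj X (Suc 0)" for g
      by (simp add: ddS that)
    ultimately show ?thesis
      by (intro kernel_eq_imageI) (simp_all add: Bex_def)
  qed
  have 5: "complex E n X" using angle_complex[OF X] Xs by (simp add: complex_E)
  have 6: "push E G (Obj X (n + 1)) (Dif X 0) \<delta> = \<one>\<^bsub>GOb G (Obj X (n + 1)) (Obj X 1)\<^esub>"
    "pull E G (Obj X 0) (Dif X n) \<delta> = \<one>\<^bsub>GOb G (Obj X n) (Obj X 0)\<^esub>"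
    by (simp_all add: ddS ddn)
  have 7: "\<delta> \<in> carrier (GOb G (Obj X (n + 1)) (Obj X 0))" by simp
  show ?thesis
    unfolding exangle_def E_simps by (intro conjI ballI 1 2 3 4 5 6 7; assumption)
qed

lemma lift_E:
  assumes "seq_map (with_ext X \<delta>) (with_ext Y \<rho>) f" "with_ext X \<delta> \<in> P" "with_ext Y \<rho> \<in> P"
    "f 0 = a" "f (Suc n) = c"
  shows "lift E n X Y a c f"
  using chain_map_seq_map[OF angle_seq[OF assms(2)] angle_seq[OF assms(3)] assms(1)] assms(4,5)
  by (simp add: lift_def chain_map_def del: mor_iff)

lemma exact_realisation_E: "exact_realisation n E G r"
proof -
  have "exact_realisation_axioms n E G r"
  proof (rule exact_realisation_axioms.intro)
    fix C A \<delta> assume "C \<in> Ob E" "A \<in> Ob E" "\<delta> \<in> carrier (GOb G C A)"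
    then obtain X where X: "X \<in> P" "Obj X 0 = A" "Obj X (Suc n) = C" "Dif X (Suc n) = \<delta>" "in_sub X"
      using realising_angle[of A C \<delta>] by auto
    then have "with_ext X \<delta> \<in> P" using with_ext_Dif[of X] by simp
    then have "complex D n X" "r C A \<delta> = homotopy_class E n X"
      using angle_complex r_eq[of X \<delta>] X by simp_all
    then show "\<exists>X \<in> complexes_between E n A C. r C A \<delta> = homotopy_class E n X"
      using X by (intro bexI[of _ X]) (simp_all add: complexes_between_def complex_E)
  next
    fix X Y \<delta> \<rho> a c
    assume "distinguished n E G r X \<delta>" "distinguished n E G r Y \<rho>"
      and m: "ext_morphism E G (Obj X (n + 1)) (Obj X 0) \<delta> (Obj Y (n + 1)) (Obj Y 0) \<rho> a c"
    then have X: "with_ext X \<delta> \<in> P" "in_sub X" and Y: "with_ext Y \<rho> \<in> P" "in_sub Y"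
      by (simp_all add: distinguished_iff)
    note [simp] = in_subD[OF X(2)] in_subD[OF Y(2)]
    have [simp]: "arrow \<delta>" "src \<delta> = Obj X (Suc n)" "tgt \<delta> = S (Obj X 0)"
      "arrow \<rho>" "src \<rho> = Obj Y (Suc n)" "tgt \<rho> = S (Obj Y 0)"
      using seqD(2,3)[OF angle_seq[OF X(1)], of "Suc n"] seqD(2,3)[OF angle_seq[OF Y(1)], of
        "Suc n"]
        seqD(5)[OF angle_seq[OF X(1)]] seqD(5)[OF angle_seq[OF Y(1)]]
      by simp_all
    have [simp]: "arrow a" "src a = Obj X 0" "tgt a = Obj Y 0" "arrow c" "src c = Obj X (Suc n)"
      "tgt c = Obj Y (Suc n)"
      using m by (simp_all add: ext_morphism_def)
    have "SM a \<cdot> \<delta> = \<rho> \<cdot> c" using m by (simp add: ext_morphism_def)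
    then obtain \<phi> where "seq_map (with_ext X \<delta>) (with_ext Y \<rho>) \<phi>" "\<phi> 0 = a" "\<phi> (Suc n) = c"
      using F4_ends[OF X(1) Y(1), of a c] by auto
    then show "\<exists>f. lift E n X Y a c f" using lift_E X(1) Y(1) by blast
  next
    fix X \<delta> assume "distinguished n E G r X \<delta>"
    then show "exangle n E G X \<delta>" by (rule exangle_E)
  next
    fix A assume A: "A \<in> Ob E"
    \<comment> \<open>Since n >= 1, degree n + 1 lies beyond the two copies of A and holds the zero
      object.\<close>
    have "agree (triv_seq 0 A) (with_ext (triv D 0 A) (zm (Zer D) (S A)))"
      using n_pos by (auto simp: agree_def triv_seq_def le_Suc_eq) (auto simp: triv_def)
    then have "with_ext (triv D 0 A) (zm (Zer D) (S A)) \<in> P"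
      using triv_angle[of A 0] A agree_angle by simp
    moreover have "in_sub (triv D 0 A)" using A by (simp add: in_sub_def triv_def)
    ultimately show "r (Zer E) A (\<one>\<^bsub>GOb G (Zer E) A\<^esub>) = homotopy_class E n (triv E 0 A)"
      using r_eq[of "triv D 0 A"] n_pos by (simp add: triv_def)
  next
    fix C assume C: "C \<in> Ob E"
    \<comment> \<open>Since n >= 1, degree 0 lies before the two copies of C and holds the zero
      object.\<close>
    have "agree (triv_seq n C) (with_ext (triv D n C) (zm C (S (Zer D))))"
      using n_pos by (auto simp: agree_def triv_seq_def le_Suc_eq) (auto simp: triv_def)
    then have "with_ext (triv D n C) (zm C (S (Zer D))) \<in> P"
      using triv_angle[of C n] C agree_angle by simp
    moreover have "in_sub (triv D n C)" using C by (simp add: in_sub_def triv_def)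
    ultimately show "r C (Zer E) (\<one>\<^bsub>GOb G C (Zer E)\<^esub>) = homotopy_class E n (triv E n C)"
      using r_eq[of "triv D n C"] n_pos by (simp add: triv_def)
  qed
  then show ?thesis by (rule exact_realisation.intro[OF biadditive_functor_E])
qed

section \<open>(EA2) and its dual\<close>

lemma mapping_cone_with_ext [simp]:
  "mapping_cone n D (with_ext X \<delta>) (with_ext Y \<rho>) f = mapping_cone n D X Y f"
proof -
  \<comment> \<open>The cone starts with \<open>Dif X 1\<close>, which is the overwritten map if n =
    0.\<close>
  have "n \<noteq> 0" using n_pos by linarith
  then show ?thesis
    unfolding mapping_cone_def Let_def with_ext_simps(1) by (simp cong: if_cong)
qed

lemma mapping_cocone_with_ext [simp]:
  "mapping_cocone n D (with_ext X \<delta>) (with_ext Y \<rho>) f = mapping_cocone n D X Y f"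
proof -
  have [simp]: "i < n \<Longrightarrow> Dif (with_ext Y \<rho>) (i - Suc 0) = Dif Y (i - Suc 0)"
    "Dif (with_ext Y \<rho>) (n - Suc 0) = Dif Y (n - Suc 0)" for i
    by (rule with_ext_simps(2); linarith)+
  show ?thesis
    unfolding mapping_cocone_def Let_def with_ext_simps(1) by (simp cong: if_cong)
qed

lemma in_sub_mapping_cone:
  assumes "in_sub X" "in_sub Y"
  shows "in_sub (mapping_cone n D X Y f)"
  unfolding in_sub_def using in_subD[OF assms(1)] in_subD[OF assms(2)] n_pos
  by (simp add: mapping_cone_def Let_def)

lemma in_sub_mapping_cocone:
  assumes "in_sub X" "in_sub Y"
  shows "in_sub (mapping_cocone n D X Y f)"
  unfolding in_sub_def using in_subD[OF assms(1)] in_subD[OF assms(2)] n_pos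
  by (simp add: mapping_cocone_def Let_def)

lemma in_sub_with_ext [simp]: "in_sub (with_ext X \<delta>) = in_sub X"
  by (simp add: in_sub_def)

lemma EA2_E:
  assumes Y: "distinguished n E G r Y \<rho>" and e: "Obj X 0 = Obj Y 0"
    and c: "c \<in> mor E (Obj X (n + 1)) (Obj Y (n + 1))"
    and X: "distinguished n E G r X (pull E G (Obj Y 0) c \<rho>)"
  shows "\<exists>f. lift E n X Y (Id E (Obj X 0)) c f \<and>
    distinguished n E G r (mapping_cone n E X Y f) (push E G (Obj Y (n + 1)) (Dif X 0) \<rho>)"
proof -
  have Y': "with_ext Y \<rho> \<in> P" "in_sub Y" using Y by (simp_all add: distinguished_iff)
  have X': "with_ext X (pull E G (Obj Y 0) c \<rho>) \<in> P" "in_sub X" using X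
    by (simp_all add: distinguished_iff)
  note [simp] = in_subD[OF X'(2)] in_subD[OF Y'(2)] e
  have [simp]: "arrow \<rho>" "src \<rho> = Obj Y (Suc n)" "tgt \<rho> = S (Obj Y 0)"
    using seqD(2,3)[OF angle_seq[OF Y'(1)], of "Suc n"] seqD(5)[OF angle_seq[OF Y'(1)]] by simp_all
  have [simp]: "arrow c" "src c = Obj X (Suc n)" "tgt c = Obj Y (Suc n)" using c by simp_all
  let ?\<delta> = "pull E G (Obj Y 0) c \<rho>"
  have d: "?\<delta> = \<rho> \<cdot> c" by simp
  have [simp]: "arrow (Dif X 0)" "src (Dif X 0) = Obj Y 0" "tgt (Dif X 0) = Obj X (Suc 0)"
    using seqD(2-4)[OF angle_seq[OF X'(1)], of 0] by simp_all
  obtain \<phi> where \<phi>: "seq_map (with_ext X ?\<delta>) (with_ext Y \<rho>) \<phi>" "\<phi> 0 = Id D (Obj X 0)"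
    "\<phi> (Suc n) = c"
    "cn (with_ext X ?\<delta>) (with_ext Y \<rho>) \<phi> \<in> P"
    by (rule F4_ends[OF X'(1) Y'(1), of "Id D (Obj X 0)" c]) simp_all
  have "with_ext (mapping_cone n D X Y \<phi>) (SM (Dif X 0) \<cdot> \<rho>) \<in> P"
    using mapping_cone_angle[OF X'(1) Y'(1) \<phi>(1,4)] \<phi>(2) by simp
  then have "distinguished n E G r (mapping_cone n E X Y \<phi>) (push E G (Obj Y (n + 1)) (Dif X 0) \<rho>)"
    using in_sub_mapping_cone[OF X'(2) Y'(2)] by (simp add: distinguished_iff)
  moreover have "lift E n X Y (Id E (Obj X 0)) c \<phi>"
    using lift_E[OF \<phi>(1) X'(1) Y'(1)] \<phi>(2,3) by simp
  ultimately show ?thesis by blast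
qed

lemma EA2_op_E:
  assumes X: "distinguished n E G r X \<delta>" and e: "Obj X (n + 1) = Obj Y (n + 1)"
    and a: "a \<in> mor E (Obj X 0) (Obj Y 0)"
    and Y: "distinguished n E G r Y (push E G (Obj X (n + 1)) a \<delta>)"
  shows "\<exists>f. lift E n X Y a (Id E (Obj X (n + 1))) f \<and>
    distinguished n E G r (mapping_cocone n E X Y f) (pull E G (Obj X 0) (Dif Y n) \<delta>)"
proof -
  let ?\<rho> = "push E G (Obj X (n + 1)) a \<delta>"
  have X': "with_ext X \<delta> \<in> P" "in_sub X" using X by (simp_all add: distinguished_iff)
  have Y': "with_ext Y ?\<rho> \<in> P" "in_sub Y" using Y by (simp_all add: distinguished_iff)
  note [simp] = in_subD[OF X'(2)] in_subD[OF Y'(2)]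
  have [simp]: "Obj X (Suc n) = Obj Y (Suc n)" using e by simp
  have [simp]: "arrow \<delta>" "src \<delta> = Obj Y (Suc n)" "tgt \<delta> = S (Obj X 0)"
    using seqD(2,3)[OF angle_seq[OF X'(1)], of "Suc n"] seqD(5)[OF angle_seq[OF X'(1)]] by simp_all
  have [simp]: "arrow a" "src a = Obj X 0" "tgt a = Obj Y 0" using a by simp_all
  have [simp]: "arrow (Dif Y n)" "src (Dif Y n) = Obj Y n" "tgt (Dif Y n) = Obj Y (Suc n)"
    using seqD(2-4)[OF angle_seq[OF Y'(1)], of n] by simp_all
  obtain \<phi> where \<phi>: "seq_map (with_ext X \<delta>) (with_ext Y ?\<rho>) \<phi>" "\<phi> 0 = a"
    "\<phi> (Suc n) = Id D (Obj X (Suc n))"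
    "cn (with_ext X \<delta>) (with_ext Y ?\<rho>) \<phi> \<in> P"
    by (rule F4_ends[OF X'(1) Y'(1), of a "Id D (Obj X (Suc n))"]) simp_all
  have "with_ext (mapping_cocone n D X Y \<phi>) (\<delta> \<cdot> Dif Y n) \<in> P"
    using mapping_cocone_angle[OF X'(1) Y'(1) \<phi>(1,4)] \<phi>(3) by simp
  then have "distinguished n E G r (mapping_cocone n E X Y \<phi>) (pull E G (Obj X 0) (Dif Y n) \<delta>)"
    using in_sub_mapping_cocone[OF X'(2) Y'(2)] by (simp add: distinguished_iff)
  moreover have "lift E n X Y a (Id E (Obj X (n + 1))) \<phi>"
    using lift_E[OF \<phi>(1) X'(1) Y'(1)] \<phi>(2,3) by simp
  ultimately show ?thesis by blast
qed

section \<open>(EA1) and its dual\<close>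

lemma inflation_iff: "inflation n E G r f \<longleftrightarrow> (\<exists>X \<in> P. in_sub X \<and> Dif X 0 = f)"
proof
  assume "inflation n E G r f"
  then obtain X \<delta> where "with_ext X \<delta> \<in> P" "in_sub X" "Dif X 0 = f"
    by (auto simp: inflation_def distinguished_iff)
  then show "\<exists>X \<in> P. in_sub X \<and> Dif X 0 = f" by (intro bexI[of _ "with_ext X \<delta>"]) simp_all
qed (use distinguished_angle in \<open>auto simp: inflation_def\<close>)

lemma deflation_iff: "deflation n E G r f \<longleftrightarrow> (\<exists>X \<in> P. in_sub X \<and> Dif X n = f)"
proof
  assume "deflation n E G r f"
  then obtain X \<delta> where "with_ext X \<delta> \<in> P" "in_sub X" "Dif X n = f"
    by (auto simp: deflation_def distinguished_iff)
  then show "\<exists>X \<in> P. in_sub X \<and> Dif X n = f" by (intro bexI[of _ "with_ext X \<delta>"]) simp_all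
qed (use distinguished_angle in \<open>auto simp: deflation_def\<close>)

lemma inflation_comp:
  assumes "inflation n E G r f" "inflation n E G r g" "tgt f = src g"
  shows "inflation n E G r (g \<cdot> f)"
proof -
  obtain X where X: "X \<in> P" "in_sub X" "Dif X 0 = f" using assms(1) inflation_iff by blast
  obtain Y where Y: "Y \<in> P" "in_sub Y" "Dif Y 0 = g" using assms(2) inflation_iff by blast
  have Xs: "seq X" and Ys: "seq Y" using X Y by (simp_all add: angle_seq)
  note [simp] = in_subD[OF X(2)] in_subD[OF Y(2)] seqD[OF Xs] seqD[OF Ys] n_pos[simplified] Xs Ys
  have n0 [simp]: "n \<noteq> 0" "0 < n" using n_pos by linarith+
  have fg [simp]: "arrow f" "src f = Obj X 0" "tgt f = Obj X (Suc 0)" "arrow g" "src g = Obj Y 0"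
    "tgt g = Obj Y (Suc 0)"
    using X(3) Y(3) seqD(2-4)[OF Xs, of 0] seqD(2-4)[OF Ys, of 0] by simp_all
  have B [simp]: "Obj Y 0 = Obj X (Suc 0)" using assms(3) by simp
  let ?x = "Dif X (Suc 0)"
  obtain Z where Z: "Z \<in> P" "Obj Z 0 = Obj X (Suc (Suc 0))" "Obj Z (Suc n) = Obj Y (Suc n)"
      "Dif Z (Suc n) = SM ?x \<cdot> Dif Y (Suc n)" "in_sub Z"
    by (rule realising_angle[of "Obj X (Suc (Suc 0))" "Obj Y (Suc n)" "SM ?x \<cdot> Dif Y (Suc n)"])
      simp_all
  have Zs: "seq Z" using Z(1) by (rule angle_seq)
  note [simp] = in_subD[OF Z(5)] seqD[OF Zs] Z(2-4)
  obtain \<phi> where \<phi>: "seq_map Y Z \<phi>" "\<phi> 0 = ?x" "\<phi> (Suc n) = Id D (Obj Y (Suc n))" "cn Y Z \<phi> \<in> P"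
    by (rule F4_ends[OF Y(1) Z(1), of ?x "Id D (Obj Y (Suc n))"]) simp_all
  define N where "N = with_ext (mapping_cocone n D Y Z \<phi>) (Dif Y (Suc n) \<cdot> Dif Z n)"
  have N: "N \<in> P" unfolding N_def by (rule mapping_cocone_angle[OF Y(1) Z(1) \<phi>(1,4)])
    (simp_all add: \<phi>)
  have Nsub: "in_sub N" unfolding N_def using in_sub_mapping_cocone[OF Y(2) Z(5)] by simp
  have Ns: "seq N" using N by (rule angle_seq)
  have N0: "Obj N 0 = Obj X (Suc 0)" "Obj N (Suc 0) = Sum D (Obj Y (Suc 0)) (Obj X (Suc (Suc 0)))"
    "Dif N 0 = colm g ?x"
    using Y(3) by (simp_all add: N_def mapping_cocone_def Let_def \<phi>(2))
  note [simp] = in_subD[OF Nsub] seqD[OF Ns] N0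
  let ?X' = "rot X" and ?C = "Obj Y (Suc 0)" and ?X2 = "Obj X (Suc (Suc 0))"
  \<comment> \<open>The first square is Pr2 [g; x] = x. The choice of the projection puts the
    identity of \<open>?X2\<close> into \<open>Dif M 0\<close>, so that this object can be
    eliminated.\<close>
  obtain \<psi> where \<psi>: "seq_map N ?X' \<psi>" "\<psi> 0 = Id D (Obj N 0)" "\<psi> (Suc 0) = Pr2 D ?C ?X2"
    "cn N ?X' \<psi> \<in> P"
    by (rule F4_first[OF N rot_angle[OF X(1)], of "Id D (Obj N 0)" "Pr2 D ?C ?X2"]) simp_all
  define M where "M = with_ext (mapping_cone n D N ?X' \<psi>) (SM (Dif N 0) \<cdot> Dif ?X' (Suc n))"
  have M: "M \<in> P" unfolding M_def
    by (rule mapping_cone_angle[OF N rot_angle[OF X(1)] \<psi>(1,4)]) (simp_all add: \<psi>)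
  have Ms: "seq M" using M by (rule angle_seq)
  let ?d = "Dif N (Suc 0)" and ?N2 = "Obj N (Suc (Suc 0))"
  have M_ob: "Obj M 0 = Sum D ?C ?X2" "Obj M (Suc 0) = Sum D ?N2 ?X2" "Obj M (Suc n) = S (Obj X 0)"
    "\<And>i. 0 < i \<Longrightarrow> i \<le> n \<Longrightarrow> Obj M i = Sum D (Obj N (Suc i)) (Obj X (Suc i))"
    by (simp_all add: M_def mapping_cone_def Let_def)
  have Md: "Dif M 0 = colm (\<ominus> ?d) (Pr2 D ?C ?X2)"
    by (simp add: M_def mapping_cone_def Let_def numeral_2_eq_2 \<psi>(3))
  have MdS: "Dif M (Suc n) = SM (colm g ?x) \<cdot> sg n (SM f)"
    by (simp add: M_def X(3))
  note [simp] = seqD[OF Ms]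
  \<comment> \<open>These are the complements of \<open>?X2\<close> in degrees 0 and 1. The second
    entry of the row corrects for the component of \<open>Dif M 0\<close> from \<open>?X2\<close> to
    \<open>?N2\<close>.\<close>
  let ?i = "\<lambda>j. if j = 0 then In1 D ?C ?X2 else if j = Suc 0 then In1 D ?N2 ?X2 else Id D (Obj M j)"
  let ?p = "\<lambda>j. if j = 0 then Pr1 D ?C ?X2 else if j = Suc 0
    then rowm (Id D ?N2) (?d \<cdot> In2 D ?C ?X2)
    else Id D (Obj M j)"
  define V :: "('o, 'm) chain" where
    "V = \<lparr>Obj = \<lambda>j. src (?i j), Dif = \<lambda>j. cyc_map ?p (Suc j) \<cdot> (Dif M j \<cdot> ?i j)\<rparr>"
  have V: "V \<in> P"
    unfolding V_def
  proof (rule gauss_angle[OF M, of 0 "In2 D ?C ?X2" "Pr2 D ?N2 ?X2"])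
    show "In2 D ?C ?X2 \<cdot> (Pr2 D ?N2 ?X2 \<cdot> Dif M 0) \<oplus> In1 D ?C ?X2 \<cdot> Pr1 D ?C ?X2 = Id D (Obj M 0)"
      by (simp add: Md M_ob plus_commute[of "In2 D ?C ?X2 \<cdot> Pr2 D ?C ?X2"] In_Pr)
    show "Dif M 0 \<cdot> (In2 D ?C ?X2 \<cdot> Pr2 D ?N2 ?X2) \<oplus> In1 D ?N2 ?X2 \<cdot> rowm (Id D ?N2) (?d \<cdot>
      In2 D ?C ?X2) =
        Id D (Obj M (Suc 0))"
      by (simp add: Md M_ob In_colm[of ?N2 ?X2] Pr_rowm[of ?N2 ?X2])
  qed (simp_all add: Md M_ob)
  have Vs: "seq V" using V by (rule angle_seq)
  \<comment> \<open>The last object of V is \<Sigma> of \<open>Obj X 0\<close>, which need not lie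
    in \<B>; right rotation turns it into \<open>Obj X 0\<close> in degree 0.\<close>
  obtain R where R: "seq R" "agree (rot R) V" using right_rotation[OF Vs] .
  note R' = right_rotationD[OF R]
  note [simp] = seqD[OF R(1)]
  have Vn: "Obj V (Suc n) = S (Obj X 0)" by (simp add: V_def M_ob)
  have R0: "Obj R 0 = Obj X 0"
  proof -
    have "inj_on S (Ob D)" using F_ob by (rule bij_betw_imp_inj_on)
    then show ?thesis by (rule inj_onD) (simp_all add: R'(1) Vn)
  qed
  have "in_sub R" unfolding in_sub_def
  proof (intro allI impI)
    fix i assume i: "i \<le> Suc n"
    show "Obj R i \<in> \<B>"
    proof (cases i)
      case (Suc j)
      then show ?thesis using i M_ob(4)[of j] by (auto simp: R'(2) V_def)
    qed (simp add: R0)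
  qed
  moreover have "R \<in> P" using right_rotation_angle[OF R V] .
  moreover have "Dif R 0 = g \<cdot> f"
  proof (rule SM_inj)
    \<comment> \<open>Behind the last map the projection of degree 0 reappears as \<Sigma> of Pr1
      and selects g from the column.\<close>
    have "Dif V (Suc n) = SM (Pr1 D ?C ?X2) \<cdot> (SM (colm g ?x) \<cdot> sg n (SM f))"
      by (simp add: V_def MdS M_ob)
    also have "\<dots> = SM (Pr1 D ?C ?X2 \<cdot> colm g ?x) \<cdot> sg n (SM f)"
      by (simp del: Pr_colm)
    also have "\<dots> = sg n (SM g \<cdot> SM f)" by simp
    finally show "SM (Dif R 0) = SM (g \<cdot> f)" by (simp add: R'(4))
  qed (use R'(2)[of 0] in \<open>simp_all add: R0 V_def\<close>)
  ultimately show ?thesis using inflation_iff by blast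
qed

text \<open>With w the map of Y into the source of g, pulling X back along w gives an angle M over
  \<B> that ends with the row [w, f]. The cocone of a morphism from the right rotation of Y to M has
  last map g [w, f] = [0, g f]. Eliminating the source of w leaves an angle with last map g f, and
  its left rotation has g f in position n.\<close>

lemma deflation_comp:
  assumes "deflation n E G r f" "deflation n E G r g" "tgt f = src g"
  shows "deflation n E G r (g \<cdot> f)"
proof -
  obtain X where X: "X \<in> P" "in_sub X" "Dif X n = f" using assms(1) deflation_iff by blast
  obtain Y where Y: "Y \<in> P" "in_sub Y" "Dif Y n = g" using assms(2) deflation_iff by blast
  have Xs: "seq X" and Ys: "seq Y" using X Y by (simp_all add: angle_seq)
  note [simp] = in_subD[OF X(2)] in_subD[OF Y(2)] seqD[OF Xs] seqD[OF Ys] n_pos[simplified]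
  have n0 [simp]: "n \<noteq> 0" "0 < n" using n_pos by linarith+
  let ?n = "n - Suc 0"
  have n1 [simp]: "Suc ?n = n" "?n \<le> n" "?n < n" "?n \<le> Suc n" using n0 by linarith+
  have fg [simp]: "arrow f" "src f = Obj X n" "tgt f = Obj X (Suc n)" "arrow g" "src g = Obj Y n"
    "tgt g = Obj Y (Suc n)"
    using X(3) Y(3) seqD(2-4)[OF Xs, of n] seqD(2-4)[OF Ys, of n] by simp_all
  have B [simp]: "Obj Y n = Obj X (Suc n)" using assms(3) by simp
  let ?w = "Dif Y ?n"
  have w [simp]: "tgt ?w = Obj X (Suc n)" using seqD(4)[OF Ys, of ?n] by simp
  have gw: "g \<cdot> ?w = zm (Obj Y ?n) (Obj Y (Suc n))"
    using Dif_Dif[OF Y(1), of ?n] Y(3) by simp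
  obtain Z where Z: "Z \<in> P" "Obj Z 0 = Obj X 0" "Obj Z (Suc n) = Obj Y ?n"
      "Dif Z (Suc n) = Dif X (Suc n) \<cdot> ?w" "in_sub Z"
    by (rule realising_angle[of "Obj X 0" "Obj Y ?n" "Dif X (Suc n) \<cdot> ?w"]) simp_all
  have Zs: "seq Z" using Z(1) by (rule angle_seq)
  note [simp] = in_subD[OF Z(5)] seqD[OF Zs] Z(2-4)
  obtain \<phi> where \<phi>: "seq_map Z X \<phi>" "\<phi> 0 = Id D (Obj X 0)" "\<phi> (Suc n) = ?w" "cn Z X \<phi> \<in> P"
    by (rule F4_ends[OF Z(1) X(1), of "Id D (Obj X 0)" ?w]) simp_all
  define M where "M = with_ext (mapping_cone n D Z X \<phi>) (SM (Dif Z 0) \<cdot> Dif X (Suc n))"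
  have M: "M \<in> P" unfolding M_def by (rule mapping_cone_angle[OF Z(1) X(1) \<phi>(1,4)])
    (simp_all add: \<phi>)
  have Msub: "in_sub M" unfolding M_def using in_sub_mapping_cone[OF Z(5) X(2)] by simp
  have Ms: "seq M" using M by (rule angle_seq)
  let ?A = "Obj X n" and ?U = "Obj Y ?n" and ?Mn = "Obj M ?n"
  have Mn: "Obj M n = Sum D ?U ?A" "Obj M (Suc n) = Obj X (Suc n)" "Dif M n = rowm ?w f"
    using X(3) by (simp_all add: M_def mapping_cone_def Let_def \<phi>(3))
  note [simp] = in_subD[OF Msub] seqD[OF Ms] Mn
  \<comment> \<open>The rotation makes w the differential in degree n and g the last map, that is,
    the extension.\<close>
  obtain R where R: "seq R" "agree (rot R) Y" using right_rotation[OF Ys] .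
  note R' = right_rotationD[OF R]
  have RP: "R \<in> P" using right_rotation_angle[OF R Y(1)] .
  note [simp] = seqD[OF R(1)]
  have Rn [simp]: "Obj R n = ?U" "Obj R (Suc n) = Obj X (Suc n)" "Dif R n = ?w" "Dif R (Suc n) = g"
    using R'(2)[of ?n] R'(3)[of ?n] R'(2,3)[of n] Y(3) by simp_all
  \<comment> \<open>The square holds as [w, f] In1 = w. The inclusion puts the identity of
    \<open>?U\<close> into \<open>Dif L n\<close>, so that this object can be eliminated.\<close>
  obtain \<theta> where \<theta>: "seq_map R M \<theta>" "\<theta> n = In1 D ?U ?A" "\<theta> (Suc n) = Id D (Obj X (Suc n))"
    "cn R M \<theta> \<in> P"
    by (rule F4_last[OF RP M, of "In1 D ?U ?A" "Id D (Obj X (Suc n))"]) simp_all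
  define L where "L = with_ext (mapping_cocone n D R M \<theta>) (Dif R (Suc n) \<cdot> Dif M n)"
  have L: "L \<in> P" unfolding L_def by (rule mapping_cocone_angle[OF RP M \<theta>(1,4)]) (simp_all add: \<theta>)
  have Ls: "seq L" using L by (rule angle_seq)
  let ?m = "Dif M ?n"
  have m [simp]: "tgt ?m = Sum D ?U ?A" using seqD(4)[OF Ms, of ?n] by simp
  have L_ob: "Obj L 0 = Obj R 0" "Obj L n = Sum D ?U ?Mn" "Obj L (Suc n) = Sum D ?U ?A"
    "\<And>i. 0 < i \<Longrightarrow> i \<le> n \<Longrightarrow> Obj L i = Sum D (Obj R i) (Obj M (i - Suc 0))"
    by (simp_all add: L_def mapping_cocone_def Let_def)
  have Ld: "Dif L n = rowm (In1 D ?U ?A) (\<ominus> ?m)"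
    "Dif L (Suc n) = rowm (zm ?U (Obj Y (Suc n))) (g \<cdot> f)"
    by (simp_all add: L_def mapping_cocone_def Let_def \<theta>(2) gw)
  note [simp] = seqD[OF Ls]
  \<comment> \<open>This entry makes the image of the column under \<open>Dif L n\<close> lie in
    \<open>?A\<close>: its component in \<open>?U\<close> is
    \<open>?\<alpha> - ?\<alpha>\<close>.\<close>
  let ?\<alpha> = "Pr1 D ?U ?A \<cdot> ?m"
  let ?i = "\<lambda>j. if j = n then colm ?\<alpha> (Id D ?Mn) else if j = Suc n
    then In2 D ?U ?A else Id D (Obj L j)"
  let ?p = "\<lambda>j. if j = n then Pr2 D ?U ?Mn else if j = Suc n then Pr2 D ?U ?A else Id D (Obj L j)"
  define V :: "('o, 'm) chain" where
    "V = \<lparr>Obj = \<lambda>j. src (?i j), Dif = \<lambda>j. cyc_map ?p (Suc j) \<cdot> (Dif L j \<cdot> ?i j)\<rparr>"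
  have V: "V \<in> P"
    unfolding V_def
  proof (rule gauss_angle[OF L, of n "In1 D ?U ?Mn" "Pr1 D ?U ?A"])
    show "In1 D ?U ?Mn \<cdot> (Pr1 D ?U ?A \<cdot> Dif L n) \<oplus> colm ?\<alpha> (Id D ?Mn) \<cdot> Pr2 D ?U ?Mn =
      Id D (Obj L n)"
      by (simp add: Ld L_ob In_colm[of ?U ?Mn] Pr_rowm[of ?U ?Mn])
    show "Dif L n \<cdot> (In1 D ?U ?Mn \<cdot> Pr1 D ?U ?A) \<oplus> In2 D ?U ?A \<cdot> Pr2 D ?U ?A = Id D (Obj L (Suc n))"
    proof -
      have "Dif L n \<cdot> (In1 D ?U ?Mn \<cdot> Pr1 D ?U ?A) = Dif L n \<cdot> In1 D ?U ?Mn \<cdot> Pr1 D ?U ?A"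
        by (rule comp_assoc'[symmetric]) (simp_all add: L_ob)
      then show ?thesis by (simp add: Ld L_ob In_Pr)
    qed
  qed (simp_all add: Ld L_ob)
  have Vs: "seq V" using V by (rule angle_seq)
  have V0: "Obj V 0 = Obj R 0" by (simp add: V_def L_ob)
  \<comment> \<open>\<open>Obj V 0\<close> is a desuspension of \<open>Obj Y (Suc n)\<close> and
    need not lie in \<B>. Left rotation replaces it by \<open>Obj Y (Suc n)\<close> in degree n +
    1.\<close>
  have "in_sub (rot V)" unfolding in_sub_def
  proof (intro allI impI)
    fix i assume i: "i \<le> Suc n"
    consider "i = Suc n" | "i = n" | "Suc i = n" | "Suc i < n" using i by linarith
    then show "Obj (rot V) i \<in> \<B>"
    proof cases
      case 1
      then show ?thesis using R'(1) V0 by simp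
    next
      case 2
      then show ?thesis by (simp add: V_def)
    next
      case 3
      then show ?thesis by (simp add: V_def)
    next
      case 4
      then have [simp]: "i \<le> n" "i \<le> Suc n" "Suc i \<le> n" by linarith+
      show ?thesis using 4 L_ob(4)[of "Suc i"] R'(2)[of i] by (simp add: V_def)
    qed
  qed
  moreover have "rot V \<in> P" using V by (rule rot_angle)
  moreover have "Dif (rot V) n = g \<cdot> f"
    by (simp add: V_def Ld L_ob R'(1))
  ultimately show ?thesis using deflation_iff by blast
qed

lemma exangulated_category_E: "exangulated_category n E G r"
proof -
  have "exangulated_category_axioms n E G r"
  proof (rule exangulated_category_axioms.intro)
    fix A B C f g
    assume *: "A \<in> Ob E" "B \<in> Ob E" "C \<in> Ob E" "f \<in> mor E A B" "g \<in> mor E B C"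
    then have "tgt f = src g" by simp
    then show "inflation n E G r f \<Longrightarrow> inflation n E G r g \<Longrightarrow> inflation n E G r (g \<cdot>\<^bsub>E\<^esub> f)"
      and "deflation n E G r f \<Longrightarrow> deflation n E G r g \<Longrightarrow> deflation n E G r (g \<cdot>\<^bsub>E\<^esub> f)"
      using inflation_comp deflation_comp by simp_all
  qed (fact EA2_E EA2_op_E)+
  then show ?thesis by (rule exangulated_category.intro[OF exact_realisation_E])
qed

end

text \<open>The first conjunct expresses independence of the chosen angle, which the choice operator
  in \<open>r_sub\<close> would otherwise hide.\<close>

theorem corollary5p4:
  fixes n :: nat
    and D :: "('o, 'm) addcat"
    and \<Sigma> :: "('o, 'm) endofunctor"
    and P :: "('o, 'm) chain set"
    and \<B> :: "'o set"
  assumes "1 \<le> n"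
    and "angulated_category n D \<Sigma> P"
    and "additive_subcategory D \<B>"
    and "extension_closed n D \<Sigma> P \<B>"
  shows "(\<forall>A \<in> \<B>. \<forall>C \<in> \<B>. \<forall>\<delta> \<in> mor D C (FOb \<Sigma> A). \<forall>X \<in> angles_in n P \<B> C A \<delta>.
            r_sub n D P \<B> C A \<delta> = homotopy_class (full_subcategory D \<B>) n X)
       \<and> exangulated_category n (full_subcategory D \<B>) (G_shift D \<Sigma>) (r_sub n D P \<B>)"
proof -
  interpret angulated_category n D \<Sigma> P by (rule assms(2))
  interpret extension_closed_subcategory n D \<Sigma> P \<B>
    by unfold_locales (fact assms)+
  show ?thesis
  proof (intro conjI ballI)
    fix A C \<delta> X assume A: "A \<in> \<B>" and C: "C \<in> \<B>" and "X \<in> angles_in n P \<B> C A \<delta>"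
    then have X: "X \<in> P" "Obj X 0 = A" "Obj X (Suc n) = C" "Dif X (Suc n) = \<delta>" "in_sub X"
      by (simp_all add: angles_in_iff[OF A C])
    then have "with_ext X \<delta> \<in> P" using with_ext_Dif[of X] by simp
    then show "r C A \<delta> = homotopy_class E n X" using r_eq[of X \<delta>] X by simp
  qed (rule exangulated_category_E)
qed

end
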